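(* Let $(M,\omega)$ be a symplectic manifold and let $G$ be a Lie group acting symplectically on $M$ with momentum map $J:M\to\mathfrak g^*$ (relative to a non-degenerate pairing $\kappa:\mathfrak g^*\times\mathfrak g\to\mathbb R$). Let $(P,\theta)$ be a Cartan geometry over a manifold $B$, modeled on a Klein pair $(\mathfrak a,\mathfrak g)$ with group $G$, which is an orbit through $m\in M$ via the map $\chi:P\to M$, and let $\kappa_{\mathfrak a}$ be a duality of $(\mathfrak a,\mathfrak g)$. Assume that $J$ is $\mathfrak a$-equivariant (relative to $\kappa_{\mathfrak a}$). Then: (i) The $1$-form $\alpha$ on $P$ defined by $\alpha_p(X)=\kappa_{\mathfrak a}\big(J(\chi(p)),\theta_p(X)\big)$ for $p\in P$, $X\in T_pP$, is basic and hence induces a $1$-form $\check\alpha$ on $B$. (ii) We have $d\alpha=\kappa_{\mathfrak a}(J\circ\chi,\Omega)$, where $\Omega=d\theta-\frac12[\theta\wedge\theta]\in\Omega^2(P,\mathfrak a)$ is the curvature of $\theta$. In particular, if $\theta$ is torsion-free, then $d\alpha=0$ and $d\check\alpha=0$. (iii) If $B$ is simply connected and $\theta$ is torsion-free, then there exists a function $\Psi_m:B\to\mathbb R$ such that $\check\alpha=d\Psi_m$.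
   Context: Manifolds and Lie groups are smooth and possibly infinite-dimensional (modeled on locally convex spaces); linear and bilinear maps between topological vector spaces are understood to be continuous. A Klein pair $(\mathfrak a,\mathfrak g)$ with group $G$ consists of a Lie algebra $\mathfrak a$, a Lie subalgebra $\mathfrak g\subseteq\mathfrak a$ which is closed and has a closed topological complement, a Lie group $G$ with Lie algebra $\mathfrak g$, and a representation $\mathrm{Ad}$ of $G$ on $\mathfrak a$ restricting to the adjoint representation on $\mathfrak g$. ($\mathfrak a$ need not integrate to a Lie group.) A Cartan geometry $(P,\theta)$ modeled on $(\mathfrak a,\mathfrak g)$ with group $G$ on a manifold $B$ is a left principal $G$-bundle $\pi:P\to B$ with a $1$-form $\theta\in\Omega^1(P,\mathfrak a)$ such that $\theta_p:T_pP\to\mathfrak a$ is an isomorphism for all $p$, $\theta_{g\cdot p}(g\cdot X)=\mathrm{Ad}_g\theta_p(X)$ for all $g \in G$, $X\in T_pP$, and $\theta(\xi^* )=\xi$ for $\xi\in\mathfrak g$, where $\xi^*$ is the fundamental vector field. Here $\frac12[\theta\wedge\theta](X,Y)=[\theta(X),\theta(Y)]$, and $\theta$ is torsion-free if its curvature $\Omega$ takes values in $\mathfrak g$. A form on $P$ is basic if it is the pull-back along $\pi$ of a form on $B$. $(P,\theta)$ is an orbit through $m\in M$ (where $G$ acts on $M$) if (i) there is a smooth $G$-equivariant map $\chi:P\to M$ whose image contains $m$; (ii) there is a Lie subalgebra $\mathfrak a_m\subseteq\mathfrak a$ and a right Lie algebra action of $\mathfrak a_m$ on $P$, $\zeta\mapsto\zeta^*$,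 commuting with the $G$-action and satisfying $T\chi(\zeta^* )=0$. Put $\rho_p(\xi):=T_p\chi(\theta_p^{-1}(\xi))\in T_{\chi(p)}M$ for $\xi\in\mathfrak a$. A momentum map relative to $\kappa$ is a smooth map $J:M\to\mathfrak g^*$ with $\omega_m(\xi\cdot m,X)+\kappa(T_mJ(X),\xi)=0$ for all $m\in M$, $X\in T_mM$, $\xi\in\mathfrak g$; here $\mathfrak g^*$ is a chosen vector space non-degenerately paired with $\mathfrak g$ by $\kappa$ (not necessarily the topological dual), and the coadjoint action on $\mathfrak g^*$ is dual to $\mathrm{Ad}$ via $\kappa$. Its non-equivariance $1$-cocycle $\sigma:G\to\mathfrak g^*$ is given by $J(g\cdot m)=\mathrm{Ad}^*_{g^{-1}}J(m)+\sigma(g)$ (independent of $m$). A duality of $(\mathfrak a,\mathfrak g)$ is an $\mathrm{Ad}_G$-invariant bilinear map $\kappa_{\mathfrak a}:\mathfrak g^*\times\mathfrak a\to\mathbb R$ vanishing on $\mathfrak g^*\times\mathfrak g$. The Calabi operator is $C_p:=T_{\chi(p)}J\circ\rho_p:\mathfrak a\to\mathfrak g^*$. $J$ is $\mathfrak a$-equivariant relative to $\kappa_{\mathfrak a}$ if $\kappa_{\mathfrak a}(C_p\xi,\eta)-\kappa_{\mathfrak a}(C_p\eta,\xi)=-\kappa_{\mathfrak a}(J(\chi(p)),[\xi,\eta])$ for all $p\in P$, $\xi,\eta\in\mathfrak a$, and $\kappa_{\mathfrak a}(\sigma(g),\xi)=0$ for all $g\in G$, $\xi\in\mathfrak a$.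 *)

theory Defs
  imports "HOL-Analysis.Analysis" "HOL-Algebra.Group"
begin

section \<open>Calculus on locally convex spaces\<close>

text \<open>Locally convex spaces are real and Hausdorff.\<close>

class locally_convex_space = real_vector + topological_ab_group_add + t2_space +
  assumes tendsto_scaleR_Pair:
      "LIM z (nhds a \<times>\<^sub>F nhds x). fst z *\<^sub>R snd z :> nhds (a *\<^sub>R x)"
    and convex_nhds_0_raw:
      "open U \<Longrightarrow> 0 \<in> U \<Longrightarrow> \<exists>V. open V \<and> 0 \<in> V \<and> V \<subseteq> U \<and>
        (\<forall>x\<in>V. \<forall>y\<in>V. \<forall>u\<ge>0. \<forall>v\<ge>0. u + v = 1 \<longrightarrow> u *\<^sub>R x + v *\<^sub>R y \<in> V)"

lemma convex_nhds_0:
  fixes U :: "'a::locally_convex_space set"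
  shows "open U \<Longrightarrow> 0 \<in> U \<Longrightarrow> \<exists>V. open V \<and> 0 \<in> V \<and> V \<subseteq> U \<and> convex V"
  unfolding convex_def by (rule convex_nhds_0_raw)

instance real :: locally_convex_space
proof
  fix a x :: real
  show "LIM z (nhds a \<times>\<^sub>F nhds x). fst z *\<^sub>R snd z :> nhds (a *\<^sub>R x)"
    by (intro tendsto_scaleR filterlim_fst filterlim_snd)
next
  fix U :: "real set"
  assume "open U" "0 \<in> U"
  then obtain e where "e > 0" "ball 0 e \<subseteq> U"
    by (meson openE)
  then show "\<exists>V. open V \<and> 0 \<in> V \<and> V \<subseteq> U \<and>
      (\<forall>x\<in>V. \<forall>y\<in>V. \<forall>u\<ge>0. \<forall>v\<ge>0. u + v = 1 \<longrightarrow> u *\<^sub>R x + v *\<^sub>R y \<in> V)"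
    unfolding convex_def[symmetric] by (intro exI[of _ "ball 0 e"]) auto
qed

instance prod :: (topological_monoid_add, topological_monoid_add) topological_monoid_add
proof
  fix a b :: "'a \<times> 'b"
  show "LIM x (nhds a \<times>\<^sub>F nhds b). fst x + snd x :> nhds (a + b)"
    unfolding plus_prod_def
    by (intro tendsto_Pair tendsto_add tendsto_fst tendsto_snd filterlim_fst filterlim_snd)
qed

instance prod :: (topological_comm_monoid_add, topological_comm_monoid_add) topological_comm_monoid_add ..

instance prod :: (topological_group_add, topological_group_add) topological_group_add
proof
  fix a :: "'a \<times> 'b"
  have "((\<lambda>x::'a \<times> 'b. (- fst x, - snd x)) \<longlongrightarrow> (- fst a, - snd a)) (nhds a)"
    by (intro tendsto_Pair tendsto_minus tendsto_fst tendsto_snd) (auto intro: filterlim_ident)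
  then show "(uminus \<longlongrightarrow> - a) (nhds a)"
    by (simp add: uminus_prod_def[abs_def])
qed

instance prod :: (topological_ab_group_add, topological_ab_group_add) topological_ab_group_add ..

instance prod :: (locally_convex_space, locally_convex_space) locally_convex_space
proof
  fix r :: real and x :: "'a \<times> 'b"
  have 1: "LIM z (nhds r \<times>\<^sub>F nhds x). fst z *\<^sub>R f (snd z) :> nhds (r *\<^sub>R f x)"
    if "(f \<longlongrightarrow> f x) (nhds x)" for f :: "'a \<times> 'b \<Rightarrow> 'c::locally_convex_space"
  proof -
    have "filterlim (\<lambda>z. (fst z, f (snd z))) (nhds r \<times>\<^sub>F nhds (f x)) (nhds r \<times>\<^sub>F nhds x)"
      by (intro filterlim_Pair filterlim_fst filterlim_compose[OF that filterlim_snd])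
    from filterlim_compose[OF tendsto_scaleR_Pair this] show ?thesis
      by simp
  qed
  have "LIM z (nhds r \<times>\<^sub>F nhds x). (fst z *\<^sub>R fst (snd z), fst z *\<^sub>R snd (snd z))
      :> nhds (r *\<^sub>R fst x, r *\<^sub>R snd x)"
    by (intro tendsto_Pair 1 tendsto_fst tendsto_snd) (auto intro: filterlim_ident)
  then show "LIM z (nhds r \<times>\<^sub>F nhds x). fst z *\<^sub>R snd z :> nhds (r *\<^sub>R x)"
    by (simp add: scaleR_prod_def)
next
  fix U :: "('a \<times> 'b) set"
  assume "open U" "0 \<in> U"
  then obtain A B where AB: "open A" "open B" "(0::'a) \<in> A" "(0::'b) \<in> B" "A \<times> B \<subseteq> U"
    unfolding zero_prod_def by (metis open_prod_elim mem_Sigma_iff)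
  obtain A' where A': "open A'" "0 \<in> A'" "A' \<subseteq> A" "convex A'"
    using convex_nhds_0[OF AB(1,3)] by blast
  obtain B' where B': "open B'" "0 \<in> B'" "B' \<subseteq> B" "convex B'"
    using convex_nhds_0[OF AB(2,4)] by blast
  show "\<exists>V. open V \<and> 0 \<in> V \<and> V \<subseteq> U \<and>
      (\<forall>x\<in>V. \<forall>y\<in>V. \<forall>u\<ge>0. \<forall>v\<ge>0. u + v = 1 \<longrightarrow> u *\<^sub>R x + v *\<^sub>R y \<in> V)"
    unfolding convex_def[symmetric] using AB A' B'
    by (intro exI[of _ "A' \<times> B'"]) (auto simp: open_Times convex_Times zero_prod_def)
qed

definition diff_quot :: "('e::locally_convex_space \<Rightarrow> 'f::locally_convex_space) \<Rightarrow> 'e \<Rightarrow> 'e \<Rightarrow> real \<Rightarrow> 'f"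
  where "diff_quot f x v t = (f (x + t *\<^sub>R v) - f x) /\<^sub>R t"

definition dderiv :: "('e::locally_convex_space \<Rightarrow> 'f::locally_convex_space) \<Rightarrow> 'e \<Rightarrow> 'e \<Rightarrow> 'f"
  where "dderiv f x v = Lim (at 0) (diff_quot f x v)"

primrec iter_dderiv ::
  "('e::locally_convex_space \<Rightarrow> 'f::locally_convex_space) \<Rightarrow> 'e list \<Rightarrow> 'e \<Rightarrow> 'f" where
  "iter_dderiv f [] = f"
| "iter_dderiv f (v # vs) = (\<lambda>x. dderiv (iter_dderiv f vs) x v)"

text \<open>Smoothness in the sense of Michal and Bastiani: on the open set \<open>U\<close> all iterated directional
  derivatives exist and, for each order \<open>k\<close>, are continuous on \<open>U \<times> E\<^sup>k\<close>. The factor \<open>E\<^sup>k\<close> is encoded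
  by the first \<open>k\<close> entries of a sequence (with the product topology on sequences).\<close>

definition smooth_on :: "'e set \<Rightarrow> ('e::locally_convex_space \<Rightarrow> 'f::locally_convex_space) \<Rightarrow> bool" where
  "smooth_on U f \<longleftrightarrow> open U \<and>
    (\<forall>vs. \<forall>x\<in>U. \<forall>v. \<exists>l. (diff_quot (iter_dderiv f vs) x v \<longlongrightarrow> l) (at 0)) \<and>
    (\<forall>k. continuous_on (U \<times> UNIV) (\<lambda>(x, w :: nat \<Rightarrow> 'e). iter_dderiv f (map w [0..<k]) x))"

definition continuous_bilinear ::
  "('e::locally_convex_space \<Rightarrow> 'f::locally_convex_space \<Rightarrow> 'h::locally_convex_space) \<Rightarrow> bool" where
  "continuous_bilinear f \<longleftrightarrow> bilinear f \<and> continuous_on UNIV (\<lambda>(x, y). f x y)"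

definition tvs_iso :: "('e::locally_convex_space \<Rightarrow> 'f::locally_convex_space) \<Rightarrow> bool" where
  "tvs_iso f \<longleftrightarrow> linear f \<and> (\<exists>h. homeomorphism UNIV UNIV f h)"

section \<open>Manifolds and differential forms\<close>

text \<open>A chart is an open set together with a map which is only relevant on that set.
  The underlying Hausdorff space of a manifold is a type.\<close>

type_synonym ('m, 'e) chart = "'m set \<times> ('m \<Rightarrow> 'e)"
type_synonym ('m, 'e) atlas = "('m, 'e) chart set"

definition manifold :: "('m::t2_space, 'e::locally_convex_space) atlas \<Rightarrow> bool" where
  "manifold A \<longleftrightarrow>
    (\<forall>(U, \<phi>)\<in>A. open U \<and> open (\<phi> ` U) \<and> homeomorphism U (\<phi> ` U) \<phi> (inv_into U \<phi>)) \<and>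
    (\<Union>(U, \<phi>)\<in>A. U) = UNIV \<and>
    (\<forall>(U, \<phi>)\<in>A. \<forall>(V, \<psi>)\<in>A. smooth_on (\<phi> ` (U \<inter> V)) (\<psi> \<circ> inv_into U \<phi>))"

definition model_atlas :: "('e, 'e) atlas" where
  "model_atlas = {(UNIV, \<lambda>x. x)}"

definition prod_atlas :: "('m, 'e) atlas \<Rightarrow> ('n, 'f) atlas \<Rightarrow> ('m \<times> 'n, 'e \<times> 'f) atlas" where
  "prod_atlas A B = {(U \<times> V, map_prod \<phi> \<psi>) |U \<phi> V \<psi>. (U, \<phi>) \<in> A \<and> (V, \<psi>) \<in> B}"

definition smooth_map_on :: "('m::t2_space, 'e::locally_convex_space) atlas \<Rightarrow> 'm set \<Rightarrow>
    ('n::t2_space, 'f::locally_convex_space) atlas \<Rightarrow> ('m \<Rightarrow> 'n) \<Rightarrow> bool" where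
  "smooth_map_on A S B f \<longleftrightarrow> open S \<and> continuous_on S f \<and>
    (\<forall>(U, \<phi>)\<in>A. \<forall>(V, \<psi>)\<in>B. smooth_on (\<phi> ` (U \<inter> S \<inter> f -` V)) (\<psi> \<circ> f \<circ> inv_into U \<phi>))"

abbreviation smooth_map :: "('m::t2_space, 'e::locally_convex_space) atlas \<Rightarrow>
    ('n::t2_space, 'f::locally_convex_space) atlas \<Rightarrow> ('m \<Rightarrow> 'n) \<Rightarrow> bool" where
  "smooth_map A B f \<equiv> smooth_map_on A UNIV B f"

text \<open>A chart around each point is chosen once and for all, and the tangent space at \<open>p\<close> is identified
  with the model space by means of the chart chosen at \<open>p\<close>. Thus a tangent vector at \<open>p\<close> is an element
  of the model space, and tangent maps are derivatives with respect to the chosen charts at source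
  and target.\<close>

definition chart_at :: "('m, 'e) atlas \<Rightarrow> 'm \<Rightarrow> ('m, 'e) chart" where
  "chart_at A p = (SOME c. c \<in> A \<and> p \<in> fst c)"

definition tangent_map :: "('m, 'e::locally_convex_space) atlas \<Rightarrow> ('n, 'f::locally_convex_space) atlas \<Rightarrow>
    ('m \<Rightarrow> 'n) \<Rightarrow> 'm \<Rightarrow> 'e \<Rightarrow> 'f" where
  "tangent_map A B f p v =
    (let (U, \<phi>) = chart_at A p; (V, \<psi>) = chart_at B (f p)
     in dderiv (\<psi> \<circ> f \<circ> inv_into U \<phi>) (\<phi> p) v)"

text \<open>Local representatives in a chart, i.e. on an open subset of the model space, of vector fields,
  \<open>1\<close>-forms and \<open>2\<close>-forms.\<close>

definition vf_rep :: "('m, 'e::locally_convex_space) atlas \<Rightarrow> ('m, 'e) chart \<Rightarrow> ('m \<Rightarrow> 'e) \<Rightarrow> 'e \<Rightarrow> 'e" where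
  "vf_rep A c X x = (let q = inv_into (fst c) (snd c) x in tangent_map A model_atlas (snd c) q (X q))"

definition form1_rep :: "('m, 'e::locally_convex_space) atlas \<Rightarrow> ('m, 'e) chart \<Rightarrow>
    ('m \<Rightarrow> 'e \<Rightarrow> 'f) \<Rightarrow> 'e \<Rightarrow> 'e \<Rightarrow> 'f" where
  "form1_rep A c \<alpha> x v =
    (let \<phi>' = inv_into (fst c) (snd c); T = tangent_map model_atlas A \<phi>' x in \<alpha> (\<phi>' x) (T v))"

definition form2_rep :: "('m, 'e::locally_convex_space) atlas \<Rightarrow> ('m, 'e) chart \<Rightarrow>
    ('m \<Rightarrow> 'e \<Rightarrow> 'e \<Rightarrow> 'f) \<Rightarrow> 'e \<Rightarrow> 'e \<Rightarrow> 'e \<Rightarrow> 'f" where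
  "form2_rep A c \<omega> x v w =
    (let \<phi>' = inv_into (fst c) (snd c); T = tangent_map model_atlas A \<phi>' x in \<omega> (\<phi>' x) (T v) (T w))"

definition vector_field :: "('m::t2_space, 'e::locally_convex_space) atlas \<Rightarrow> ('m \<Rightarrow> 'e) \<Rightarrow> bool" where
  "vector_field A X \<longleftrightarrow> (\<forall>(U, \<phi>)\<in>A. smooth_on (\<phi> ` U) (vf_rep A (U, \<phi>) X))"

definition form1 :: "('m::t2_space, 'e::locally_convex_space) atlas \<Rightarrow>
    ('m \<Rightarrow> 'e \<Rightarrow> 'f::locally_convex_space) \<Rightarrow> bool" where
  "form1 A \<alpha> \<longleftrightarrow> (\<forall>p. linear (\<alpha> p)) \<and>
    (\<forall>(U, \<phi>)\<in>A. smooth_on (\<phi> ` U \<times> UNIV) (\<lambda>(x, v). form1_rep A (U, \<phi>) \<alpha> x v))"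

definition form2 :: "('m::t2_space, 'e::locally_convex_space) atlas \<Rightarrow>
    ('m \<Rightarrow> 'e \<Rightarrow> 'e \<Rightarrow> 'f::locally_convex_space) \<Rightarrow> bool" where
  "form2 A \<omega> \<longleftrightarrow> (\<forall>p. bilinear (\<omega> p) \<and> (\<forall>v. \<omega> p v v = 0)) \<and>
    (\<forall>(U, \<phi>)\<in>A. smooth_on (\<phi> ` U \<times> UNIV) (\<lambda>(x, v, w). form2_rep A (U, \<phi>) \<omega> x v w))"

text \<open>The bracket is that of derivations, in local coordinates \<open>[X, Y] = dY(X) - dX(Y)\<close>. The
  exterior derivative is normalised by \<open>d\<alpha>(X, Y) = X \<alpha>(Y) - Y \<alpha>(X) - \<alpha>([X, Y])\<close> and computed with
  vector fields that are constant in the chart chosen at the base point.\<close>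

definition vf_bracket :: "('m, 'e::locally_convex_space) atlas \<Rightarrow> ('m \<Rightarrow> 'e) \<Rightarrow> ('m \<Rightarrow> 'e) \<Rightarrow> 'm \<Rightarrow> 'e" where
  "vf_bracket A X Y p =
    (let c = chart_at A p; x = snd c p; X' = vf_rep A c X; Y' = vf_rep A c Y
     in dderiv Y' x (X' x) - dderiv X' x (Y' x))"

definition ext_deriv1 :: "('m, 'e::locally_convex_space) atlas \<Rightarrow>
    ('m \<Rightarrow> 'e \<Rightarrow> 'f::locally_convex_space) \<Rightarrow> 'm \<Rightarrow> 'e \<Rightarrow> 'e \<Rightarrow> 'f" where
  "ext_deriv1 A \<alpha> p X Y =
    (let c = chart_at A p; x = snd c p; a = form1_rep A c \<alpha>
     in dderiv (\<lambda>y. a y Y) x X - dderiv (\<lambda>y. a y X) x Y)"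

definition ext_deriv2 :: "('m, 'e::locally_convex_space) atlas \<Rightarrow>
    ('m \<Rightarrow> 'e \<Rightarrow> 'e \<Rightarrow> 'f::locally_convex_space) \<Rightarrow> 'm \<Rightarrow> 'e \<Rightarrow> 'e \<Rightarrow> 'e \<Rightarrow> 'f" where
  "ext_deriv2 A \<omega> p X Y Z =
    (let c = chart_at A p; x = snd c p; w = form2_rep A c \<omega>
     in dderiv (\<lambda>y. w y Y Z) x X - dderiv (\<lambda>y. w y X Z) x Y + dderiv (\<lambda>y. w y X Y) x Z)"

definition pullback1 :: "('m, 'e::locally_convex_space) atlas \<Rightarrow> ('n, 'f::locally_convex_space) atlas \<Rightarrow>
    ('m \<Rightarrow> 'n) \<Rightarrow> ('n \<Rightarrow> 'f \<Rightarrow> 'h) \<Rightarrow> 'm \<Rightarrow> 'e \<Rightarrow> 'h" where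
  "pullback1 A B f \<beta> = (\<lambda>p v. \<beta> (f p) (tangent_map A B f p v))"

text \<open>Symplectic forms are only required to be weakly non-degenerate, as is usual for
  infinite-dimensional manifolds.\<close>

definition symplectic_form :: "('m::t2_space, 'e::locally_convex_space) atlas \<Rightarrow>
    ('m \<Rightarrow> 'e \<Rightarrow> 'e \<Rightarrow> real) \<Rightarrow> bool" where
  "symplectic_form A \<omega> \<longleftrightarrow> form2 A \<omega> \<and> (\<forall>p X Y Z. ext_deriv2 A \<omega> p X Y Z = 0) \<and>
    (\<forall>p X. (\<forall>Y. \<omega> p X Y = 0) \<longrightarrow> X = 0)"

section \<open>Lie groups and Lie algebras\<close>

definition lie_algebra :: "('a::locally_convex_space \<Rightarrow> 'a \<Rightarrow> 'a) \<Rightarrow> bool" where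
  "lie_algebra br \<longleftrightarrow> continuous_bilinear br \<and> (\<forall>x. br x x = 0) \<and>
    (\<forall>x y z. br x (br y z) + br y (br z x) + br z (br x y) = 0)"

definition lie_subalgebra :: "('a::locally_convex_space \<Rightarrow> 'a \<Rightarrow> 'a) \<Rightarrow> 'a set \<Rightarrow> bool" where
  "lie_subalgebra br S \<longleftrightarrow> subspace S \<and> (\<forall>x\<in>S. \<forall>y\<in>S. br x y \<in> S)"

definition lie_group :: "'g::t2_space monoid \<Rightarrow> ('g, 'k::locally_convex_space) atlas \<Rightarrow> bool" where
  "lie_group G GA \<longleftrightarrow> group G \<and> carrier G = UNIV \<and> manifold GA \<and>
    smooth_map (prod_atlas GA GA) GA (\<lambda>(g, h). g \<otimes>\<^bsub>G\<^esub> h) \<and>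
    smooth_map GA GA (\<lambda>g. inv\<^bsub>G\<^esub> g)"

text \<open>The Lie algebra of \<open>G\<close> is the tangent space at the identity, i.e. the model space of \<open>G\<close>,
  with the bracket of left invariant vector fields.\<close>

definition left_invariant :: "'g::t2_space monoid \<Rightarrow> ('g, 'k::locally_convex_space) atlas \<Rightarrow> 'k \<Rightarrow> 'g \<Rightarrow> 'k" where
  "left_invariant G GA \<xi> g = tangent_map GA GA (\<lambda>h. g \<otimes>\<^bsub>G\<^esub> h) \<one>\<^bsub>G\<^esub> \<xi>"

definition lie_bracket :: "'g::t2_space monoid \<Rightarrow> ('g, 'k::locally_convex_space) atlas \<Rightarrow> 'k \<Rightarrow> 'k \<Rightarrow> 'k" where
  "lie_bracket G GA \<xi> \<eta> = vf_bracket GA (left_invariant G GA \<xi>) (left_invariant G GA \<eta>) \<one>\<^bsub>G\<^esub>"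

definition adjoint_rep :: "'g::t2_space monoid \<Rightarrow> ('g, 'k::locally_convex_space) atlas \<Rightarrow> 'g \<Rightarrow> 'k \<Rightarrow> 'k" where
  "adjoint_rep G GA g = tangent_map GA GA (\<lambda>h. g \<otimes>\<^bsub>G\<^esub> h \<otimes>\<^bsub>G\<^esub> inv\<^bsub>G\<^esub> g) \<one>\<^bsub>G\<^esub>"

definition smooth_action :: "'g::t2_space monoid \<Rightarrow> ('g, 'k::locally_convex_space) atlas \<Rightarrow>
    ('m::t2_space, 'e::locally_convex_space) atlas \<Rightarrow> ('g \<Rightarrow> 'm \<Rightarrow> 'm) \<Rightarrow> bool" where
  "smooth_action G GA A act \<longleftrightarrow> (\<forall>p. act \<one>\<^bsub>G\<^esub> p = p) \<and>
    (\<forall>g h p. act (g \<otimes>\<^bsub>G\<^esub> h) p = act g (act h p)) \<and>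
    smooth_map (prod_atlas GA A) A (\<lambda>(g, p). act g p)"

definition fundamental_vf :: "'g::t2_space monoid \<Rightarrow> ('g, 'k::locally_convex_space) atlas \<Rightarrow>
    ('m::t2_space, 'e::locally_convex_space) atlas \<Rightarrow> ('g \<Rightarrow> 'm \<Rightarrow> 'm) \<Rightarrow> 'k \<Rightarrow> 'm \<Rightarrow> 'e" where
  "fundamental_vf G GA A act \<xi> p = tangent_map GA A (\<lambda>g. act g p) \<one>\<^bsub>G\<^esub> \<xi>"

definition symplectic_action :: "'g::t2_space monoid \<Rightarrow> ('g, 'k::locally_convex_space) atlas \<Rightarrow>
    ('m::t2_space, 'e::locally_convex_space) atlas \<Rightarrow> ('m \<Rightarrow> 'e \<Rightarrow> 'e \<Rightarrow> real) \<Rightarrow> ('g \<Rightarrow> 'm \<Rightarrow> 'm) \<Rightarrow> bool" where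
  "symplectic_action G GA A \<omega> act \<longleftrightarrow> smooth_action G GA A act \<and>
    (\<forall>g p X Y. \<omega> (act g p) (tangent_map A A (act g) p X) (tangent_map A A (act g) p Y) = \<omega> p X Y)"

section \<open>Momentum maps\<close>

definition nondegenerate_pairing ::
  "('d::locally_convex_space \<Rightarrow> 'k::locally_convex_space \<Rightarrow> real) \<Rightarrow> bool" where
  "nondegenerate_pairing \<kappa> \<longleftrightarrow> continuous_bilinear \<kappa> \<and>
    (\<forall>\<mu>. (\<forall>\<xi>. \<kappa> \<mu> \<xi> = 0) \<longrightarrow> \<mu> = 0) \<and> (\<forall>\<xi>. (\<forall>\<mu>. \<kappa> \<mu> \<xi> = 0) \<longrightarrow> \<xi> = 0)"

text \<open>The chosen dual need not be the topological one, so the existence of \<open>Ad\<^sup>*\<close> is a condition;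
  it is unique when \<open>\<kappa>\<close> is non-degenerate. Being the plain transpose of \<open>Ad g\<close>, \<open>Ad\<^sup>* g\<close> is
  a right action in \<open>g\<close>, and the coadjoint action of \<open>g\<close> is \<open>Ad\<^sup>* (inv g)\<close>.\<close>

definition coadjoint :: "'g::t2_space monoid \<Rightarrow> ('g, 'k::locally_convex_space) atlas \<Rightarrow>
    ('d::locally_convex_space \<Rightarrow> 'k \<Rightarrow> real) \<Rightarrow> ('g \<Rightarrow> 'd \<Rightarrow> 'd) \<Rightarrow> bool" where
  "coadjoint G GA \<kappa> Ads \<longleftrightarrow> (\<forall>g. linear (Ads g) \<and> continuous_on UNIV (Ads g)) \<and>
    (\<forall>g \<mu> \<xi>. \<kappa> (Ads g \<mu>) \<xi> = \<kappa> \<mu> (adjoint_rep G GA g \<xi>))"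

definition momentum_map :: "'g::t2_space monoid \<Rightarrow> ('g, 'k::locally_convex_space) atlas \<Rightarrow>
    ('m::t2_space, 'e::locally_convex_space) atlas \<Rightarrow> ('m \<Rightarrow> 'e \<Rightarrow> 'e \<Rightarrow> real) \<Rightarrow> ('g \<Rightarrow> 'm \<Rightarrow> 'm) \<Rightarrow>
    ('d::locally_convex_space \<Rightarrow> 'k \<Rightarrow> real) \<Rightarrow> ('m \<Rightarrow> 'd) \<Rightarrow> bool" where
  "momentum_map G GA A \<omega> act \<kappa> J \<longleftrightarrow> smooth_map A model_atlas J \<and>
    (\<forall>m X \<xi>. \<omega> m (fundamental_vf G GA A act \<xi> m) X + \<kappa> (tangent_map A model_atlas J m X) \<xi> = 0)"

definition nonequivariance_cocycle :: "'g monoid \<Rightarrow> ('g \<Rightarrow> 'm \<Rightarrow> 'm) \<Rightarrow>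
    ('g \<Rightarrow> 'd \<Rightarrow> 'd) \<Rightarrow> ('m \<Rightarrow> 'd::locally_convex_space) \<Rightarrow> ('g \<Rightarrow> 'd) \<Rightarrow> bool" where
  "nonequivariance_cocycle G act Ads J \<sigma> \<longleftrightarrow> (\<forall>g m. J (act g m) = Ads (inv\<^bsub>G\<^esub> g) (J m) + \<sigma> g)"

section \<open>Klein pairs and Cartan geometries\<close>

text \<open>In a Klein pair, the map \<open>\<iota>\<close> is the identification of the Lie algebra of \<open>G\<close> with the subalgebra
  \<open>\<gg>\<close> of the Lie algebra \<open>\<aa>\<close>, which is the whole type with bracket \<open>br\<close>.\<close>

definition klein_pair :: "('a::locally_convex_space \<Rightarrow> 'a \<Rightarrow> 'a) \<Rightarrow> 'a set \<Rightarrow>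
    'g::t2_space monoid \<Rightarrow> ('g, 'k::locally_convex_space) atlas \<Rightarrow> ('k \<Rightarrow> 'a) \<Rightarrow> ('g \<Rightarrow> 'a \<Rightarrow> 'a) \<Rightarrow> bool" where
  "klein_pair br \<gg> G GA \<iota> Ad \<longleftrightarrow>
    lie_algebra br \<and> lie_subalgebra br \<gg> \<and> closed \<gg> \<and>
    (\<exists>C q. subspace C \<and> closed C \<and> homeomorphism (\<gg> \<times> C) UNIV (\<lambda>(x, y). x + y) q) \<and>
    lie_group G GA \<and>
    linear \<iota> \<and> (\<exists>j. homeomorphism UNIV \<gg> \<iota> j) \<and>
    (\<forall>\<xi> \<eta>. \<iota> (lie_bracket G GA \<xi> \<eta>) = br (\<iota> \<xi>) (\<iota> \<eta>)) \<and>
    (\<forall>g. linear (Ad g)) \<and> smooth_action G GA model_atlas Ad \<and>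
    (\<forall>g \<xi>. Ad g (\<iota> \<xi>) = \<iota> (adjoint_rep G GA g \<xi>))"

definition principal_bundle :: "'g::t2_space monoid \<Rightarrow> ('g, 'k::locally_convex_space) atlas \<Rightarrow>
    ('p::t2_space, 'e::locally_convex_space) atlas \<Rightarrow> ('b::t2_space, 'c::locally_convex_space) atlas \<Rightarrow>
    ('g \<Rightarrow> 'p \<Rightarrow> 'p) \<Rightarrow> ('p \<Rightarrow> 'b) \<Rightarrow> bool" where
  "principal_bundle G GA PA BA act \<pi> \<longleftrightarrow>
    manifold PA \<and> manifold BA \<and> smooth_action G GA PA act \<and> smooth_map PA BA \<pi> \<and>
    (\<forall>b. \<exists>U \<tau> \<Phi>. open U \<and> b \<in> U \<and>
      smooth_map_on PA (\<pi> -` U) (prod_atlas BA GA) (\<lambda>p. (\<pi> p, \<tau> p)) \<and>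
      smooth_map_on (prod_atlas BA GA) (U \<times> UNIV) PA \<Phi> \<and>
      homeomorphism (\<pi> -` U) (U \<times> UNIV) (\<lambda>p. (\<pi> p, \<tau> p)) \<Phi> \<and>
      (\<forall>g. \<forall>p \<in> \<pi> -` U. \<pi> (act g p) = \<pi> p \<and> \<tau> (act g p) = g \<otimes>\<^bsub>G\<^esub> \<tau> p))"

definition cartan_geometry :: "'g::t2_space monoid \<Rightarrow> ('g, 'k::locally_convex_space) atlas \<Rightarrow>
    ('k \<Rightarrow> 'a::locally_convex_space) \<Rightarrow> ('g \<Rightarrow> 'a \<Rightarrow> 'a) \<Rightarrow>
    ('p::t2_space, 'e::locally_convex_space) atlas \<Rightarrow> ('b::t2_space, 'c::locally_convex_space) atlas \<Rightarrow>
    ('g \<Rightarrow> 'p \<Rightarrow> 'p) \<Rightarrow> ('p \<Rightarrow> 'b) \<Rightarrow> ('p \<Rightarrow> 'e \<Rightarrow> 'a) \<Rightarrow> bool" where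
  "cartan_geometry G GA \<iota> Ad PA BA act \<pi> \<theta> \<longleftrightarrow>
    principal_bundle G GA PA BA act \<pi> \<and> form1 PA \<theta> \<and> (\<forall>p. tvs_iso (\<theta> p)) \<and>
    (\<forall>g p X. \<theta> (act g p) (tangent_map PA PA (act g) p X) = Ad g (\<theta> p X)) \<and>
    (\<forall>\<xi> p. \<theta> p (fundamental_vf G GA PA act \<xi> p) = \<iota> \<xi>)"

definition curvature :: "('a::locally_convex_space \<Rightarrow> 'a \<Rightarrow> 'a) \<Rightarrow>
    ('p, 'e::locally_convex_space) atlas \<Rightarrow> ('p \<Rightarrow> 'e \<Rightarrow> 'a) \<Rightarrow> 'p \<Rightarrow> 'e \<Rightarrow> 'e \<Rightarrow> 'a" where
  "curvature br PA \<theta> p X Y = ext_deriv1 PA \<theta> p X Y - br (\<theta> p X) (\<theta> p Y)"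

definition torsion_free :: "('a::locally_convex_space \<Rightarrow> 'a \<Rightarrow> 'a) \<Rightarrow> 'a set \<Rightarrow>
    ('p, 'e::locally_convex_space) atlas \<Rightarrow> ('p \<Rightarrow> 'e \<Rightarrow> 'a) \<Rightarrow> bool" where
  "torsion_free br \<gg> PA \<theta> \<longleftrightarrow> (\<forall>p X Y. curvature br PA \<theta> p X Y \<in> \<gg>)"

text \<open>A right Lie algebra action is a Lie algebra homomorphism into the vector fields with the
  bracket of derivations (a left one would be an antihomomorphism). The values of \<open>star\<close> outside
  of \<open>\<aa>\<^sub>m\<close> are irrelevant.\<close>

definition right_lie_algebra_action :: "('a::locally_convex_space \<Rightarrow> 'a \<Rightarrow> 'a) \<Rightarrow> 'a set \<Rightarrow>
    ('p::t2_space, 'e::locally_convex_space) atlas \<Rightarrow> ('a \<Rightarrow> 'p \<Rightarrow> 'e) \<Rightarrow> bool" where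
  "right_lie_algebra_action br S PA star \<longleftrightarrow>
    (\<forall>\<zeta>\<in>S. vector_field PA (star \<zeta>)) \<and>
    (\<forall>p. continuous_on S (\<lambda>\<zeta>. star \<zeta> p)) \<and>
    (\<forall>\<zeta>\<in>S. \<forall>\<eta>\<in>S. \<forall>p. star (\<zeta> + \<eta>) p = star \<zeta> p + star \<eta> p) \<and>
    (\<forall>\<zeta>\<in>S. \<forall>r p. star (r *\<^sub>R \<zeta>) p = r *\<^sub>R star \<zeta> p) \<and>
    (\<forall>\<zeta>\<in>S. \<forall>\<eta>\<in>S. \<forall>p. star (br \<zeta> \<eta>) p = vf_bracket PA (star \<zeta>) (star \<eta>) p)"

definition orbit_through :: "('a::locally_convex_space \<Rightarrow> 'a \<Rightarrow> 'a) \<Rightarrow>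
    ('p::t2_space, 'e::locally_convex_space) atlas \<Rightarrow> ('g \<Rightarrow> 'p \<Rightarrow> 'p) \<Rightarrow>
    ('m::t2_space, 'f::locally_convex_space) atlas \<Rightarrow> ('g \<Rightarrow> 'm \<Rightarrow> 'm) \<Rightarrow> 'm \<Rightarrow> ('p \<Rightarrow> 'm) \<Rightarrow> bool" where
  "orbit_through br PA actP MA actM m chi \<longleftrightarrow>
    smooth_map PA MA chi \<and> (\<forall>g p. chi (actP g p) = actM g (chi p)) \<and> m \<in> range chi \<and>
    (\<exists>\<aa>\<^sub>m star. lie_subalgebra br \<aa>\<^sub>m \<and> right_lie_algebra_action br \<aa>\<^sub>m PA star \<and>
      (\<forall>\<zeta>\<in>\<aa>\<^sub>m. \<forall>g p. tangent_map PA PA (actP g) p (star \<zeta> p) = star \<zeta> (actP g p)) \<and>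
      (\<forall>\<zeta>\<in>\<aa>\<^sub>m. \<forall>p. tangent_map PA MA chi p (star \<zeta> p) = 0))"

definition duality :: "'g monoid \<Rightarrow> 'a::locally_convex_space set \<Rightarrow> ('g \<Rightarrow> 'a \<Rightarrow> 'a) \<Rightarrow>
    ('g \<Rightarrow> 'd \<Rightarrow> 'd) \<Rightarrow> ('d::locally_convex_space \<Rightarrow> 'a \<Rightarrow> real) \<Rightarrow> bool" where
  "duality G \<gg> Ad Ads \<kappa>\<^sub>a \<longleftrightarrow> continuous_bilinear \<kappa>\<^sub>a \<and>
    (\<forall>g \<mu> \<xi>. \<kappa>\<^sub>a (Ads (inv\<^bsub>G\<^esub> g) \<mu>) (Ad g \<xi>) = \<kappa>\<^sub>a \<mu> \<xi>) \<and>
    (\<forall>\<mu>. \<forall>\<xi>\<in>\<gg>. \<kappa>\<^sub>a \<mu> \<xi> = 0)"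

definition rho :: "('p, 'e::locally_convex_space) atlas \<Rightarrow> ('m, 'f::locally_convex_space) atlas \<Rightarrow>
    ('p \<Rightarrow> 'm) \<Rightarrow> ('p \<Rightarrow> 'e \<Rightarrow> 'a) \<Rightarrow> 'p \<Rightarrow> 'a \<Rightarrow> 'f" where
  "rho PA MA chi \<theta> p \<xi> = tangent_map PA MA chi p (inv_into UNIV (\<theta> p) \<xi>)"

definition calabi :: "('p, 'e::locally_convex_space) atlas \<Rightarrow> ('m, 'f::locally_convex_space) atlas \<Rightarrow>
    ('p \<Rightarrow> 'm) \<Rightarrow> ('p \<Rightarrow> 'e \<Rightarrow> 'a) \<Rightarrow> ('m \<Rightarrow> 'd::locally_convex_space) \<Rightarrow> 'p \<Rightarrow> 'a \<Rightarrow> 'd" where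
  "calabi PA MA chi \<theta> J p \<xi> = tangent_map MA model_atlas J (chi p) (rho PA MA chi \<theta> p \<xi>)"

definition a_equivariant :: "('a::locally_convex_space \<Rightarrow> 'a \<Rightarrow> 'a) \<Rightarrow>
    ('p, 'e::locally_convex_space) atlas \<Rightarrow> ('m, 'f::locally_convex_space) atlas \<Rightarrow>
    ('p \<Rightarrow> 'm) \<Rightarrow> ('p \<Rightarrow> 'e \<Rightarrow> 'a) \<Rightarrow> ('d::locally_convex_space \<Rightarrow> 'a \<Rightarrow> real) \<Rightarrow>
    ('m \<Rightarrow> 'd) \<Rightarrow> ('g \<Rightarrow> 'd) \<Rightarrow> bool" where
  "a_equivariant br PA MA chi \<theta> \<kappa>\<^sub>a J \<sigma> \<longleftrightarrow>
    (\<forall>p \<xi> \<eta>. \<kappa>\<^sub>a (calabi PA MA chi \<theta> J p \<xi>) \<eta> - \<kappa>\<^sub>a (calabi PA MA chi \<theta> J p \<eta>) \<xi> = - \<kappa>\<^sub>a (J (chi p)) (br \<xi> \<eta>)) \<and>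
    (\<forall>g \<xi>. \<kappa>\<^sub>a (\<sigma> g) \<xi> = 0)"

definition basic_form :: "('p::t2_space, 'e::locally_convex_space) atlas \<Rightarrow>
    ('b::t2_space, 'c::locally_convex_space) atlas \<Rightarrow> ('p \<Rightarrow> 'b) \<Rightarrow>
    ('p \<Rightarrow> 'e \<Rightarrow> 'f::locally_convex_space) \<Rightarrow> bool" where
  "basic_form PA BA \<pi> \<alpha> \<longleftrightarrow> form1 PA \<alpha> \<and> (\<exists>\<beta>. form1 BA \<beta> \<and> \<alpha> = pullback1 PA BA \<pi> \<beta>)"

definition orbit_form :: "('d \<Rightarrow> 'a \<Rightarrow> real) \<Rightarrow> ('m \<Rightarrow> 'd) \<Rightarrow> ('p \<Rightarrow> 'm) \<Rightarrow> ('p \<Rightarrow> 'e \<Rightarrow> 'a) \<Rightarrow> 'p \<Rightarrow> 'e \<Rightarrow> real" where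
  "orbit_form \<kappa>\<^sub>a J chi \<theta> p X = \<kappa>\<^sub>a (J (chi p)) (\<theta> p X)"

end

theory Submission
  imports Defs
begin

text \<open>
  Write \<open>\<alpha> = \<kappa>\<^sub>a(J \<circ> \<chi>, \<theta>)\<close> for the form of the orbit.

  A form on the total space of a principal bundle comes from a unique form on the base if it
  is invariant and vanishes on fundamental vector fields (\<open>invariant_horizontal_form_basic\<close>). The form
  \<open>\<alpha>\<close> is invariant because \<open>\<chi>\<close> and \<open>\<theta>\<close> are equivariant, \<open>\<kappa>\<^sub>a\<close> is invariant, and the non-equivariance cocycle
  of \<open>J\<close> is invisible to \<open>\<kappa>\<^sub>a\<close>. It is horizontal because \<open>\<theta>\<close> maps fundamental vector fields to \<open>\<gg>\<close>, where
  \<open>\<kappa>\<^sub>a\<close> vanishes. The form on the base is locally the pull-back of \<open>\<alpha>\<close> by a section \<open>s\<close>: writing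
  \<open>q = \<tau>(q) \<cdot> s(\<pi> q)\<close> and differentiating shows that \<open>\<alpha>\<^sub>p(X)\<close> only depends on the projection of \<open>X\<close>
  (\<open>invariant_horizontal_form_on_section\<close>).

  By the product rule (\<open>ext_deriv1_orbit_form\<close>), \<open>d\<alpha>(X, Y)\<close> is
  \<open>\<kappa>\<^sub>a(C(\<theta> X), \<theta> Y) - \<kappa>\<^sub>a(C(\<theta> Y), \<theta> X) + \<kappa>\<^sub>a(J \<circ> \<chi>, d\<theta>(X, Y))\<close> with the Calabi operator \<open>C\<close>. Equivariance of
  \<open>J\<close> replaces the first two terms by \<open>- \<kappa>\<^sub>a(J \<circ> \<chi>, [\<theta> X, \<theta> Y])\<close>, which gives \<open>\<kappa>\<^sub>a(J \<circ> \<chi>, \<Omega>(X, Y))\<close>. If \<open>\<theta>\<close> is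
  torsion-free, this is zero, and pulling back by sections shows that the form on the base is closed
  (\<open>closed_pullback_imp_closed_in_charts\<close>).

  A closed form has primitives on convex sets in charts, given by integration along
  segments (\<open>closed_form_has_primitive\<close>). They differ by local constants, so they can be continued along
  paths and homotopies, and on a simply connected space the result is independent of the path
  (\<open>global_primitive\<close>).

  The manifolds are modelled on locally convex spaces, for which the calculus is developed first. Its
  source is a mean value theorem for open convex sets (\<open>mean_value_open_convex\<close>) and the resulting
  convergence of difference quotients with moving base point and direction (\<open>diff_quot_tendsto\<close>). They
  yield linearity of the derivative, the chain rule, the product rule for \<open>f\<^sup>(\<^sup>k\<^sup>)(x; v\<^sub>1, \<dots>, v\<^sub>k)\<close> and the
  symmetry of second derivatives. That smooth maps compose and have smooth derivatives then follows
  by coinduction (\<open>smooth_on_coinduct\<close>): one exhibits a class of functions closed under differentiation.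
\<close>

section \<open>Directional derivatives in locally convex spaces\<close>

lemma tendsto_scaleR_lcs:
  fixes g :: "'i \<Rightarrow> 'e::locally_convex_space"
  assumes "(f \<longlongrightarrow> a) F" "(g \<longlongrightarrow> b) F"
  shows "((\<lambda>i. f i *\<^sub>R g i) \<longlongrightarrow> a *\<^sub>R b) F"
  using filterlim_compose[OF tendsto_scaleR_Pair filterlim_Pair[OF assms]] by simp

text \<open>Local convexity is postulated at the origin only and is moved to other points by translation.\<close>

lemma open_convex_nhd:
  fixes S :: "'e::locally_convex_space set"
  assumes "open S" "l \<in> S"
  obtains C where "open C" "convex C" "l \<in> C" "C \<subseteq> S"
proof -
  have cont: "continuous_on UNIV (\<lambda>x::'e. x + c)" for c
    by (simp add: continuous_on_def tendsto_add tendsto_ident_at)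
  have "open ((\<lambda>x. x + l) -` S)" "0 \<in> (\<lambda>x. x + l) -` S"
    using assms open_vimage[OF assms(1) cont] by auto
  then obtain V where V: "open V" "0 \<in> V" "V \<subseteq> (\<lambda>x. x + l) -` S" "convex V"
    using convex_nhds_0 by metis
  have "(\<lambda>x. l + x) ` V = (\<lambda>x. x + (- l)) -` V"
    by (force simp: image_iff)
  then have "open ((\<lambda>x. l + x) ` V)"
    using open_vimage[OF V(1) cont] by metis
  moreover have "convex ((\<lambda>x. l + x) ` V)"
    using V(4) by (rule convex_translation)
  ultimately show ?thesis
    using V that[of "(\<lambda>x. l + x) ` V"] by (force simp: add.commute)
qed

definition has_dderiv ::
  "('e::locally_convex_space \<Rightarrow> 'f::locally_convex_space) \<Rightarrow> 'e \<Rightarrow> 'e \<Rightarrow> 'f \<Rightarrow> bool" where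
  "has_dderiv f x v l \<longleftrightarrow> (diff_quot f x v \<longlongrightarrow> l) (at 0)"

lemma has_dderiv_imp_eq: "has_dderiv f x v l \<Longrightarrow> dderiv f x v = l"
  unfolding has_dderiv_def dderiv_def by (rule tendsto_Lim) auto

lemma has_dderiv_unique: "has_dderiv f x v l \<Longrightarrow> has_dderiv f x v l' \<Longrightarrow> l = l'"
  by (metis has_dderiv_imp_eq)

lemma tendsto_line:
  fixes x v :: "'e::locally_convex_space"
  shows "((\<lambda>t. x + t *\<^sub>R v) \<longlongrightarrow> x) (at 0)"
proof -
  have "((\<lambda>t. x + t *\<^sub>R v) \<longlongrightarrow> x + 0 *\<^sub>R v) (at 0)"
    by (intro tendsto_add tendsto_const tendsto_scaleR_lcs tendsto_ident_at)
  then show ?thesis by simp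
qed

lemma eventually_line:
  fixes x v :: "'e::locally_convex_space"
  assumes "open U" "x \<in> U"
  shows "\<forall>\<^sub>F t in at 0. x + t *\<^sub>R v \<in> U"
  using topological_tendstoD[OF tendsto_line assms] .

lemma has_dderiv_cong:
  assumes "open U" "x \<in> U" "\<And>y. y \<in> U \<Longrightarrow> f y = g y"
  shows "has_dderiv f x v l \<longleftrightarrow> has_dderiv g x v l"
  unfolding has_dderiv_def
  by (rule tendsto_cong, rule eventually_mono[OF eventually_line[OF assms(1,2), of v]])
    (auto simp: diff_quot_def assms)

lemma dderiv_cong:
  assumes "open U" "x \<in> U" "\<And>y. y \<in> U \<Longrightarrow> f y = g y"
  shows "dderiv f x v = dderiv g x v"
proof -
  have "has_dderiv f x v l = has_dderiv g x v l" for l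
    using has_dderiv_cong[of U x f g v] assms by blast
  then show ?thesis
    unfolding dderiv_def Topological_Spaces.Lim_def has_dderiv_def by meson
qed

lemma has_dderiv_const: "has_dderiv (\<lambda>x. c) x v 0"
  by (simp add: has_dderiv_def diff_quot_def[abs_def])

lemma has_dderiv_linear:
  assumes "linear L"
  shows "has_dderiv L x v (L v)"
proof -
  have "(diff_quot L x v \<longlongrightarrow> L v) (at 0) \<longleftrightarrow> ((\<lambda>t::real. L v) \<longlongrightarrow> L v) (at 0)"
    by (rule tendsto_cong)
      (auto simp: diff_quot_def linear_add[OF assms] linear_scale[OF assms] eventually_at_filter)
  then show ?thesis
    by (simp add: has_dderiv_def)
qed

lemma has_dderiv_ident: "has_dderiv (\<lambda>x. x) x v v"
  using has_dderiv_linear[of "\<lambda>x. x"] by (simp add: linear_iff)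

lemma has_dderiv_add:
  assumes "has_dderiv f x v a" "has_dderiv g x v b"
  shows "has_dderiv (\<lambda>x. f x + g x) x v (a + b)"
proof -
  have "diff_quot (\<lambda>x. f x + g x) x v = (\<lambda>t. diff_quot f x v t + diff_quot g x v t)"
    by (auto simp: diff_quot_def scaleR_right_diff_distrib scaleR_add_right)
  then show ?thesis
    using assms tendsto_add by (simp add: has_dderiv_def)
qed

lemma has_dderiv_scaleR:
  assumes "has_dderiv f x v a"
  shows "has_dderiv (\<lambda>x. c *\<^sub>R f x) x v (c *\<^sub>R a)"
proof -
  have "diff_quot (\<lambda>x. c *\<^sub>R f x) x v = (\<lambda>t. c *\<^sub>R diff_quot f x v t)"
    by (rule ext) (simp add: diff_quot_def scaleR_right_diff_distrib mult.commute)
  then show ?thesis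
    using assms tendsto_scaleR_lcs[OF tendsto_const] by (simp add: has_dderiv_def)
qed

lemma has_dderiv_Pair:
  assumes "has_dderiv f x v a" "has_dderiv g x v b"
  shows "has_dderiv (\<lambda>x. (f x, g x)) x v (a, b)"
proof -
  have "diff_quot (\<lambda>x. (f x, g x)) x v = (\<lambda>t. (diff_quot f x v t, diff_quot g x v t))"
    by (auto simp: diff_quot_def)
  then show ?thesis
    using assms tendsto_Pair by (simp add: has_dderiv_def)
qed

lemma has_dderiv_bilinear:
  assumes "continuous_bilinear B" "has_dderiv f x v a" "has_dderiv g x v b"
  shows "has_dderiv (\<lambda>x. B (f x) (g x)) x v (B a (g x) + B (f x) b)"
proof -
  have lin: "linear (B p)" "linear (\<lambda>p. B p q)" for p q
    using assms(1) by (auto simp: continuous_bilinear_def bilinear_def)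
  have cont: "((\<lambda>i. B (p i) (q i)) \<longlongrightarrow> B p0 q0) F" if "(p \<longlongrightarrow> p0) F" "(q \<longlongrightarrow> q0) F" for p q p0 q0 and F :: "real filter"
    using continuous_on_tendsto_compose[OF _ tendsto_Pair[OF that], of UNIV "\<lambda>(x, y). B x y"] assms(1)
    by (simp add: continuous_bilinear_def)
  have g: "((\<lambda>t. g (x + t *\<^sub>R v)) \<longlongrightarrow> g x) (at 0)"
  proof (rule Lim_transform_eventually)
    show "((\<lambda>t. g x + t *\<^sub>R diff_quot g x v t) \<longlongrightarrow> g x) (at 0)"
      using tendsto_add[OF tendsto_const tendsto_scaleR_lcs[OF tendsto_ident_at assms(3)[unfolded has_dderiv_def]]]
      by fastforce
  qed (auto simp: eventually_at_filter diff_quot_def)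
  have "diff_quot (\<lambda>x. B (f x) (g x)) x v =
      (\<lambda>t. B (diff_quot f x v t) (g (x + t *\<^sub>R v)) + B (f x) (diff_quot g x v t))"
    by (rule ext) (simp add: diff_quot_def linear_scale[OF lin(1)] linear_scale[OF lin(2)]
        linear_diff[OF lin(1)] linear_diff[OF lin(2)] algebra_simps)
  then show ?thesis
    unfolding has_dderiv_def
    using tendsto_add[OF cont[OF assms(2)[unfolded has_dderiv_def] g]
        cont[OF tendsto_const assms(3)[unfolded has_dderiv_def]]] by simp
qed

text \<open>The mean value theorem in a form that needs neither a norm nor linear functionals. Difference
  quotients over short intervals around a given point lie in the open set \<open>C\<close>, and those over adjacent
  intervals combine convexly; subdividing the interval does the rest.\<close>

lemma mean_value_open_convex:
  fixes \<gamma> :: "real \<Rightarrow> 'f::locally_convex_space"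
  assumes C: "open C" "convex C" and ab: "a < b"
    and der: "\<And>t. a \<le> t \<Longrightarrow> t \<le> b \<Longrightarrow> has_dderiv \<gamma> t 1 (\<gamma>' t)"
    and val: "\<And>t. a \<le> t \<Longrightarrow> t \<le> b \<Longrightarrow> \<gamma>' t \<in> C"
  shows "(\<gamma> b - \<gamma> a) /\<^sub>R (b - a) \<in> C"
proof -
  define P where "P u v \<longleftrightarrow> (a \<le> u \<and> u < v \<and> v \<le> b \<longrightarrow> (\<gamma> v - \<gamma> u) /\<^sub>R (v - u) \<in> C)" for u v
  have glue: "(\<gamma> w - \<gamma> u) /\<^sub>R (w - u) \<in> C"
    if "u < v" "v < w" "(\<gamma> v - \<gamma> u) /\<^sub>R (v - u) \<in> C" "(\<gamma> w - \<gamma> v) /\<^sub>R (w - v) \<in> C" for u v w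
  proof -
    have "((v - u) / (w - u)) *\<^sub>R ((\<gamma> v - \<gamma> u) /\<^sub>R (v - u)) + ((w - v) / (w - u)) *\<^sub>R ((\<gamma> w - \<gamma> v) /\<^sub>R (w - v)) \<in> C"
      using that by (intro convexD[OF C(2)]) (auto simp: add_divide_distrib[symmetric])
    moreover have "((v - u) / (w - u)) *\<^sub>R ((\<gamma> v - \<gamma> u) /\<^sub>R (v - u)) + ((w - v) / (w - u)) *\<^sub>R ((\<gamma> w - \<gamma> v) /\<^sub>R (w - v))
        = (\<gamma> w - \<gamma> u) /\<^sub>R (w - u)"
    proof -
      have "(v - u) / (w - u) * inverse (v - u) = inverse (w - u)"
        "(w - v) / (w - u) * inverse (w - v) = inverse (w - u)"
        using that by (auto simp: divide_inverse)
      then have "((v - u) / (w - u)) *\<^sub>R ((\<gamma> v - \<gamma> u) /\<^sub>R (v - u)) + ((w - v) / (w - u)) *\<^sub>R ((\<gamma> w - \<gamma> v) /\<^sub>R (w - v))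
          = (\<gamma> v - \<gamma> u) /\<^sub>R (w - u) + (\<gamma> w - \<gamma> v) /\<^sub>R (w - u)"
        by (simp only: scaleR_scaleR)
      also have "\<dots> = (\<gamma> w - \<gamma> u) /\<^sub>R (w - u)"
        by (simp add: scaleR_right_diff_distrib)
      finally show ?thesis .
    qed
    ultimately show ?thesis by simp
  qed
  have "P a b"
    using less_imp_le[OF ab]
  proof (induction rule: Bolzano)
    case (trans u v w)
    show ?case
      unfolding P_def
    proof
      assume *: "a \<le> u \<and> u < w \<and> w \<le> b"
      consider "u = v" | "v = w" | "u < v" "v < w"
        using trans(3,4) by linarith
      then show "(\<gamma> w - \<gamma> u) /\<^sub>R (w - u) \<in> C"
      proof cases
        case 3
        with trans(1,2) * show ?thesis
          unfolding P_def by (intro glue[of u v w]) linarith+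
      qed (use trans(1,2) * in \<open>simp_all add: P_def\<close>)
    qed
  next
    case (local x)
    have "\<forall>\<^sub>F h in at 0. diff_quot \<gamma> x 1 h \<in> C"
      using topological_tendstoD[OF der[OF local, unfolded has_dderiv_def] C(1) val[OF local]] .
    then obtain d where d: "d > 0" "\<And>h. h \<noteq> 0 \<Longrightarrow> \<bar>h\<bar> < d \<Longrightarrow> (\<gamma> (x + h) - \<gamma> x) /\<^sub>R h \<in> C"
      by (auto simp: eventually_at dist_real_def diff_quot_def)
    have "P u v" if uv: "u \<le> x" "x \<le> v" "v - u < d" for u v
    proof -
      have 1: "(\<gamma> v - \<gamma> x) /\<^sub>R (v - x) \<in> C" if "x < v"
        using d(2)[of "v - x"] that \<open>u \<le> x\<close> \<open>v - u < d\<close> by auto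
      have 2: "(\<gamma> x - \<gamma> u) /\<^sub>R (x - u) \<in> C" if "u < x"
      proof -
        have "(\<gamma> u - \<gamma> x) /\<^sub>R (u - x) \<in> C"
          using d(2)[of "u - x"] that \<open>x \<le> v\<close> \<open>v - u < d\<close> by auto
        moreover have "(\<gamma> u - \<gamma> x) /\<^sub>R (u - x) = (\<gamma> x - \<gamma> u) /\<^sub>R (x - u)"
          by (metis inverse_minus_eq minus_diff_eq scaleR_minus_left scaleR_minus_right minus_minus)
        ultimately show ?thesis by simp
      qed
      consider "u = x" | "x = v" | "u < x" "x < v"
        using uv by linarith
      then show ?thesis
      proof cases
        case 3
        then show ?thesis
          using glue[OF 3 2 1] unfolding P_def by blast
      qed (use 1 2 in \<open>auto simp only: P_def\<close>)
    qed
    with d(1) show ?case by blast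
  qed
  with ab show ?thesis by (simp add: P_def)
qed

lemma has_dderiv_along_line:
  assumes "has_dderiv g (x + s *\<^sub>R v) v l"
  shows "has_dderiv (\<lambda>s. g (x + s *\<^sub>R v)) s 1 l"
  using assms unfolding has_dderiv_def diff_quot_def by (simp add: algebra_simps)

lemma diff_quot_open_convex:
  fixes g :: "'e::locally_convex_space \<Rightarrow> 'f::locally_convex_space"
  assumes C: "open C" "convex C" and t: "t \<noteq> 0"
    and der: "\<And>s. \<bar>s\<bar> \<le> \<bar>t\<bar> \<Longrightarrow> has_dderiv g (x + s *\<^sub>R v) v (D (x + s *\<^sub>R v))"
    and val: "\<And>s. \<bar>s\<bar> \<le> \<bar>t\<bar> \<Longrightarrow> D (x + s *\<^sub>R v) \<in> C"
  shows "(g (x + t *\<^sub>R v) - g x) /\<^sub>R t \<in> C"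
proof (cases "t > 0")
  case True
  have "(g (x + t *\<^sub>R v) - g (x + 0 *\<^sub>R v)) /\<^sub>R (t - 0) \<in> C"
    using True der val
    by (intro mean_value_open_convex[OF C, where \<gamma> = "\<lambda>s. g (x + s *\<^sub>R v)" and \<gamma>' = "\<lambda>s. D (x + s *\<^sub>R v)"]
        has_dderiv_along_line) auto
  then show ?thesis by simp
next
  case False
  have "(g (x + 0 *\<^sub>R v) - g (x + t *\<^sub>R v)) /\<^sub>R (0 - t) \<in> C"
    using False der val t
    by (intro mean_value_open_convex[OF C, where \<gamma> = "\<lambda>s. g (x + s *\<^sub>R v)" and \<gamma>' = "\<lambda>s. D (x + s *\<^sub>R v)"]
        has_dderiv_along_line) auto
  moreover have "(g x - g (x + t *\<^sub>R v)) /\<^sub>R (- t) = (g (x + t *\<^sub>R v) - g x) /\<^sub>R t"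
    by (metis inverse_minus_eq minus_diff_eq scaleR_minus_left scaleR_minus_right minus_minus)
  ultimately show ?thesis by simp
qed

lemma eventually_segment:
  fixes x0 v0 :: "'e::locally_convex_space"
  assumes "(x \<longlongrightarrow> x0) F" "(v \<longlongrightarrow> v0) F" "(t \<longlongrightarrow> (0::real)) F" "open N" "x0 \<in> N"
  shows "\<forall>\<^sub>F i in F. \<forall>s. \<bar>s\<bar> \<le> \<bar>t i\<bar> \<longrightarrow> x i + s *\<^sub>R v i \<in> N"
proof -
  have "((\<lambda>(y, s, w). y + s *\<^sub>R w) \<longlongrightarrow> x0 + 0 *\<^sub>R v0) (nhds (x0, 0, v0))"
    unfolding split_def
    by (intro tendsto_add tendsto_scaleR_lcs tendsto_fst tendsto_snd)
      (auto intro!: tendsto_eq_intros filterlim_ident)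
  then have "\<forall>\<^sub>F (y, s, w) in nhds x0 \<times>\<^sub>F (nhds 0 \<times>\<^sub>F nhds v0). y + s *\<^sub>R w \<in> N"
    using topological_tendstoD[of "\<lambda>(y, s, w). y + s *\<^sub>R w" _ "nhds (x0, 0, v0)" N] assms(4,5)
    by (simp add: nhds_prod split_def)
  then obtain P Q R where PQR: "eventually P (nhds x0)" "eventually Q (nhds (0::real))" "eventually R (nhds v0)"
      "\<And>y s w. P y \<Longrightarrow> Q s \<Longrightarrow> R w \<Longrightarrow> y + s *\<^sub>R w \<in> N"
    by (auto simp: eventually_prod_filter)
  obtain d where d: "d > 0" "\<And>s. \<bar>s\<bar> < d \<Longrightarrow> Q s"
    using PQR(2) by (auto simp: eventually_nhds_metric dist_real_def)
  have "\<forall>\<^sub>F i in F. P (x i)" "\<forall>\<^sub>F i in F. R (v i)"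
    using assms(1,2) PQR(1,3) by (auto simp: filterlim_iff)
  moreover have "\<forall>\<^sub>F i in F. \<bar>t i\<bar> < d"
    using tendstoD[OF assms(3) d(1)] by (simp add: dist_real_def)
  ultimately show ?thesis
    by eventually_elim (use d PQR(4) in fastforce)
qed

text \<open>Near the base point the derivatives lie in a given open convex neighbourhood of the limit, hence so
  do the difference quotients. The generality, a family \<open>g i\<close> with moving base point, direction and step,
  makes the linearity of the derivative, the chain rule, the product rule and the symmetry of second
  derivatives special cases.\<close>

lemma diff_quot_tendsto:
  fixes g :: "'i \<Rightarrow> 'e::locally_convex_space \<Rightarrow> 'f::locally_convex_space"
  assumes dd: "\<forall>\<^sub>F (i, y) in F \<times>\<^sub>F nhds x0. has_dderiv (g i) y (v i) (D i y)"
    and D: "((\<lambda>(i, y). D i y) \<longlongrightarrow> l) (F \<times>\<^sub>F nhds x0)"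
    and x: "(x \<longlongrightarrow> x0) F" and v: "(v \<longlongrightarrow> v0) F" and t: "(t \<longlongrightarrow> 0) F" "\<forall>\<^sub>F i in F. t i \<noteq> 0"
  shows "((\<lambda>i. (g i (x i + t i *\<^sub>R v i) - g i (x i)) /\<^sub>R t i) \<longlongrightarrow> l) F"
proof (rule topological_tendstoI)
  fix S assume "open S" "l \<in> S"
  then obtain C where C: "open C" "convex C" "l \<in> C" "C \<subseteq> S"
    by (rule open_convex_nhd)
  have "\<forall>\<^sub>F z in F \<times>\<^sub>F nhds x0. (case z of (i, y) \<Rightarrow> has_dderiv (g i) y (v i) (D i y)) \<and>
      (case z of (i, y) \<Rightarrow> D i y) \<in> C"
    using dd topological_tendstoD[OF D C(1,3)] by eventually_elim auto
  then obtain P Q where PQ: "eventually P F" "eventually Q (nhds x0)"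
      "\<And>i y. P i \<Longrightarrow> Q y \<Longrightarrow> has_dderiv (g i) y (v i) (D i y) \<and> D i y \<in> C"
    unfolding eventually_prod_filter by auto
  obtain N where N: "open N" "x0 \<in> N" "\<And>y. y \<in> N \<Longrightarrow> Q y"
    using PQ(2) by (auto simp: eventually_nhds)
  show "\<forall>\<^sub>F i in F. (g i (x i + t i *\<^sub>R v i) - g i (x i)) /\<^sub>R t i \<in> S"
    using PQ(1) eventually_segment[OF x v t(1) N(1,2)] t(2)
  proof eventually_elim
    case (elim i)
    then have "(g i (x i + t i *\<^sub>R v i) - g i (x i)) /\<^sub>R t i \<in> C"
      using PQ(3) N(3) by (intro diff_quot_open_convex[OF C(1,2), where D = "D i"]) auto
    with C(4) show ?case by blast
  qed
qed

definition C1_on :: "'e set \<Rightarrow> ('e::locally_convex_space \<Rightarrow> 'f::locally_convex_space) \<Rightarrow> bool" where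
  "C1_on U f \<longleftrightarrow> open U \<and> (\<forall>x\<in>U. \<forall>v. has_dderiv f x v (dderiv f x v)) \<and>
    continuous_on (U \<times> UNIV) (\<lambda>(x, v). dderiv f x v)"

lemma C1_on_D:
  assumes "C1_on U f" "x \<in> U"
  shows "has_dderiv f x v (dderiv f x v)"
  using assms by (auto simp: C1_on_def)

lemma C1_on_diff_quot_tendsto:
  assumes f: "C1_on U f" and x0: "x0 \<in> U" and x: "(x \<longlongrightarrow> x0) F" and v: "(v \<longlongrightarrow> v0) F"
    and t: "(t \<longlongrightarrow> 0) F" "\<forall>\<^sub>F i in F. t i \<noteq> 0"
  shows "((\<lambda>i. (f (x i + t i *\<^sub>R v i) - f (x i)) /\<^sub>R t i) \<longlongrightarrow> dderiv f x0 v0) F"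
proof (rule diff_quot_tendsto[OF _ _ x v t, where g = "\<lambda>i. f" and D = "\<lambda>i y. dderiv f y (v i)"])
  have U: "\<forall>\<^sub>F (i, y) in F \<times>\<^sub>F nhds x0. y \<in> U"
    using topological_tendstoD[OF filterlim_snd, of U x0 F] f x0 by (simp add: C1_on_def split_def)
  then show "\<forall>\<^sub>F (i, y) in F \<times>\<^sub>F nhds x0. has_dderiv f y (v i) (dderiv f y (v i))"
    by eventually_elim (use f in \<open>auto simp: C1_on_def\<close>)
  have "((\<lambda>z. (snd z, v (fst z))) \<longlongrightarrow> (x0, v0)) (F \<times>\<^sub>F nhds x0)"
    by (intro tendsto_Pair filterlim_snd filterlim_compose[OF v filterlim_fst])
  then show "((\<lambda>(i, y). dderiv f y (v i)) \<longlongrightarrow> dderiv f x0 v0) (F \<times>\<^sub>F nhds x0)"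
    using continuous_on_tendsto_compose[of "U \<times> UNIV" "\<lambda>(x, v). dderiv f x v" "\<lambda>z. (snd z, v (fst z))" "(x0, v0)"]
      f x0 U by (simp add: C1_on_def split_def)
qed

text \<open>Homogeneity is built into directional derivatives. Additivity comes from going from \<open>x\<close> to
  \<open>x + tv + tw\<close> in two steps: the second one starts at the moving point \<open>x + tv\<close>, for which continuity
  of the derivative in the base point is needed.\<close>

lemma C1_on_linear:
  assumes f: "C1_on U f" and x: "x \<in> U"
  shows "linear (dderiv f x)"
proof (rule linearI)
  fix v w
  have "((\<lambda>t. (f ((x + t *\<^sub>R v) + t *\<^sub>R w) - f (x + t *\<^sub>R v)) /\<^sub>R t) \<longlongrightarrow> dderiv f x w) (at 0)"
    by (rule C1_on_diff_quot_tendsto[OF f x tendsto_line tendsto_const tendsto_ident_at])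
      (simp add: eventually_at_filter)
  from tendsto_add[OF C1_on_D[OF f x, of v, unfolded has_dderiv_def] this]
  have lim: "((\<lambda>t. diff_quot f x v t + (f ((x + t *\<^sub>R v) + t *\<^sub>R w) - f (x + t *\<^sub>R v)) /\<^sub>R t)
      \<longlongrightarrow> dderiv f x v + dderiv f x w) (at 0)" .
  have eq: "diff_quot f x v t + (f ((x + t *\<^sub>R v) + t *\<^sub>R w) - f (x + t *\<^sub>R v)) /\<^sub>R t = diff_quot f x (v + w) t" for t
    by (simp add: diff_quot_def scaleR_right_diff_distrib scaleR_add_right add.assoc)
  have "has_dderiv f x (v + w) (dderiv f x v + dderiv f x w)"
    using lim unfolding eq has_dderiv_def .
  then show "dderiv f x (v + w) = dderiv f x v + dderiv f x w"
    by (rule has_dderiv_imp_eq)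
next
  fix r v
  show "dderiv f x (r *\<^sub>R v) = r *\<^sub>R dderiv f x v"
  proof (cases "r = 0")
    case True
    have "has_dderiv f x 0 0"
      by (simp add: has_dderiv_def diff_quot_def[abs_def])
    with True show ?thesis by (simp add: has_dderiv_imp_eq)
  next
    case False
    have "filterlim (\<lambda>t. r * t) (at 0) (at 0)"
      using False by (auto simp: filterlim_at eventually_at_filter intro!: tendsto_eq_intros)
    from tendsto_scaleR_lcs[OF tendsto_const filterlim_compose[OF C1_on_D[OF f x, unfolded has_dderiv_def] this]]
    have "((\<lambda>t. r *\<^sub>R diff_quot f x v (r * t)) \<longlongrightarrow> r *\<^sub>R dderiv f x v) (at 0)" .
    moreover have "r *\<^sub>R diff_quot f x v (r * t) = diff_quot f x (r *\<^sub>R v) t" for t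
    proof -
      have "r * inverse (r * t) = inverse t"
        using False by (simp add: inverse_mult_distrib)
      then show ?thesis
        by (simp only: diff_quot_def scaleR_scaleR mult.commute)
    qed
    ultimately show ?thesis
      by (simp add: has_dderiv_imp_eq has_dderiv_def)
  qed
qed

lemma has_dderiv_imp_tendsto_line:
  assumes "has_dderiv f x v l"
  shows "((\<lambda>t. f (x + t *\<^sub>R v)) \<longlongrightarrow> f x) (at 0)"
proof (rule Lim_transform_eventually)
  show "((\<lambda>t. f x + t *\<^sub>R diff_quot f x v t) \<longlongrightarrow> f x) (at 0)"
    using tendsto_add[OF tendsto_const tendsto_scaleR_lcs[OF tendsto_ident_at assms[unfolded has_dderiv_def]]]
    by fastforce
qed (auto simp: eventually_at_filter diff_quot_def)

text \<open>With \<open>q\<^sub>t\<close> the difference quotient of \<open>f\<close>, the point \<open>f (x + tv)\<close> is \<open>f x + t q\<^sub>t\<close>: the direction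
  moves, which is what the general form of the convergence of difference quotients allows for.\<close>

lemma has_dderiv_compose:
  assumes g: "C1_on V g" and V: "f x \<in> V" and f: "has_dderiv f x v l"
  shows "has_dderiv (\<lambda>x. g (f x)) x v (dderiv g (f x) l)"
proof -
  have "((\<lambda>t. (g (f x + t *\<^sub>R diff_quot f x v t) - g (f x)) /\<^sub>R t) \<longlongrightarrow> dderiv g (f x) l) (at 0)"
    by (rule C1_on_diff_quot_tendsto[OF g V tendsto_const f[unfolded has_dderiv_def] tendsto_ident_at])
      (simp add: eventually_at_filter)
  then show ?thesis
    unfolding has_dderiv_def
    by (rule Lim_transform_eventually) (auto simp: eventually_at_filter diff_quot_def)
qed

section \<open>Smooth maps between locally convex spaces\<close>

lemma tendsto_fun:
  fixes f :: "'i \<Rightarrow> 'a \<Rightarrow> 'b::topological_space"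
  assumes "\<And>k. ((\<lambda>i. f i k) \<longlongrightarrow> l k) F"
  shows "(f \<longlongrightarrow> l) F"
proof -
  have "limitin (product_topology (\<lambda>k. euclidean) UNIV) f l F"
    using assms by (simp add: limitin_componentwise)
  then show ?thesis
    by (simp add: euclidean_product_topology)
qed

lemma smooth_on_open: "smooth_on U f \<Longrightarrow> open U"
  by (simp add: smooth_on_def)

lemma smooth_on_has_dderiv_iter:
  assumes "smooth_on U f" "x \<in> U"
  shows "has_dderiv (iter_dderiv f vs) x v (iter_dderiv f (v # vs) x)"
  using assms has_dderiv_imp_eq unfolding smooth_on_def has_dderiv_def by force

lemma smooth_on_has_dderiv:
  assumes "smooth_on U f" "x \<in> U"
  shows "has_dderiv f x v (dderiv f x v)"
  using smooth_on_has_dderiv_iter[OF assms, of "[]"] by simp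

text \<open>The continuity of the \<open>k\<close>-th derivative in the base point and in all directions together, freed of
  the encoding of the directions by a sequence, which is filled up with zeros.\<close>

lemma smooth_on_iter_tendsto:
  assumes f: "smooth_on U f" and x: "(x \<longlongrightarrow> x0) F" "x0 \<in> U"
    and us: "list_all2 (\<lambda>u v. (u \<longlongrightarrow> v) F) us vs"
  shows "((\<lambda>i. iter_dderiv f (map (\<lambda>u. u i) us) (x i)) \<longlongrightarrow> iter_dderiv f vs x0) F"
proof -
  define w where "w i k = (if k < length us then (us ! k) i else 0)" for i k
  define w0 where "w0 k = (if k < length us then vs ! k else 0)" for k
  have len: "length vs = length us"
    using us by (simp add: list_all2_lengthD)
  have "(w \<longlongrightarrow> w0) F"
    using us by (intro tendsto_fun) (auto simp: w_def w0_def list_all2_conv_all_nth)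
  then have "((\<lambda>i. (x i, w i)) \<longlongrightarrow> (x0, w0)) F"
    by (rule tendsto_Pair[OF x(1)])
  moreover have "continuous_on (U \<times> UNIV) (\<lambda>(x, w). iter_dderiv f (map w [0..<length us]) x)"
    using f by (simp add: smooth_on_def)
  moreover have "\<forall>\<^sub>F i in F. x i \<in> U"
    using topological_tendstoD[OF x(1) smooth_on_open[OF f] x(2)] .
  ultimately have "((\<lambda>i. iter_dderiv f (map (w i) [0..<length us]) (x i))
      \<longlongrightarrow> iter_dderiv f (map w0 [0..<length us]) x0) F"
    using x(2) continuous_on_tendsto_compose[of "U \<times> UNIV" "\<lambda>(x, w). iter_dderiv f (map w [0..<length us]) x"
      "\<lambda>i. (x i, w i)" "(x0, w0)" F] by simp
  moreover have "map (w i) [0..<length us] = map (\<lambda>u. u i) us" for i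
    by (rule nth_equalityI) (auto simp: w_def)
  moreover have "map w0 [0..<length us] = vs"
    by (rule nth_equalityI) (auto simp: w0_def len)
  ultimately show ?thesis by simp
qed

lemma smooth_on_imp_C1_on_iter:
  fixes f :: "'e::locally_convex_space \<Rightarrow> 'f::locally_convex_space"
  assumes "smooth_on U f"
  shows "C1_on U (iter_dderiv f vs)"
  unfolding C1_on_def
proof (intro conjI ballI allI)
  show "open U"
    using assms by (rule smooth_on_open)
  show "has_dderiv (iter_dderiv f vs) x v (dderiv (iter_dderiv f vs) x v)" if "x \<in> U" for x v
    using smooth_on_has_dderiv_iter[OF assms that] by simp
  show "continuous_on (U \<times> UNIV) (\<lambda>(x, v). dderiv (iter_dderiv f vs) x v)"
    unfolding continuous_on_def
  proof safe
    fix x0 v0 :: 'e assume "x0 \<in> U"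
    have fst: "(fst \<longlongrightarrow> x0) (at (x0, v0) within U \<times> UNIV)"
      and snd: "(snd \<longlongrightarrow> v0) (at (x0, v0) within U \<times> UNIV)"
      by (auto intro!: tendsto_eq_intros)
    have "((\<lambda>i. iter_dderiv f (map (\<lambda>u. u i) (snd # map (\<lambda>v _. v) vs)) (fst i))
        \<longlongrightarrow> iter_dderiv f (v0 # vs) x0) (at (x0, v0) within U \<times> UNIV)"
      by (rule smooth_on_iter_tendsto[OF assms fst \<open>x0 \<in> U\<close>])
        (auto simp: snd list_all2_conv_all_nth nth_Cons split: nat.split)
    then show "((\<lambda>(x, v). dderiv (iter_dderiv f vs) x v) \<longlongrightarrow>
        dderiv (iter_dderiv f vs) x0 v0) (at (x0, v0) within U \<times> UNIV)"
      by (simp add: split_def o_def)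
  qed
qed

lemma smooth_on_imp_C1_on: "smooth_on U f \<Longrightarrow> C1_on U f"
  using smooth_on_imp_C1_on_iter[of U f "[]"] by simp

lemma smooth_on_imp_continuous_on:
  assumes "smooth_on U f"
  shows "continuous_on U f"
proof -
  have "continuous_on (U \<times> (UNIV :: (nat \<Rightarrow> 'a) set)) (\<lambda>(x, w). f x)"
    using assms unfolding smooth_on_def by (elim conjE allE[of _ "0::nat"]) simp
  moreover have "continuous_on U (\<lambda>x. (x, \<lambda>_::nat. 0 :: 'a))"
    by (intro continuous_intros)
  ultimately show ?thesis
    using continuous_on_compose2[of "U \<times> UNIV" "\<lambda>(x, w). f x" U "\<lambda>x. (x, \<lambda>_::nat. 0 :: 'a)"] by auto
qed

text \<open>A directional derivative that is continuous in base point and direction is linear, which settles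
  the first slot. In the other slots the derivative is a limit of difference quotients that are linear
  by induction.\<close>

lemma smooth_on_iter_linear:
  assumes f: "smooth_on U f" and "x \<in> U"
  shows "linear (\<lambda>u. iter_dderiv f (us @ u # vs) x)"
  using assms(2)
proof (induction us arbitrary: x)
  case Nil
  then show ?case
    using C1_on_linear[OF smooth_on_imp_C1_on_iter[OF f]] by simp
next
  case (Cons a us)
  let ?D = "\<lambda>u x. iter_dderiv f (us @ u # vs) x"
  have der: "has_dderiv (?D u) x a (iter_dderiv f ((a # us) @ u # vs) x)" for u
    using smooth_on_has_dderiv_iter[OF f Cons.prems] by simp
  show ?case
  proof (rule linearI)
    fix u v :: 'a
    show "iter_dderiv f ((a # us) @ (u + v) # vs) x
        = iter_dderiv f ((a # us) @ u # vs) x + iter_dderiv f ((a # us) @ v # vs) x"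
      using has_dderiv_add[OF der der, of u v] has_dderiv_cong[OF smooth_on_open[OF f] Cons.prems,
          of "?D (u + v)" "\<lambda>x. ?D u x + ?D v x" a] linear_add[OF Cons.IH] der[of "u + v"]
      by (intro has_dderiv_unique[where f = "?D (u + v)" and x = x and v = a]) auto
  next
    fix r :: real and u :: 'a
    show "iter_dderiv f ((a # us) @ (r *\<^sub>R u) # vs) x = r *\<^sub>R iter_dderiv f ((a # us) @ u # vs) x"
      using has_dderiv_scaleR[OF der, of r u] has_dderiv_cong[OF smooth_on_open[OF f] Cons.prems,
          of "?D (r *\<^sub>R u)" "\<lambda>x. r *\<^sub>R ?D u x" a] linear_scale[OF Cons.IH] der[of "r *\<^sub>R u"]
      by (intro has_dderiv_unique[where f = "?D (r *\<^sub>R u)" and x = x and v = a]) auto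
  qed
qed

text \<open>Difference quotients of a multilinear function, one slot at a time. The vectors \<open>ps\<close> stand in
  the slots that have already been dealt with.\<close>

lemma iter_dderiv_slots_tendsto:
  assumes f: "smooth_on U f" and y: "y \<in> U"
    and as: "list_all2 (\<lambda>a a'. has_dderiv a x v a') as as'"
  shows "((\<lambda>t. (iter_dderiv f (ps @ map (\<lambda>a. a (x + t *\<^sub>R v)) as) y -
        iter_dderiv f (ps @ map (\<lambda>a. a x) as) y) /\<^sub>R t) \<longlongrightarrow>
      (\<Sum>i<length as. iter_dderiv f (ps @ (map (\<lambda>a. a x) as)[i := as' ! i]) y)) (at 0)"
  using as
proof (induction as arbitrary: as' ps)
  case Nil
  then show ?case by simp
next
  case (Cons a as bs)
  then obtain b as' where bs: "bs = b # as'" and a: "has_dderiv a x v b"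
    and as: "list_all2 (\<lambda>a a'. has_dderiv a x v a') as as'"
    by (auto simp: list_all2_Cons1)
  let ?A = "\<lambda>t. map (\<lambda>a. a (x + t *\<^sub>R v)) as" and ?B = "map (\<lambda>a. a x) as"
  have "((\<lambda>t. iter_dderiv f (map (\<lambda>u. u t) (map (\<lambda>p _. p) ps @ diff_quot a x v # map (\<lambda>a t. a (x + t *\<^sub>R v)) as)) y)
      \<longlongrightarrow> iter_dderiv f (ps @ b # ?B) y) (at 0)"
    using a[unfolded has_dderiv_def] as
    by (intro smooth_on_iter_tendsto[OF f tendsto_const y] list_all2_appendI)
      (auto simp: has_dderiv_def[symmetric] list_all2_map1 list_all2_map2 list_all2_conv_all_nth
        nth_Cons split: nat.split intro!: has_dderiv_imp_tendsto_line)
  then have 1: "((\<lambda>t. iter_dderiv f (ps @ diff_quot a x v t # ?A t) y)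
      \<longlongrightarrow> iter_dderiv f (ps @ b # ?B) y) (at 0)"
    by (simp add: o_def)
  have 2: "((\<lambda>t. (iter_dderiv f ((ps @ [a x]) @ ?A t) y - iter_dderiv f ((ps @ [a x]) @ ?B) y) /\<^sub>R t)
      \<longlongrightarrow> (\<Sum>i<length as. iter_dderiv f ((ps @ [a x]) @ ?B[i := as' ! i]) y)) (at 0)"
    by (rule Cons.IH[OF as])
  \<comment> \<open>The first slot is changed while the later ones have moved already; then \<open>a x\<close> joins \<open>ps\<close>.\<close>
  have eq: "iter_dderiv f (ps @ diff_quot a x v t # ?A t) y +
      (iter_dderiv f ((ps @ [a x]) @ ?A t) y - iter_dderiv f ((ps @ [a x]) @ ?B) y) /\<^sub>R t =
      (iter_dderiv f (ps @ map (\<lambda>a. a (x + t *\<^sub>R v)) (a # as)) y -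
        iter_dderiv f (ps @ map (\<lambda>a. a x) (a # as)) y) /\<^sub>R t" for t
    unfolding diff_quot_def
    by (simp add: linear_scale[OF smooth_on_iter_linear[OF f y]] linear_diff[OF smooth_on_iter_linear[OF f y]]
        scaleR_right_diff_distrib)
  show ?case
    using tendsto_add[OF 1 2] unfolding eq bs by (simp add: sum.lessThan_Suc_shift del: sum.lessThan_Suc)
qed

text \<open>The product rule: \<open>f\<^sup>(\<^sup>k\<^sup>)\<close> is continuous and multilinear in its \<open>k\<close> directions, so it may be
  differentiated along a curve that moves the base point \<open>p x\<close> and all directions \<open>a x\<close>.\<close>

lemma has_dderiv_iter_dderiv:
  assumes f: "smooth_on U f" and p: "p x \<in> U" "has_dderiv p x v p'"
    and as: "list_all2 (\<lambda>a a'. has_dderiv a x v a') as as'"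
  shows "has_dderiv (\<lambda>x. iter_dderiv f (map (\<lambda>a. a x) as) (p x)) x v
      (iter_dderiv f (p' # map (\<lambda>a. a x) as) (p x) +
        (\<Sum>i<length as. iter_dderiv f ((map (\<lambda>a. a x) as)[i := as' ! i]) (p x)))"
proof -
  let ?A = "\<lambda>t. map (\<lambda>a. a (x + t *\<^sub>R v)) as" and ?B = "map (\<lambda>a. a x) as"
  have lim: "list_all2 (\<lambda>u v. (u \<longlongrightarrow> v) (at 0)) (map (\<lambda>a t. a (x + t *\<^sub>R v)) as) ?B"
    using as by (auto simp: list_all2_conv_all_nth intro!: has_dderiv_imp_tendsto_line)
  have 1: "((\<lambda>t. (iter_dderiv f (?A t) (p x + t *\<^sub>R diff_quot p x v t) - iter_dderiv f (?A t) (p x)) /\<^sub>R t)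
      \<longlongrightarrow> iter_dderiv f (p' # ?B) (p x)) (at 0)"
  proof (rule diff_quot_tendsto[where D = "\<lambda>t y. iter_dderiv f (diff_quot p x v t # ?A t) y",
        OF _ _ tendsto_const p(2)[unfolded has_dderiv_def] tendsto_ident_at])
    have U: "\<forall>\<^sub>F (t, y) in at 0 \<times>\<^sub>F nhds (p x). y \<in> U"
      using topological_tendstoD[OF filterlim_snd smooth_on_open[OF f] p(1)] by (simp add: split_def)
    then show "\<forall>\<^sub>F (t, y) in at 0 \<times>\<^sub>F nhds (p x).
        has_dderiv (iter_dderiv f (?A t)) y (diff_quot p x v t) (iter_dderiv f (diff_quot p x v t # ?A t) y)"
      by eventually_elim (use smooth_on_has_dderiv_iter[OF f] in auto)
    have "((\<lambda>z. iter_dderiv f (map (\<lambda>u. u z) ((\<lambda>z. diff_quot p x v (fst z)) # map (\<lambda>a z. a (x + fst z *\<^sub>R v)) as)) (snd z))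
      \<longlongrightarrow> iter_dderiv f (p' # ?B) (p x)) (at 0 \<times>\<^sub>F nhds (p x))"
      using p(2) lim
      by (intro smooth_on_iter_tendsto[OF f filterlim_snd p(1)])
        (auto simp: has_dderiv_def list_all2_map1 list_all2_map2 list_all2_conv_all_nth nth_Cons
          split: nat.split intro!: filterlim_compose[OF _ filterlim_fst])
    then show "((\<lambda>(t, y). iter_dderiv f (diff_quot p x v t # ?A t) y)
        \<longlongrightarrow> iter_dderiv f (p' # ?B) (p x)) (at 0 \<times>\<^sub>F nhds (p x))"
      by (simp add: split_def o_def)
    show "\<forall>\<^sub>F t::real in at 0. t \<noteq> 0"
      by (simp add: eventually_at_filter)
  qed
  have 2: "((\<lambda>t. (iter_dderiv f (?A t) (p x) - iter_dderiv f ?B (p x)) /\<^sub>R t) \<longlongrightarrow>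
      (\<Sum>i<length as. iter_dderiv f (?B[i := as' ! i]) (p x))) (at 0)"
    using iter_dderiv_slots_tendsto[OF f p(1) as, of "[]"] by simp
  show ?thesis
    unfolding has_dderiv_def
  proof (rule Lim_transform_eventually[OF tendsto_add[OF 1 2]])
    show "\<forall>\<^sub>F t in at 0. (iter_dderiv f (?A t) (p x + t *\<^sub>R diff_quot p x v t) - iter_dderiv f (?A t) (p x)) /\<^sub>R t +
        (iter_dderiv f (?A t) (p x) - iter_dderiv f ?B (p x)) /\<^sub>R t =
        diff_quot (\<lambda>x. iter_dderiv f (map (\<lambda>a. a x) as) (p x)) x v t"
      by (auto simp: eventually_at_filter diff_quot_def simp flip: scaleR_add_right)
  qed
qed

text \<open>Smoothness by coinduction. \<open>Q\<close> is a class of functions of a point and of a sequence of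
  directions which contains \<open>f\<close> and which is closed under differentiation; differentiating consumes
  the first direction and shifts the others.\<close>

lemma smooth_on_coinduct:
  fixes f :: "'e::locally_convex_space \<Rightarrow> 'f::locally_convex_space"
    and Q :: "('e \<Rightarrow> (nat \<Rightarrow> 'e) \<Rightarrow> 'f) \<Rightarrow> bool"
  assumes U: "open U" and f: "Q (\<lambda>x w. f x)"
    and cont: "\<And>H. Q H \<Longrightarrow> continuous_on (U \<times> UNIV) (\<lambda>(x, w). H x w)"
    and der: "\<And>H. Q H \<Longrightarrow> \<exists>H'. Q H' \<and> (\<forall>x\<in>U. \<forall>w. has_dderiv (\<lambda>x. H x (\<lambda>i. w (Suc i))) x (w 0) (H' x w))"
  shows "smooth_on U f"
proof -
  have *: "\<exists>H. Q H \<and> (\<forall>x\<in>U. \<forall>w. iter_dderiv f (map w [0..<k]) x = H x w)" for k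
  proof (induction k)
    case 0
    with f show ?case by auto
  next
    case (Suc k)
    then obtain H where H: "Q H" "\<And>x w. x \<in> U \<Longrightarrow> iter_dderiv f (map w [0..<k]) x = H x w"
      by auto
    obtain H' where H': "Q H'" "\<And>x w. x \<in> U \<Longrightarrow> has_dderiv (\<lambda>x. H x (\<lambda>i. w (Suc i))) x (w 0) (H' x w)"
      using der[OF H(1)] by auto
    have "iter_dderiv f (map w [0..<Suc k]) x = H' x w" if x: "x \<in> U" for x w
    proof -
      have "map w [0..<Suc k] = w 0 # map (\<lambda>i. w (Suc i)) [0..<k]"
        by (simp add: upt_conv_Cons map_Suc_upt[symmetric] o_def del: upt_Suc)
      moreover have "dderiv (iter_dderiv f (map (\<lambda>i. w (Suc i)) [0..<k])) x (w 0) = H' x w"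
        using H'(2)[OF x, of w] H(2)
        by (subst dderiv_cong[OF U x, where g = "\<lambda>x. H x (\<lambda>i. w (Suc i))"]) (auto intro: has_dderiv_imp_eq)
      ultimately show ?thesis by simp
    qed
    with H'(1) show ?case by blast
  qed
  show ?thesis
    unfolding smooth_on_def
  proof (intro conjI allI ballI)
    show "open U" by (rule U)
  next
    fix vs :: "'e list" and x v :: 'e assume x: "x \<in> U"
    obtain H where H: "Q H" "\<And>x w. x \<in> U \<Longrightarrow> iter_dderiv f (map w [0..<length vs]) x = H x w"
      using *[of "length vs"] by auto
    obtain H' where H': "\<And>x w. x \<in> U \<Longrightarrow> has_dderiv (\<lambda>x. H x (\<lambda>i. w (Suc i))) x (w 0) (H' x w)"
      using der[OF H(1)] by auto
    define w where "w i = (v # vs) ! i" for i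
    have "has_dderiv (\<lambda>x. H x ((!) vs)) x v (H' x w)"
      using H'[OF x, of w] by (simp add: w_def)
    moreover have "iter_dderiv f vs y = H y ((!) vs)" if "y \<in> U" for y
      using H(2)[OF that, of "(!) vs"] by (simp add: map_nth)
    ultimately have "has_dderiv (iter_dderiv f vs) x v (H' x w)"
      by (simp add: has_dderiv_cong[OF U x, of "iter_dderiv f vs" "\<lambda>x. H x ((!) vs)"])
    then show "\<exists>l. (diff_quot (iter_dderiv f vs) x v \<longlongrightarrow> l) (at 0)"
      by (auto simp: has_dderiv_def)
  next
    fix k
    obtain H where H: "Q H" "\<And>x w. x \<in> U \<Longrightarrow> iter_dderiv f (map w [0..<k]) x = H x w"
      using *[of k] by auto
    show "continuous_on (U \<times> UNIV) (\<lambda>(x, w). iter_dderiv f (map w [0..<k]) x)"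
      using cont[OF H(1)] H(2) by (subst continuous_on_cong[OF refl]) auto
  qed
qed

section \<open>Closure properties of smooth maps\<close>

lemma iter_dderiv_cong:
  assumes "open U" "x \<in> U" "\<And>y. y \<in> U \<Longrightarrow> f y = g y"
  shows "iter_dderiv f vs x = iter_dderiv g vs x"
  using assms(2)
proof (induction vs arbitrary: x)
  case (Cons v vs)
  then show ?case
    by (simp, intro dderiv_cong[OF assms(1)]) auto
qed (use assms in auto)

lemma smooth_on_cong:
  assumes f: "smooth_on U f" and eq: "\<And>y. y \<in> U \<Longrightarrow> f y = g y"
  shows "smooth_on U g"
  unfolding smooth_on_def
proof (intro conjI allI ballI)
  show U: "open U"
    using f by (rule smooth_on_open)
  have iter: "iter_dderiv f vs x = iter_dderiv g vs x" if "x \<in> U" for vs x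
    using iter_dderiv_cong[OF U that eq] .
  fix vs v x assume x: "x \<in> U"
  show "\<exists>l. (diff_quot (iter_dderiv g vs) x v \<longlongrightarrow> l) (at 0)"
    using smooth_on_has_dderiv_iter[OF f x, of vs v] has_dderiv_cong[OF U x, of "iter_dderiv f vs" "iter_dderiv g vs"] iter
    unfolding has_dderiv_def by metis
next
  fix k
  have "continuous_on (U \<times> UNIV) (\<lambda>(x, w). iter_dderiv f (map w [0..<k]) x)"
    using f by (simp add: smooth_on_def)
  then show "continuous_on (U \<times> UNIV) (\<lambda>(x, w). iter_dderiv g (map w [0..<k]) x)"
    using iter_dderiv_cong[OF smooth_on_open[OF f] _ eq]
    by (subst (asm) continuous_on_cong[OF refl]) auto
qed

lemma smooth_on_subset:
  assumes "smooth_on U f" "open S" "S \<subseteq> U"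
  shows "smooth_on S f"
  using assms continuous_on_subset[of "U \<times> UNIV" _ "S \<times> UNIV"] unfolding smooth_on_def by blast

lemma smooth_on_local:
  fixes f :: "'e::locally_convex_space \<Rightarrow> 'f::locally_convex_space"
  assumes "\<And>x. x \<in> U \<Longrightarrow> \<exists>N. x \<in> N \<and> N \<subseteq> U \<and> smooth_on N f"
  shows "smooth_on U f"
  unfolding smooth_on_def
proof (intro conjI allI ballI)
  show "open U"
    by (rule topological_space_class.openI) (use assms smooth_on_open in blast)
  fix vs v x assume "x \<in> U"
  then show "\<exists>l. (diff_quot (iter_dderiv f vs) x v \<longlongrightarrow> l) (at 0)"
    using assms smooth_on_has_dderiv_iter unfolding has_dderiv_def by blast
next
  fix k
  define \<N> where "\<N> = {N. N \<subseteq> U \<and> smooth_on N f}"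
  have "continuous_on (\<Union>N\<in>\<N>. N \<times> (UNIV :: (nat \<Rightarrow> 'e) set)) (\<lambda>(x, w). iter_dderiv f (map w [0..<k]) x)"
    by (rule continuous_on_open_UN) (auto simp: \<N>_def smooth_on_def open_Times)
  moreover have "(\<Union>N\<in>\<N>. N \<times> (UNIV :: (nat \<Rightarrow> 'e) set)) = U \<times> UNIV"
  proof -
    have "\<Union>\<N> = U"
      using assms unfolding \<N>_def by blast
    then show ?thesis by blast
  qed
  ultimately show "continuous_on (U \<times> UNIV) (\<lambda>(x, w :: nat \<Rightarrow> 'e). iter_dderiv f (map w [0..<k]) x)"
    by simp
qed

inductive_set sums_of :: "('a \<Rightarrow> 'b \<Rightarrow> 'f::monoid_add) set \<Rightarrow> ('a \<Rightarrow> 'b \<Rightarrow> 'f) set" for T where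
  zero: "(\<lambda>x w. 0) \<in> sums_of T"
| base: "H \<in> T \<Longrightarrow> H \<in> sums_of T"
| add: "H \<in> sums_of T \<Longrightarrow> K \<in> sums_of T \<Longrightarrow> (\<lambda>x w. H x w + K x w) \<in> sums_of T"

lemma sum_in_sums_of:
  fixes H :: "nat \<Rightarrow> 'a \<Rightarrow> 'b \<Rightarrow> 'f::comm_monoid_add"
  assumes "\<And>i. i < n \<Longrightarrow> H i \<in> sums_of T"
  shows "(\<lambda>x w. \<Sum>i<n. H i x w) \<in> sums_of T"
  using assms by (induction n) (auto intro: sums_of.intros)

text \<open>Differentiation is additive, so the finite sums of terms form a class suitable for coinduction as
  soon as the derivative of a single term is such a sum.\<close>

lemma smooth_on_terms:
  fixes f :: "'e::locally_convex_space \<Rightarrow> 'f::locally_convex_space"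
    and T :: "('e \<Rightarrow> (nat \<Rightarrow> 'e) \<Rightarrow> 'f) set"
  assumes U: "open U" and f: "(\<lambda>x w. f x) \<in> sums_of T"
    and cont: "\<And>H. H \<in> T \<Longrightarrow> continuous_on (U \<times> UNIV) (\<lambda>(x, w). H x w)"
    and der: "\<And>H. H \<in> T \<Longrightarrow> \<exists>H'\<in>sums_of T. \<forall>x\<in>U. \<forall>w. has_dderiv (\<lambda>x. H x (\<lambda>i. w (Suc i))) x (w 0) (H' x w)"
  shows "smooth_on U f"
proof (rule smooth_on_coinduct[where Q = "\<lambda>H. H \<in> sums_of T", OF U f])
  fix H assume "H \<in> sums_of T"
  then show "continuous_on (U \<times> UNIV) (\<lambda>(x, w). H x w)"
  proof induction
    case (add H K)
    then show ?case
      unfolding split_def continuous_on_def by (auto intro!: tendsto_add)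
  qed (use cont in auto)
next
  fix H assume "H \<in> sums_of T"
  then have "\<exists>H'\<in>sums_of T. \<forall>x\<in>U. \<forall>w. has_dderiv (\<lambda>x. H x (\<lambda>i. w (Suc i))) x (w 0) (H' x w)"
  proof induction
    case zero
    show ?case
      by (intro bexI[OF _ sums_of.zero]) (simp add: has_dderiv_const)
  next
    case (base H)
    then show ?case by (rule der)
  next
    case (add H K)
    then obtain H' K' where "H' \<in> sums_of T" "K' \<in> sums_of T"
        "\<forall>x\<in>U. \<forall>w. has_dderiv (\<lambda>x. H x (\<lambda>i. w (Suc i))) x (w 0) (H' x w)"
        "\<forall>x\<in>U. \<forall>w. has_dderiv (\<lambda>x. K x (\<lambda>i. w (Suc i))) x (w 0) (K' x w)"
      by blast
    then show ?case
      by (intro bexI[OF _ sums_of.add[of H' T K']]) (auto intro: has_dderiv_add)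
  qed
  then show "\<exists>H'. H' \<in> sums_of T \<and> (\<forall>x\<in>U. \<forall>w. has_dderiv (\<lambda>x. H x (\<lambda>i. w (Suc i))) x (w 0) (H' x w))"
    by auto
qed

lemma continuous_on_iter_dderiv_compose:
  assumes g: "smooth_on V g" and p: "continuous_on S p" "\<And>z. z \<in> S \<Longrightarrow> p z \<in> V"
    and as: "\<And>a. a \<in> set as \<Longrightarrow> continuous_on S a"
  shows "continuous_on S (\<lambda>z. iter_dderiv g (map (\<lambda>a. a z) as) (p z))"
  unfolding continuous_on_def
proof
  fix z assume z: "z \<in> S"
  show "((\<lambda>z. iter_dderiv g (map (\<lambda>a. a z) as) (p z)) \<longlongrightarrow> iter_dderiv g (map (\<lambda>a. a z) as) (p z)) (at z within S)"
    using p as z by (intro smooth_on_iter_tendsto[OF g]) (auto simp: continuous_on_def list_all2_conv_all_nth)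
qed

text \<open>The formula of Faa di Bruno without the bookkeeping: if the base point \<open>p\<close> and the functions
  in \<open>\<A>\<close> have their derivatives in \<open>\<A>\<close>, then by the product rule every derivative of
  \<open>g\<^sup>(\<^sup>k\<^sup>)(p x; a\<^sub>1, \<dots>, a\<^sub>k)\<close> is a sum of terms of the same shape. The chain rule for smooth maps and the
  smoothness of the derivative are the two applications.\<close>

lemma smooth_on_iter_dderiv_compose:
  fixes g :: "'h::locally_convex_space \<Rightarrow> 'f::locally_convex_space"
    and \<A> :: "('e::locally_convex_space \<Rightarrow> (nat \<Rightarrow> 'e) \<Rightarrow> 'h) set"
  assumes g: "smooth_on V g" and U: "open U" and p: "\<And>x. x \<in> U \<Longrightarrow> p x \<in> V" "continuous_on U p"
    and p': "p' \<in> \<A>" "\<And>x w. x \<in> U \<Longrightarrow> has_dderiv p x (w 0) (p' x w)"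
    and cont: "\<And>a. a \<in> \<A> \<Longrightarrow> continuous_on (U \<times> UNIV) (\<lambda>(x, w). a x w)"
    and shift: "\<And>a. a \<in> \<A> \<Longrightarrow> (\<lambda>x w. a x (\<lambda>i. w (Suc i))) \<in> \<A>"
    and der: "\<And>a. a \<in> \<A> \<Longrightarrow> \<exists>a'\<in>\<A>. \<forall>x\<in>U. \<forall>w. has_dderiv (\<lambda>x. a x (\<lambda>i. w (Suc i))) x (w 0) (a' x w)"
    and as: "set as \<subseteq> \<A>" "\<And>x w. iter_dderiv g (map (\<lambda>a. a x w) as) (p x) = f x"
  shows "smooth_on U f"
proof -
  define T where "T = {\<lambda>x w. iter_dderiv g (map (\<lambda>a. a x w) as) (p x) |as. set as \<subseteq> \<A>}"
  show ?thesis
  proof (rule smooth_on_terms[OF U, where T = T])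
    have "(\<lambda>x w. iter_dderiv g (map (\<lambda>a. a x w) as) (p x)) \<in> T"
      using as(1) by (auto simp: T_def)
    then show "(\<lambda>x w. f x) \<in> sums_of T"
      by (simp add: as(2) sums_of.base)
  next
    fix H assume "H \<in> T"
    then obtain as where as: "set as \<subseteq> \<A>" and H: "H = (\<lambda>x w. iter_dderiv g (map (\<lambda>a. a x w) as) (p x))"
      by (auto simp: T_def)
    have "continuous_on (U \<times> UNIV) (\<lambda>z. iter_dderiv g (map (\<lambda>b. b z) (map (\<lambda>a (x, w). a x w) as)) (p (fst z)))"
      using as cont by (intro continuous_on_iter_dderiv_compose[OF g] continuous_on_compose2[OF p(2)])
        (auto intro: continuous_on_fst p(1))
    then show "continuous_on (U \<times> UNIV) (\<lambda>(x, w). H x w)"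
      by (simp add: H split_def o_def)
    obtain d where d: "\<And>a. a \<in> \<A> \<Longrightarrow> d a \<in> \<A>"
        "\<And>a x w. a \<in> \<A> \<Longrightarrow> x \<in> U \<Longrightarrow> has_dderiv (\<lambda>x. a x (\<lambda>i. w (Suc i))) x (w 0) (d a x w)"
      using der by metis
    define s where "s a = (\<lambda>x w. a x (\<lambda>i. w (Suc i)))" for a :: "'e \<Rightarrow> (nat \<Rightarrow> 'e) \<Rightarrow> 'h"
    have s: "s a \<in> \<A>" if "a \<in> \<A>" for a
      using shift[OF that] by (simp add: s_def)
    have in_T: "(\<lambda>x w. iter_dderiv g (map (\<lambda>a. a x w) as) (p x)) \<in> sums_of T" if "set as \<subseteq> \<A>" for as
      using that by (auto simp: T_def intro: sums_of.base)
    let ?H = "\<lambda>x w. iter_dderiv g (map (\<lambda>a. a x w) (p' # map s as)) (p x) +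
        (\<Sum>i<length as. iter_dderiv g (map (\<lambda>a. a x w) ((map s as)[i := d (as ! i)])) (p x))"
    have "set (map s as) \<subseteq> \<A>"
      using as s by auto
    moreover have "set ((map s as)[i := d (as ! i)]) \<subseteq> \<A>" if "i < length as" for i
    proof -
      have "d (as ! i) \<in> \<A>"
        using that as d(1) nth_mem by blast
      then show ?thesis
        using set_update_subset_insert[of "map s as" i "d (as ! i)"] \<open>set (map s as) \<subseteq> \<A>\<close> by blast
    qed
    ultimately have "?H \<in> sums_of T"
      using p'(1) by (intro sums_of.add sum_in_sums_of in_T) auto
    moreover have "has_dderiv (\<lambda>x. H x (\<lambda>i. w (Suc i))) x (w 0) (?H x w)" if "x \<in> U" for x w
    proof -
      have "has_dderiv (\<lambda>x. iter_dderiv g (map (\<lambda>b. b x) (map (\<lambda>a x. a x (\<lambda>i. w (Suc i))) as)) (p x)) x (w 0)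
        (iter_dderiv g (p' x w # map (\<lambda>b. b x) (map (\<lambda>a x. a x (\<lambda>i. w (Suc i))) as)) (p x) +
        (\<Sum>i<length (map (\<lambda>a x. a x (\<lambda>i. w (Suc i))) as).
          iter_dderiv g ((map (\<lambda>b. b x) (map (\<lambda>a x. a x (\<lambda>i. w (Suc i))) as))[i := map (\<lambda>a. d a x w) as ! i]) (p x)))"
        using nth_mem as that p p'(2) d(2)
        by (intro has_dderiv_iter_dderiv[OF g]) (auto simp: list_all2_conv_all_nth subset_iff)
      then show ?thesis
        by (simp add: H o_def s_def map_update)
    qed
    ultimately show "\<exists>H'\<in>sums_of T. \<forall>x\<in>U. \<forall>w. has_dderiv (\<lambda>x. H x (\<lambda>i. w (Suc i))) x (w 0) (H' x w)"
      by (intro bexI[of _ ?H]) auto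
  qed
qed

text \<open>The directions are picked from the sequence by an arbitrary list of indices, so that the class
  is closed under the shift of the sequence that comes with each differentiation.\<close>

definition iter_terms :: "('e::locally_convex_space \<Rightarrow> 'f::locally_convex_space) \<Rightarrow> ('e \<Rightarrow> (nat \<Rightarrow> 'e) \<Rightarrow> 'f) set" where
  "iter_terms f = {\<lambda>x w. iter_dderiv f (map w is) x |is. True}"

lemma continuous_on_direction:
  fixes S :: "('a::topological_space \<times> (nat \<Rightarrow> 'b::topological_space)) set"
  shows "continuous_on S (\<lambda>z. snd z i)"
  by (rule continuous_on_product_then_coordinatewise[OF continuous_on_snd[OF continuous_on_id]])

lemma iter_terms_continuous:
  assumes f: "smooth_on U f" and "a \<in> iter_terms f"
  shows "continuous_on (U \<times> UNIV) (\<lambda>(x, w). a x w)"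
proof -
  obtain "is" where a: "a = (\<lambda>x w. iter_dderiv f (map w is) x)"
    using assms(2) by (auto simp: iter_terms_def)
  have "continuous_on (U \<times> (UNIV :: (nat \<Rightarrow> 'a) set))
      (\<lambda>z. iter_dderiv f (map (\<lambda>b. b z) (map (\<lambda>i z. snd z i) is)) (fst z))"
    by (intro continuous_on_iter_dderiv_compose[OF f])
      (auto intro!: continuous_intros continuous_on_direction)
  then show ?thesis
    by (simp add: a split_def o_def)
qed

lemma iter_terms_shift: "a \<in> iter_terms f \<Longrightarrow> (\<lambda>x w. a x (\<lambda>i. w (Suc i))) \<in> iter_terms f"
  unfolding iter_terms_def
proof clarify
  fix "is"
  show "\<exists>is'. (\<lambda>x w. iter_dderiv f (map (\<lambda>i. w (Suc i)) is) x) = (\<lambda>x w. iter_dderiv f (map w is') x) \<and> True"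
    by (rule exI[of _ "map Suc is"]) (simp add: o_def)
qed

lemma iter_terms_derivative:
  assumes f: "smooth_on U f" and "a \<in> iter_terms f"
  shows "\<exists>a'\<in>iter_terms f. \<forall>x\<in>U. \<forall>w. has_dderiv (\<lambda>x. a x (\<lambda>i. w (Suc i))) x (w 0) (a' x w)"
proof -
  obtain "is" where a: "a = (\<lambda>x w. iter_dderiv f (map w is) x)"
    using assms(2) by (auto simp: iter_terms_def)
  have "(\<lambda>x w. iter_dderiv f (map w (0 # map Suc is)) x) \<in> iter_terms f"
    unfolding iter_terms_def by blast
  moreover have "has_dderiv (\<lambda>x. a x (\<lambda>i. w (Suc i))) x (w 0) (iter_dderiv f (map w (0 # map Suc is)) x)"
    if "x \<in> U" for x w
    using smooth_on_has_dderiv_iter[OF f that, of "map (\<lambda>i. w (Suc i)) is" "w 0"] by (simp add: a o_def)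
  ultimately show ?thesis
    by (intro bexI[of _ "\<lambda>x w. iter_dderiv f (map w (0 # map Suc is)) x"]) auto
qed

lemma smooth_on_compose:
  assumes f: "smooth_on U f" and g: "smooth_on V g" and "\<And>x. x \<in> U \<Longrightarrow> f x \<in> V"
  shows "smooth_on U (\<lambda>x. g (f x))"
proof (rule smooth_on_iter_dderiv_compose[OF g smooth_on_open[OF f] assms(3) smooth_on_imp_continuous_on[OF f],
    where \<A> = "iter_terms f" and as = "[]" and p' = "\<lambda>x w. dderiv f x (w 0)"])
  show "(\<lambda>x w. dderiv f x (w 0)) \<in> iter_terms f"
    by (auto simp: iter_terms_def intro!: exI[of _ "[0]"])
  show "has_dderiv f x (w 0) (dderiv f x (w 0))" if "x \<in> U" for x and w :: "nat \<Rightarrow> 'a"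
    using smooth_on_has_dderiv[OF f that] .
  fix a assume a: "a \<in> iter_terms f"
  show "continuous_on (U \<times> UNIV) (\<lambda>(x, w). a x w)"
    by (rule iter_terms_continuous[OF f a])
  show "(\<lambda>x w. a x (\<lambda>i. w (Suc i))) \<in> iter_terms f"
    by (rule iter_terms_shift[OF a])
  show "\<exists>a'\<in>iter_terms f. \<forall>x\<in>U. \<forall>w. has_dderiv (\<lambda>x. a x (\<lambda>i. w (Suc i))) x (w 0) (a' x w)"
    by (rule iter_terms_derivative[OF f a])
qed simp_all

text \<open>In \<open>df (x, v)\<close> both the base point and the direction vary; with the second component \<open>v\<close> itself as
  the only direction, this is a case of the preceding computation.\<close>

lemma smooth_on_dderiv:
  fixes f :: "'e::locally_convex_space \<Rightarrow> 'f::locally_convex_space"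
  assumes f: "smooth_on U f"
  shows "smooth_on (U \<times> UNIV) (\<lambda>(x, v). dderiv f x v)"
proof -
  define \<A> :: "('e \<times> 'e \<Rightarrow> (nat \<Rightarrow> 'e \<times> 'e) \<Rightarrow> 'e) set" where
    "\<A> = {\<lambda>z w. 0, \<lambda>z w. snd z} \<union> range (\<lambda>i z w. fst (w i)) \<union> range (\<lambda>i z w. snd (w i))"
  show ?thesis
  proof (rule smooth_on_iter_dderiv_compose[OF f, where \<A> = \<A> and as = "[\<lambda>z w. snd z]" and p = fst
        and p' = "\<lambda>z w. fst (w 0)"])
    show "open (U \<times> UNIV)"
      using smooth_on_open[OF f] by (simp add: open_Times)
    show "has_dderiv fst z (w 0) (fst (w 0))" for z :: "'e \<times> 'e" and w :: "nat \<Rightarrow> 'e \<times> 'e"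
      by (rule has_dderiv_linear) (simp add: linear_iff)
    have snd: "has_dderiv snd z v (snd v)" for z v :: "'e \<times> 'e"
      by (rule has_dderiv_linear) (simp add: linear_iff)
    fix a assume a: "a \<in> \<A>"
    show "continuous_on ((U \<times> UNIV) \<times> UNIV) (\<lambda>(x, w). a x w)"
      using a by (auto simp: \<A>_def split_def intro!: continuous_intros continuous_on_direction)
    show "(\<lambda>x w. a x (\<lambda>i. w (Suc i))) \<in> \<A>"
      using a by (auto simp: \<A>_def)
    show "\<exists>a'\<in>\<A>. \<forall>z\<in>U \<times> UNIV. \<forall>w. has_dderiv (\<lambda>z. a z (\<lambda>i. w (Suc i))) z (w 0) (a' z w)"
    proof (cases "a = (\<lambda>z w. snd z)")
      case True
      then show ?thesis
        by (intro bexI[of _ "\<lambda>z w. snd (w 0)"]) (auto simp: \<A>_def snd)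
    next
      case False
      with a show ?thesis
        by (intro bexI[of _ "\<lambda>z w. 0"]) (auto simp: \<A>_def has_dderiv_const)
    qed
  qed (auto simp: \<A>_def intro: continuous_on_fst)
qed

lemma smooth_on_const: "open U \<Longrightarrow> smooth_on U (\<lambda>x. c)"
  by (rule smooth_on_coinduct[where Q = "\<lambda>H. \<exists>c. H = (\<lambda>x w. c)"]) (auto intro: has_dderiv_const)

lemma smooth_on_linear:
  fixes L :: "'e::locally_convex_space \<Rightarrow> 'f::locally_convex_space"
  assumes L: "linear L" "continuous_on UNIV L" and U: "open U"
  shows "smooth_on U L"
proof (rule smooth_on_terms[OF U, where T = "insert (\<lambda>x w. L x) (range (\<lambda>(i::nat) x w. L (w i)))"])
  show "(\<lambda>x w. L x) \<in> sums_of (insert (\<lambda>x w. L x) (range (\<lambda>(i::nat) x w. L (w i))))"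
    by (auto intro: sums_of.base)
  fix H assume H: "H \<in> insert (\<lambda>x w. L x) (range (\<lambda>(i::nat) x w. L (w i)))"
  show "continuous_on (U \<times> UNIV) (\<lambda>(x, w). H x w)"
  proof (cases "H = (\<lambda>x w. L x)")
    case True
    then show ?thesis
      using continuous_on_compose2[OF L(2) continuous_on_fst[OF continuous_on_id], of "U \<times> UNIV"]
      by (simp add: split_def)
  next
    case False
    with H obtain i where "H = (\<lambda>x w. L (w i))"
      by blast
    then show ?thesis
      using continuous_on_compose2[OF L(2) continuous_on_direction[of "U \<times> UNIV" i]]
      by (simp add: split_def)
  qed
  show "\<exists>H'\<in>sums_of (insert (\<lambda>x w. L x) (range (\<lambda>(i::nat) x w. L (w i)))).
      \<forall>x\<in>U. \<forall>w. has_dderiv (\<lambda>x. H x (\<lambda>i. w (Suc i))) x (w 0) (H' x w)"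
  proof (cases "H = (\<lambda>x w. L x)")
    case True
    then show ?thesis
      by (intro bexI[of _ "\<lambda>x w. L (w 0)"]) (auto intro: sums_of.base has_dderiv_linear[OF L(1)])
  next
    case False
    with H show ?thesis
      by (intro bexI[OF _ sums_of.zero]) (auto intro: has_dderiv_const)
  qed
qed

lemma smooth_on_ident: "open U \<Longrightarrow> smooth_on U (\<lambda>x. x)"
  by (rule smooth_on_linear) (auto simp: linear_iff)

lemma smooth_on_fst: "open U \<Longrightarrow> smooth_on U fst"
  by (rule smooth_on_linear) (auto simp: linear_iff intro: continuous_on_fst)

lemma smooth_on_snd: "open U \<Longrightarrow> smooth_on U snd"
  by (rule smooth_on_linear) (auto simp: linear_iff intro: continuous_on_snd)

lemma smooth_on_Pair:
  fixes f :: "'e::locally_convex_space \<Rightarrow> 'f::locally_convex_space" and g :: "'e \<Rightarrow> 'h::locally_convex_space"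
  assumes f: "smooth_on U f" and g: "smooth_on U g"
  shows "smooth_on U (\<lambda>x. (f x, g x))"
proof (rule smooth_on_coinduct[OF smooth_on_open[OF f],
    where Q = "\<lambda>H. \<exists>a\<in>iter_terms f. \<exists>b\<in>iter_terms g. H = (\<lambda>x w. (a x w, b x w))"])
  show "\<exists>a\<in>iter_terms f. \<exists>b\<in>iter_terms g. (\<lambda>x w. (f x, g x)) = (\<lambda>x (w :: nat \<Rightarrow> 'e). (a x w, b x w))"
    by (intro bexI[of _ "\<lambda>x w. f x"] bexI[of _ "\<lambda>x w. g x"]) (auto simp: iter_terms_def intro!: exI[of _ "[]"])
next
  fix H :: "'e \<Rightarrow> (nat \<Rightarrow> 'e) \<Rightarrow> 'f \<times> 'h"
  assume "\<exists>a\<in>iter_terms f. \<exists>b\<in>iter_terms g. H = (\<lambda>x w. (a x w, b x w))"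
  then obtain a b where a: "a \<in> iter_terms f" and b: "b \<in> iter_terms g" and H: "H = (\<lambda>x w. (a x w, b x w))"
    by blast
  show "continuous_on (U \<times> UNIV) (\<lambda>(x, w). H x w)"
    using continuous_on_Pair[OF iter_terms_continuous[OF f a] iter_terms_continuous[OF g b]]
    by (simp add: H split_def)
  show "\<exists>H'. (\<exists>a\<in>iter_terms f. \<exists>b\<in>iter_terms g. H' = (\<lambda>x w. (a x w, b x w))) \<and>
      (\<forall>x\<in>U. \<forall>w. has_dderiv (\<lambda>x. H x (\<lambda>i. w (Suc i))) x (w 0) (H' x w))"
  proof -
    obtain a' b' where a': "a' \<in> iter_terms f" "\<And>x w. x \<in> U \<Longrightarrow> has_dderiv (\<lambda>x. a x (\<lambda>i. w (Suc i))) x (w 0) (a' x w)"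
      and b': "b' \<in> iter_terms g" "\<And>x w. x \<in> U \<Longrightarrow> has_dderiv (\<lambda>x. b x (\<lambda>i. w (Suc i))) x (w 0) (b' x w)"
      using iter_terms_derivative[OF f a] iter_terms_derivative[OF g b] by blast
    have "\<forall>x\<in>U. \<forall>w. has_dderiv (\<lambda>x. H x (\<lambda>i. w (Suc i))) x (w 0) (a' x w, b' x w)"
      unfolding H by (intro ballI allI has_dderiv_Pair a'(2) b'(2))
    with a'(1) b'(1) show ?thesis
      by (intro exI[of _ "\<lambda>x w. (a' x w, b' x w)"]) blast
  qed
qed

lemma smooth_on_bilinear:
  fixes f :: "'e::locally_convex_space \<Rightarrow> 'f::locally_convex_space" and g :: "'e \<Rightarrow> 'h::locally_convex_space"
    and B :: "'f \<Rightarrow> 'h \<Rightarrow> 'i::locally_convex_space"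
  assumes B: "continuous_bilinear B" and f: "smooth_on U f" and g: "smooth_on U g"
  shows "smooth_on U (\<lambda>x. B (f x) (g x))"
proof -
  define T where "T = {\<lambda>x w. B (a x w) (b x w) |a b. a \<in> iter_terms f \<and> b \<in> iter_terms g}"
  show ?thesis
  proof (rule smooth_on_terms[OF smooth_on_open[OF f], where T = T])
    have "(\<lambda>x w. f x) \<in> iter_terms f" "(\<lambda>x w. g x) \<in> iter_terms g"
      by (auto simp: iter_terms_def intro!: exI[of _ "[]"])
    then show "(\<lambda>x w. B (f x) (g x)) \<in> sums_of T"
      by (intro sums_of.base) (auto simp: T_def)
  next
    fix H assume "H \<in> T"
    then obtain a b where a: "a \<in> iter_terms f" and b: "b \<in> iter_terms g" and H: "H = (\<lambda>x w. B (a x w) (b x w))"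
      by (auto simp: T_def)
    have "continuous_on UNIV (\<lambda>(x, y). B x y)"
      using B by (simp add: continuous_bilinear_def)
    from continuous_on_compose2[OF this continuous_on_Pair[OF iter_terms_continuous[OF f a] iter_terms_continuous[OF g b]]]
    show "continuous_on (U \<times> UNIV) (\<lambda>(x, w). H x w)"
      by (simp add: H split_def)
    obtain a' b' where a': "a' \<in> iter_terms f" "\<And>x w. x \<in> U \<Longrightarrow> has_dderiv (\<lambda>x. a x (\<lambda>i. w (Suc i))) x (w 0) (a' x w)"
      and b': "b' \<in> iter_terms g" "\<And>x w. x \<in> U \<Longrightarrow> has_dderiv (\<lambda>x. b x (\<lambda>i. w (Suc i))) x (w 0) (b' x w)"
      using iter_terms_derivative[OF f a] iter_terms_derivative[OF g b] by blast
    let ?H = "\<lambda>x w. B (a' x w) (b x (\<lambda>i. w (Suc i))) + B (a x (\<lambda>i. w (Suc i))) (b' x w)"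
    have "?H \<in> sums_of T"
      using a'(1) b'(1) iter_terms_shift[OF a] iter_terms_shift[OF b]
      by (intro sums_of.add sums_of.base) (auto simp: T_def)
    moreover have "has_dderiv (\<lambda>x. H x (\<lambda>i. w (Suc i))) x (w 0) (?H x w)" if "x \<in> U" for x w
      unfolding H by (rule has_dderiv_bilinear[OF B a'(2)[OF that] b'(2)[OF that]])
    ultimately show "\<exists>H'\<in>sums_of T. \<forall>x\<in>U. \<forall>w. has_dderiv (\<lambda>x. H x (\<lambda>i. w (Suc i))) x (w 0) (H' x w)"
      by (intro bexI[of _ ?H]) auto
  qed
qed

text \<open>Both mixed derivatives are limits of the same second difference quotient, which is symmetric
  in the two directions.\<close>

lemma second_dderiv_symmetric:
  assumes f: "smooth_on U f" and x: "x \<in> U"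
  shows "iter_dderiv f [v, w] x = iter_dderiv f [w, v] x"
proof -
  define \<Delta> where "\<Delta> v w t = ((f (x + t *\<^sub>R v + t *\<^sub>R w) - f (x + t *\<^sub>R v)) /\<^sub>R t - (f (x + t *\<^sub>R w) - f x) /\<^sub>R t) /\<^sub>R t" for v w t
  \<comment> \<open>The difference quotient in direction \<open>w\<close> is taken of \<open>f\<close> first; its derivative along \<open>v\<close> is the
    difference quotient in direction \<open>w\<close> of the derivative of \<open>f\<close> along \<open>v\<close>.\<close>
  have lim: "(\<Delta> v w \<longlongrightarrow> iter_dderiv f [w, v] x) (at 0)" for v w
    unfolding \<Delta>_def
  proof (rule diff_quot_tendsto[where g = "\<lambda>t y. (f (y + t *\<^sub>R w) - f y) /\<^sub>R t" and t = "\<lambda>t. t"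
        and x = "\<lambda>t. x" and v = "\<lambda>t. v" and ?x0.0 = x
        and D = "\<lambda>t y. (iter_dderiv f [v] (y + t *\<^sub>R w) - iter_dderiv f [v] y) /\<^sub>R t"])
    have "((\<lambda>z. snd z + fst z *\<^sub>R w) \<longlongrightarrow> x + 0 *\<^sub>R w) (at 0 \<times>\<^sub>F nhds x)"
      by (intro tendsto_add tendsto_scaleR_lcs tendsto_const filterlim_snd
          filterlim_compose[OF tendsto_ident_at filterlim_fst])
    then have "\<forall>\<^sub>F z in at 0 \<times>\<^sub>F nhds x. snd z + fst z *\<^sub>R w \<in> U"
      using topological_tendstoD smooth_on_open[OF f] x by fastforce
    moreover have "\<forall>\<^sub>F z in at 0 \<times>\<^sub>F nhds x. snd z \<in> U"
      using topological_tendstoD[OF filterlim_snd smooth_on_open[OF f] x] .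
    ultimately show "\<forall>\<^sub>F (t, y) in at 0 \<times>\<^sub>F nhds x. has_dderiv (\<lambda>y. (f (y + t *\<^sub>R w) - f y) /\<^sub>R t) y v
        ((iter_dderiv f [v] (y + t *\<^sub>R w) - iter_dderiv f [v] y) /\<^sub>R t)"
    proof eventually_elim
      case (elim z)
      obtain t y where z: "z = (t, y)" by force
      have "has_dderiv (\<lambda>y. f (y + t *\<^sub>R w)) y v (dderiv f (y + t *\<^sub>R w) v)"
        using smooth_on_has_dderiv[OF f, of "y + t *\<^sub>R w" v] elim(1)
        by (simp add: z has_dderiv_def diff_quot_def[abs_def] algebra_simps)
      moreover have "has_dderiv (\<lambda>y. (- 1) *\<^sub>R f y) y v ((- 1) *\<^sub>R dderiv f y v)"
        using smooth_on_has_dderiv[OF f, of y v] elim(2) by (intro has_dderiv_scaleR) (simp add: z)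
      ultimately have "has_dderiv (\<lambda>y. inverse t *\<^sub>R (f (y + t *\<^sub>R w) + (- 1) *\<^sub>R f y)) y v
          (inverse t *\<^sub>R (dderiv f (y + t *\<^sub>R w) v + (- 1) *\<^sub>R dderiv f y v))"
        by (rule has_dderiv_scaleR[OF has_dderiv_add])
      then show ?case
        by (simp add: z)
    qed
    have "((\<lambda>z. (iter_dderiv f [v] (snd z + fst z *\<^sub>R w) - iter_dderiv f [v] (snd z)) /\<^sub>R fst z)
        \<longlongrightarrow> dderiv (iter_dderiv f [v]) x w) (at 0 \<times>\<^sub>F nhds x)"
      by (rule C1_on_diff_quot_tendsto[OF smooth_on_imp_C1_on_iter[OF f] x filterlim_snd tendsto_const
            filterlim_compose[OF tendsto_ident_at filterlim_fst]])
        (rule filterlim_fst[unfolded filterlim_iff, rule_format, OF eventually_neq_at_within])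
    then show "((\<lambda>(t, y). (iter_dderiv f [v] (y + t *\<^sub>R w) - iter_dderiv f [v] y) /\<^sub>R t)
        \<longlongrightarrow> iter_dderiv f [w, v] x) (at 0 \<times>\<^sub>F nhds x)"
      by (simp add: split_def)
  qed (auto simp: eventually_at_filter tendsto_ident_at)
  have "\<Delta> v w t = \<Delta> w v t" for t
    by (simp add: \<Delta>_def algebra_simps)
  then have "\<Delta> v w = \<Delta> w v" by blast
  with lim[of v w] lim[of w v] show ?thesis
    using tendsto_unique[OF trivial_limit_at] by metis
qed

section \<open>Smooth maps and tangent maps of manifolds\<close>

definition local_rep :: "('m, 'e) chart \<Rightarrow> ('n, 'f) chart \<Rightarrow> ('m \<Rightarrow> 'n) \<Rightarrow> 'e \<Rightarrow> 'f" where
  "local_rep c d f = snd d \<circ> f \<circ> inv_into (fst c) (snd c)"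

text \<open>The part of the notion of a manifold that is needed of the middle space in a composition. It
  is inherited by products without any calculus.\<close>

definition charted :: "('m, 'e) atlas \<Rightarrow> bool" where
  "charted A \<longleftrightarrow> (\<Union>c\<in>A. fst c) = UNIV \<and> (\<forall>c\<in>A. inj_on (snd c) (fst c))"

lemma manifold_imp_charted: "manifold A \<Longrightarrow> charted A"
  unfolding charted_def
proof (intro conjI ballI)
  assume A: "manifold A"
  show "(\<Union>c\<in>A. fst c) = UNIV"
    using A by (simp add: manifold_def split_def)
  fix c assume "c \<in> A"
  with A have "homeomorphism (fst c) (snd c ` fst c) (snd c) (inv_into (fst c) (snd c))"
    by (auto simp: manifold_def)
  then show "inj_on (snd c) (fst c)"
    by (meson homeomorphism_apply1 inj_on_inverseI)
qed

lemma chart_at: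
  assumes "charted A"
  shows "chart_at A p \<in> A" "p \<in> fst (chart_at A p)"
proof -
  have "\<exists>c. c \<in> A \<and> p \<in> fst c"
    using assms unfolding charted_def by blast
  from someI_ex[OF this] show "chart_at A p \<in> A" "p \<in> fst (chart_at A p)"
    by (simp_all add: chart_at_def)
qed

lemma chart_inv [simp]:
  assumes "charted A" "c \<in> A" "p \<in> fst c"
  shows "inv_into (fst c) (snd c) (snd c p) = p"
  using assms by (simp add: charted_def)

lemma chart_at_inv [simp]:
  assumes "charted A" "q \<in> fst (chart_at A p)"
  shows "inv_into (fst (chart_at A p)) (snd (chart_at A p)) (snd (chart_at A p) q) = q"
  using assms chart_at(1) by (intro chart_inv)

lemma manifold_open_chart:
  assumes "manifold A" "c \<in> A"
  shows "open (fst c)" "open (snd c ` fst c)"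
  using assms by (auto simp: manifold_def)

lemma manifold_open_image:
  assumes A: "manifold A" and c: "c \<in> A" and N: "open N"
  shows "open (snd c ` (fst c \<inter> N))"
proof -
  have hom: "homeomorphism (fst c) (snd c ` fst c) (snd c) (inv_into (fst c) (snd c))"
    using A c by (auto simp: manifold_def)
  have "openin (top_of_set (snd c ` fst c)) (snd c ` (fst c \<inter> N))"
    using homeomorphism_imp_open_map[OF hom] N by (simp add: openin_open_Int)
  then show ?thesis
    using manifold_open_chart(2)[OF A c] by (simp add: openin_open_eq)
qed

lemma smooth_map_on_D:
  assumes "smooth_map_on A S B f"
  shows "open S" "continuous_on S f"
  using assms by (simp_all add: smooth_map_on_def)

lemma smooth_map_on_local_rep:
  assumes "smooth_map_on A S B f" "c \<in> A" "d \<in> B"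
  shows "smooth_on (snd c ` (fst c \<inter> S \<inter> f -` fst d)) (local_rep c d f)"
  using assms unfolding smooth_map_on_def local_rep_def by (auto split: prod.splits)

lemma smooth_map_onI:
  assumes "open S" "continuous_on S f"
    "\<And>c d. c \<in> A \<Longrightarrow> d \<in> B \<Longrightarrow> smooth_on (snd c ` (fst c \<inter> S \<inter> f -` fst d)) (local_rep c d f)"
  shows "smooth_map_on A S B f"
  using assms unfolding smooth_map_on_def local_rep_def by fastforce

lemma tangent_map_eq:
  "tangent_map A B f p v = dderiv (local_rep (chart_at A p) (chart_at B (f p)) f) (snd (chart_at A p) p) v"
  by (simp add: tangent_map_def local_rep_def Let_def split_def)

text \<open>In coordinates, composing maps is composing representatives only as long as the inner one stays in
  the chart \<open>d\<close> of the middle space, that is, on the neighbourhood \<open>N\<close>.\<close>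

lemma local_rep_compose:
  assumes A: "charted A" and B: "charted B"
    and f: "smooth_map_on A S B f" and g: "smooth_map_on B T C g"
    and c: "c \<in> A" and d: "d \<in> B" and e: "e \<in> C"
    and p: "p \<in> fst c" "p \<in> S" "f p \<in> fst d" "f p \<in> T" "g (f p) \<in> fst e"
  obtains N where "open N" "snd c p \<in> N" "N \<subseteq> snd c ` (fst c \<inter> (S \<inter> f -` T) \<inter> (g \<circ> f) -` fst e)"
    "smooth_on N (local_rep c d f)" "\<forall>y\<in>N. local_rep c d f y \<in> snd d ` (fst d \<inter> T \<inter> g -` fst e)"
    "\<forall>y\<in>N. local_rep c e (g \<circ> f) y = local_rep d e g (local_rep c d f y)"
proof -
  let ?D = "snd c ` (fst c \<inter> S \<inter> f -` fst d)" and ?E = "snd d ` (fst d \<inter> T \<inter> g -` fst e)"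
  define N where "N = ?D \<inter> local_rep c d f -` ?E"
  have sf: "smooth_on ?D (local_rep c d f)"
    by (rule smooth_map_on_local_rep[OF f c d])
  have "open N"
    unfolding N_def
    using smooth_on_open[OF smooth_map_on_local_rep[OF g d e]] smooth_on_open[OF sf] smooth_on_imp_continuous_on[OF sf]
    by (intro continuous_open_preimage)
  moreover have "snd c p \<in> N"
    using p A B c d by (auto simp: N_def local_rep_def)
  moreover have "N \<subseteq> snd c ` (fst c \<inter> (S \<inter> f -` T) \<inter> (g \<circ> f) -` fst e) \<and>
      (\<forall>y\<in>N. local_rep c e (g \<circ> f) y = local_rep d e g (local_rep c d f y))"
  proof -
    have "y \<in> snd c ` (fst c \<inter> (S \<inter> f -` T) \<inter> (g \<circ> f) -` fst e) \<and>
        local_rep c e (g \<circ> f) y = local_rep d e g (local_rep c d f y)" if yN: "y \<in> N" for y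
    proof -
      obtain q where q: "y = snd c q" "q \<in> fst c" "q \<in> S" "f q \<in> fst d"
        using yN unfolding N_def by blast
      moreover have "local_rep c d f y \<in> ?E"
        using yN unfolding N_def by blast
      ultimately obtain r where r: "snd d (f q) = snd d r" "r \<in> fst d" "r \<in> T" "g r \<in> fst e"
        using A c by (auto simp: local_rep_def)
      have "f q = r"
        using B d r q by (auto simp: charted_def dest: inj_onD)
      with q r A B c d show ?thesis
        by (auto simp: local_rep_def)
    qed
    then show ?thesis by blast
  qed
  moreover have "smooth_on N (local_rep c d f)"
    using smooth_on_subset[OF sf \<open>open N\<close>] by (auto simp: N_def)
  ultimately show ?thesis
    using that[of N] by (auto simp: N_def)
qed

lemma smooth_map_on_compose:
  assumes A: "charted A" and B: "charted B"
    and f: "smooth_map_on A S B f" and g: "smooth_map_on B T C g"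
  shows "smooth_map_on A (S \<inter> f -` T) C (g \<circ> f)"
proof (rule smooth_map_onI)
  show "open (S \<inter> f -` T)"
    using smooth_map_on_D[OF f] smooth_map_on_D[OF g] by (intro continuous_open_preimage)
  show "continuous_on (S \<inter> f -` T) (g \<circ> f)"
    using smooth_map_on_D[OF f] smooth_map_on_D[OF g]
    by (intro continuous_on_compose) (auto intro: continuous_on_subset)
  fix c e assume c: "c \<in> A" and e: "e \<in> C"
  show "smooth_on (snd c ` (fst c \<inter> (S \<inter> f -` T) \<inter> (g \<circ> f) -` fst e)) (local_rep c e (g \<circ> f))"
  proof (rule smooth_on_local)
    fix y assume "y \<in> snd c ` (fst c \<inter> (S \<inter> f -` T) \<inter> (g \<circ> f) -` fst e)"
    then obtain p where p: "y = snd c p" "p \<in> fst c" "p \<in> S" "f p \<in> T" "g (f p) \<in> fst e"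
      by auto
    obtain N where N: "open N" "snd c p \<in> N" "N \<subseteq> snd c ` (fst c \<inter> (S \<inter> f -` T) \<inter> (g \<circ> f) -` fst e)"
      "smooth_on N (local_rep c (chart_at B (f p)) f)"
      "\<forall>y\<in>N. local_rep c (chart_at B (f p)) f y \<in> snd (chart_at B (f p)) ` (fst (chart_at B (f p)) \<inter> T \<inter> g -` fst e)"
      "\<forall>y\<in>N. local_rep c e (g \<circ> f) y = local_rep (chart_at B (f p)) e g (local_rep c (chart_at B (f p)) f y)"
      by (rule local_rep_compose[OF A B f g c chart_at(1)[OF B] e p(2,3) chart_at(2)[OF B] p(4,5)])
    have "smooth_on N (local_rep c e (g \<circ> f))"
      by (rule smooth_on_cong[OF smooth_on_compose[OF N(4) smooth_map_on_local_rep[OF g chart_at(1)[OF B] e]]])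
        (use N(5,6) in auto)
    with N(2,3) p(1) show "\<exists>N. y \<in> N \<and> N \<subseteq> snd c ` (fst c \<inter> (S \<inter> f -` T) \<inter> (g \<circ> f) -` fst e) \<and>
        smooth_on N (local_rep c e (g \<circ> f))"
      by blast
  qed
qed

lemma tangent_map_compose:
  assumes A: "charted A" and B: "charted B" and C: "charted C"
    and f: "smooth_map_on A S B f" and g: "smooth_map_on B T C g" and p: "p \<in> S" "f p \<in> T"
  shows "tangent_map A C (\<lambda>q. g (f q)) p v = tangent_map B C g (f p) (tangent_map A B f p v)"
proof -
  let ?c = "chart_at A p" and ?d = "chart_at B (f p)" and ?e = "chart_at C (g (f p))"
  obtain N where N: "open N" "snd ?c p \<in> N" "N \<subseteq> snd ?c ` (fst ?c \<inter> (S \<inter> f -` T) \<inter> (g \<circ> f) -` fst ?e)"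
    "smooth_on N (local_rep ?c ?d f)" "\<forall>y\<in>N. local_rep ?c ?d f y \<in> snd ?d ` (fst ?d \<inter> T \<inter> g -` fst ?e)"
    "\<forall>y\<in>N. local_rep ?c ?e (g \<circ> f) y = local_rep ?d ?e g (local_rep ?c ?d f y)"
    by (rule local_rep_compose[OF A B f g chart_at(1)[OF A] chart_at(1)[OF B] chart_at(1)[OF C]
        chart_at(2)[OF A] p(1) chart_at(2)[OF B] p(2) chart_at(2)[OF C]])
  have "dderiv (local_rep ?c ?e (g \<circ> f)) (snd ?c p) v
      = dderiv (\<lambda>y. local_rep ?d ?e g (local_rep ?c ?d f y)) (snd ?c p) v"
    by (rule dderiv_cong[OF N(1,2)]) (use N(6) in blast)
  also have "\<dots> = dderiv (local_rep ?d ?e g) (local_rep ?c ?d f (snd ?c p)) (dderiv (local_rep ?c ?d f) (snd ?c p) v)"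
    by (rule has_dderiv_imp_eq, rule has_dderiv_compose[where g = "local_rep ?d ?e g", OF smooth_on_imp_C1_on[OF
          smooth_map_on_local_rep[OF g chart_at(1)[OF B] chart_at(1)[OF C]]] bspec[OF N(5,2)] smooth_on_has_dderiv[OF N(4,2)]])
  also have "local_rep ?c ?d f (snd ?c p) = snd ?d (f p)"
    by (simp add: local_rep_def A chart_at)
  finally show ?thesis
    by (simp add: tangent_map_eq o_def)
qed

lemma tangent_map_cong:
  assumes A: "manifold A" and S: "open S" "p \<in> S" and eq: "\<And>q. q \<in> S \<Longrightarrow> f q = g q"
  shows "tangent_map A B f p v = tangent_map A B g p v"
proof -
  note A' = manifold_imp_charted[OF A]
  have "dderiv (local_rep (chart_at A p) d f) (snd (chart_at A p) p) v
      = dderiv (local_rep (chart_at A p) d g) (snd (chart_at A p) p) v" for d :: "('c, 'd) chart"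
    by (rule dderiv_cong[OF manifold_open_image[OF A chart_at(1)[OF A'] S(1)]])
      (auto simp: local_rep_def A' chart_at S(2) eq)
  then show ?thesis
    by (simp add: tangent_map_eq eq S(2))
qed

lemma tangent_map_ident:
  assumes A: "manifold A"
  shows "tangent_map A A (\<lambda>q. q) p v = v"
proof -
  note A' = manifold_imp_charted[OF A]
  have "dderiv (local_rep (chart_at A p) (chart_at A p) (\<lambda>q. q)) (snd (chart_at A p) p) v
      = dderiv (\<lambda>y. y) (snd (chart_at A p) p) v"
    by (rule dderiv_cong[OF manifold_open_chart(2)[OF A chart_at(1)[OF A']]])
      (auto simp: local_rep_def A' chart_at)
  also have "\<dots> = v"
    by (rule has_dderiv_imp_eq[OF has_dderiv_ident])
  finally show ?thesis by (simp add: tangent_map_eq)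
qed

lemma tangent_map_linear:
  assumes A: "charted A" and B: "charted B" and f: "smooth_map_on A S B f" and p: "p \<in> S"
  shows "linear (tangent_map A B f p)"
proof -
  have "linear (dderiv (local_rep (chart_at A p) (chart_at B (f p)) f) (snd (chart_at A p) p))"
    by (rule C1_on_linear[OF smooth_on_imp_C1_on[OF smooth_map_on_local_rep[OF f chart_at(1)[OF A] chart_at(1)[OF B]]]])
      (use chart_at(2)[OF A] chart_at(2)[OF B] p in blast)
  then show ?thesis
    by (simp add: tangent_map_eq[abs_def])
qed

lemma smooth_map_on_subset:
  assumes A: "manifold A" and f: "smooth_map_on A S B f" and T: "open T" "T \<subseteq> S"
  shows "smooth_map_on A T B f"
proof (rule smooth_map_onI)
  show "continuous_on T f"
    using smooth_map_on_D(2)[OF f] T(2) by (rule continuous_on_subset)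
  fix c d assume c: "c \<in> A" and d: "d \<in> B"
  note sf = smooth_map_on_local_rep[OF f c d]
  have "snd c ` (fst c \<inter> T \<inter> f -` fst d) = snd c ` (fst c \<inter> S \<inter> f -` fst d) \<inter> snd c ` (fst c \<inter> T)"
    using T(2) inj_onD[of "snd c" "fst c"] manifold_imp_charted[OF A] c by (auto simp: charted_def)
  then show "smooth_on (snd c ` (fst c \<inter> T \<inter> f -` fst d)) (local_rep c d f)"
    using smooth_on_open[OF sf] manifold_open_image[OF A c T(1)]
    by (intro smooth_on_subset[OF sf]) (auto simp: open_Int)
qed (rule T)

lemma smooth_map_on_const:
  assumes A: "manifold A" and S: "open S"
  shows "smooth_map_on A S B (\<lambda>p. b)"
proof (rule smooth_map_onI)
  fix c d assume c: "c \<in> A" and d: "d \<in> B"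
  have "open (snd c ` (fst c \<inter> S \<inter> (\<lambda>p. b) -` fst d))"
    using manifold_open_image[OF A c S] by (cases "b \<in> fst d") auto
  then show "smooth_on (snd c ` (fst c \<inter> S \<inter> (\<lambda>p. b) -` fst d)) (local_rep c d (\<lambda>p. b))"
    unfolding local_rep_def o_def by (rule smooth_on_const)
qed (use S in auto)

lemma smooth_map_on_ident:
  assumes A: "manifold A"
  shows "smooth_map A A (\<lambda>p. p)"
proof (rule smooth_map_onI)
  fix c d assume "c \<in> A" "d \<in> A"
  with A have "smooth_on (snd c ` (fst c \<inter> fst d)) (snd d \<circ> inv_into (fst c) (snd c))"
    unfolding manifold_def by (auto split: prod.splits)
  then show "smooth_on (snd c ` (fst c \<inter> UNIV \<inter> (\<lambda>p. p) -` fst d)) (local_rep c d (\<lambda>p. p))"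
    by (simp add: local_rep_def o_def)
qed auto

subsection \<open>Products\<close>

lemma in_prod_atlas_iff:
  "c \<in> prod_atlas A B \<longleftrightarrow> (\<exists>a\<in>A. \<exists>b\<in>B. c = (fst a \<times> fst b, map_prod (snd a) (snd b)))"
  by (force simp: prod_atlas_def)

lemma charted_prod_atlas:
  assumes A: "charted A" and B: "charted B"
  shows "charted (prod_atlas A B)"
  unfolding charted_def
proof
  have "(p, q) \<in> (\<Union>c\<in>prod_atlas A B. fst c)" for p q
    using chart_at[OF A, of p] chart_at[OF B, of q]
    by (intro UN_I[of "(fst (chart_at A p) \<times> fst (chart_at B q), map_prod (snd (chart_at A p)) (snd (chart_at B q)))"])
      (auto simp: in_prod_atlas_iff)
  then show "(\<Union>c\<in>prod_atlas A B. fst c) = UNIV"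
    by auto
  show "\<forall>c\<in>prod_atlas A B. inj_on (snd c) (fst c)"
    using A B by (auto simp: in_prod_atlas_iff charted_def intro!: map_prod_inj_on)
qed

lemma inv_into_map_prod:
  assumes "inj_on f U" "inj_on g V" "x \<in> f ` U" "y \<in> g ` V"
  shows "inv_into (U \<times> V) (map_prod f g) (x, y) = (inv_into U f x, inv_into V g y)"
  using assms by (intro inv_into_f_eq map_prod_inj_on) (auto simp: inv_into_into f_inv_into_f)

lemma smooth_map_on_Pair:
  assumes A: "manifold A" and f: "smooth_map_on A S B f" and g: "smooth_map_on A S C g"
  shows "smooth_map_on A S (prod_atlas B C) (\<lambda>p. (f p, g p))"
proof (rule smooth_map_onI)
  show "open S" "continuous_on S (\<lambda>p. (f p, g p))"
    using smooth_map_on_D[OF f] smooth_map_on_D[OF g] by (auto intro: continuous_on_Pair)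
  fix a d assume a: "a \<in> A" and "d \<in> prod_atlas B C"
  then obtain b c where b: "b \<in> B" and c: "c \<in> C" and d: "d = (fst b \<times> fst c, map_prod (snd b) (snd c))"
    by (auto simp: in_prod_atlas_iff)
  let ?D = "snd a ` (fst a \<inter> S \<inter> f -` fst b)" and ?E = "snd a ` (fst a \<inter> S \<inter> g -` fst c)"
  note sf = smooth_map_on_local_rep[OF f a b] and sg = smooth_map_on_local_rep[OF g a c]
  have "snd a ` (fst a \<inter> S \<inter> (\<lambda>p. (f p, g p)) -` fst d) = ?D \<inter> ?E"
    using inj_onD[of "snd a" "fst a"] manifold_imp_charted[OF A] a by (auto simp: charted_def d)
  moreover have "open (?D \<inter> ?E)"
    using smooth_on_open[OF sf] smooth_on_open[OF sg] by (rule open_Int)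
  moreover have "local_rep a d (\<lambda>p. (f p, g p)) = (\<lambda>y. (local_rep a b f y, local_rep a c g y))"
    by (auto simp: local_rep_def d)
  ultimately show "smooth_on (snd a ` (fst a \<inter> S \<inter> (\<lambda>p. (f p, g p)) -` fst d)) (local_rep a d (\<lambda>p. (f p, g p)))"
    using smooth_on_Pair[OF smooth_on_subset[OF sf] smooth_on_subset[OF sg], of "?D \<inter> ?E"] by simp
qed

text \<open>A local trivialisation is only known to be smooth as a pair of maps; this isolates its component
  in the group.\<close>

lemma smooth_map_on_snd_component:
  assumes B: "charted B" and fg: "smooth_map_on A S (prod_atlas B C) (\<lambda>p. (f p, g p))"
  shows "smooth_map_on A S C g"
proof (rule smooth_map_onI)
  show "open S"
    by (rule smooth_map_on_D[OF fg])
  show "continuous_on S g"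
    using continuous_on_snd[OF smooth_map_on_D(2)[OF fg]] by simp
  fix a c assume a: "a \<in> A" and c: "c \<in> C"
  show "smooth_on (snd a ` (fst a \<inter> S \<inter> g -` fst c)) (local_rep a c g)"
  proof (rule smooth_on_local)
    fix y assume "y \<in> snd a ` (fst a \<inter> S \<inter> g -` fst c)"
    then obtain p where p: "y = snd a p" "p \<in> fst a" "p \<in> S" "g p \<in> fst c"
      by auto
    define b where "b = chart_at B (f p)"
    have b: "b \<in> B" "f p \<in> fst b"
      using chart_at[OF B] by (auto simp: b_def)
    define d where "d = (fst b \<times> fst c, map_prod (snd b) (snd c))"
    have "d \<in> prod_atlas B C"
      using b(1) c by (auto simp: in_prod_atlas_iff d_def)
    from smooth_map_on_local_rep[OF fg a this]
    have s: "smooth_on (snd a ` (fst a \<inter> S \<inter> (\<lambda>p. (f p, g p)) -` fst d)) (local_rep a d (\<lambda>p. (f p, g p)))" .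
    have "smooth_on (snd a ` (fst a \<inter> S \<inter> (\<lambda>p. (f p, g p)) -` fst d)) (local_rep a c g)"
      by (rule smooth_on_cong[OF smooth_on_compose[OF s smooth_on_snd[OF open_UNIV]]]) (auto simp: local_rep_def d_def)
    moreover have "y \<in> snd a ` (fst a \<inter> S \<inter> (\<lambda>p. (f p, g p)) -` fst d)"
      using p b by (auto simp: d_def)
    moreover have "snd a ` (fst a \<inter> S \<inter> (\<lambda>p. (f p, g p)) -` fst d) \<subseteq> snd a ` (fst a \<inter> S \<inter> g -` fst c)"
      by (auto simp: d_def)
    ultimately show "\<exists>N. y \<in> N \<and> N \<subseteq> snd a ` (fst a \<inter> S \<inter> g -` fst c) \<and> smooth_on N (local_rep a c g)"
      by (intro exI[of _ "snd a ` (fst a \<inter> S \<inter> (\<lambda>p. (f p, g p)) -` fst d)"] conjI)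
  qed
qed

lemma smooth_map_on_binary:
  assumes A: "manifold A" and B: "charted B" and C: "charted C"
    and f: "smooth_map_on A S B f" and g: "smooth_map_on A S C g"
    and F: "smooth_map_on (prod_atlas B C) T D (\<lambda>(x, y). F x y)" and T: "\<And>p. p \<in> S \<Longrightarrow> (f p, g p) \<in> T"
  shows "smooth_map_on A S D (\<lambda>p. F (f p) (g p))"
proof -
  have "S \<inter> (\<lambda>p. (f p, g p)) -` T = S"
    using T by auto
  then show ?thesis
    using smooth_map_on_compose[OF manifold_imp_charted[OF A] charted_prod_atlas[OF B C] smooth_map_on_Pair[OF A f g] F]
    by (simp add: o_def)
qed

text \<open>The derivative of a map of two arguments is the sum of its partial derivatives because, in
  product charts, it is additive.\<close>

lemma tangent_map_binary:
  assumes A: "manifold A" and B: "manifold B" and C: "manifold C" and D: "charted D"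
    and f: "smooth_map_on A S B f" and g: "smooth_map_on A S C g"
    and F: "smooth_map_on (prod_atlas B C) T D (\<lambda>(x, y). F x y)" and p: "p \<in> S" "(f p, g p) \<in> T"
  shows "tangent_map A D (\<lambda>q. F (f q) (g q)) p v =
    tangent_map B D (\<lambda>x. F x (g p)) (f p) (tangent_map A B f p v) +
    tangent_map C D (\<lambda>y. F (f p) y) (g p) (tangent_map A C g p v)"
proof -
  note A' = manifold_imp_charted[OF A] and B' = manifold_imp_charted[OF B] and C' = manifold_imp_charted[OF C]
  let ?F = "\<lambda>(x, y). F x y" and ?fg = "\<lambda>q. (f q, g q)"
  define a b c d where "a = chart_at A p" and "b = chart_at B (f p)" and "c = chart_at C (g p)"
    and "d = chart_at D (F (f p) (g p))"
  define bc where "bc = (fst b \<times> fst c, map_prod (snd b) (snd c))"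
  have a: "a \<in> A" "p \<in> fst a" and b: "b \<in> B" "f p \<in> fst b" and c: "c \<in> C" "g p \<in> fst c"
    and d: "d \<in> D" "F (f p) (g p) \<in> fst d"
    using chart_at[OF A'] chart_at[OF B'] chart_at[OF C'] chart_at[OF D] by (auto simp: a_def b_def c_def d_def)
  have bc: "bc \<in> prod_atlas B C"
    using b c by (auto simp: in_prod_atlas_iff bc_def)
  let ?R = "local_rep bc d ?F" and ?x = "snd a p" and ?y = "snd b (f p)" and ?z = "snd c (g p)"
  let ?u = "tangent_map A B f p v" and ?w = "tangent_map A C g p v"
  have inj: "inj_on (snd b) (fst b)" "inj_on (snd c) (fst c)"
    using B' C' b c by (auto simp: charted_def)
  note sF = smooth_map_on_local_rep[OF F bc d(1)]
  have yz: "(?y, ?z) \<in> snd bc ` (fst bc \<inter> T \<inter> ?F -` fst d)"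
    using b c d p by (force simp: bc_def)
  have "?fg p \<in> fst bc" "?fg p \<in> T" "?F (?fg p) \<in> fst d"
    using b c d p(2) by (simp_all add: bc_def)
  then obtain N where N: "open N" "?x \<in> N" "N \<subseteq> snd a ` (fst a \<inter> (S \<inter> ?fg -` T) \<inter> (?F \<circ> ?fg) -` fst d)"
    "smooth_on N (local_rep a bc ?fg)" "\<forall>y\<in>N. local_rep a bc ?fg y \<in> snd bc ` (fst bc \<inter> T \<inter> ?F -` fst d)"
    "\<forall>y\<in>N. local_rep a d (?F \<circ> ?fg) y = ?R (local_rep a bc ?fg y)"
    by (rule local_rep_compose[OF A' charted_prod_atlas[OF B' C'] smooth_map_on_Pair[OF A f g] F a(1) bc d(1) a(2) p(1)])
  have rep: "local_rep a bc ?fg = (\<lambda>y. (local_rep a b f y, local_rep a c g y))"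
    by (auto simp: local_rep_def bc_def)
  have rep_x: "local_rep a bc ?fg ?x = (?y, ?z)"
    using a A' by (simp add: local_rep_def bc_def)
  have xf: "?x \<in> snd a ` (fst a \<inter> S \<inter> f -` fst b)" and xg: "?x \<in> snd a ` (fst a \<inter> S \<inter> g -` fst c)"
    using a b c p by auto
  have fg': "has_dderiv (local_rep a bc ?fg) ?x v (?u, ?w)"
    unfolding rep tangent_map_eq a_def[symmetric] b_def[symmetric] c_def[symmetric]
    by (intro has_dderiv_Pair smooth_on_has_dderiv[OF smooth_map_on_local_rep[OF f a(1) b(1)] xf]
        smooth_on_has_dderiv[OF smooth_map_on_local_rep[OF g a(1) c(1)] xg])
  have "tangent_map A D (\<lambda>q. F (f q) (g q)) p v = dderiv (local_rep a d (?F \<circ> ?fg)) ?x v"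
    by (simp add: tangent_map_eq a_def d_def o_def)
  also have "\<dots> = dderiv (\<lambda>y. ?R (local_rep a bc ?fg y)) ?x v"
    by (rule dderiv_cong[OF N(1,2)]) (use N(6) in blast)
  also have "\<dots> = dderiv ?R (?y, ?z) (?u, ?w)"
    using has_dderiv_imp_eq[OF has_dderiv_compose[where g = ?R, OF smooth_on_imp_C1_on[OF sF] _ fg']] yz
    by (simp add: rep_x)
  also have "\<dots> = dderiv ?R (?y, ?z) (?u, 0) + dderiv ?R (?y, ?z) (0, ?w)"
    using linear_add[OF C1_on_linear[OF smooth_on_imp_C1_on[OF sF] yz], of "(?u, 0)" "(0, ?w)"] by simp
  also have "dderiv ?R (?y, ?z) (?u, 0) = dderiv (\<lambda>y. ?R (y, ?z)) ?y ?u"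
    by (simp add: dderiv_def diff_quot_def[abs_def])
  also have "\<dots> = dderiv (local_rep b d (\<lambda>x. F x (g p))) ?y ?u"
    by (rule dderiv_cong[OF manifold_open_chart(2)[OF B b(1)]])
      (use b c C' in \<open>auto simp: local_rep_def bc_def inv_into_map_prod[OF inj]\<close>)
  also have "dderiv ?R (?y, ?z) (0, ?w) = dderiv (\<lambda>z. ?R (?y, z)) ?z ?w"
    by (simp add: dderiv_def diff_quot_def[abs_def])
  also have "\<dots> = dderiv (local_rep c d (\<lambda>y. F (f p) y)) ?z ?w"
    by (rule dderiv_cong[OF manifold_open_chart(2)[OF C c(1)]])
      (use b c B' in \<open>auto simp: local_rep_def bc_def inv_into_map_prod[OF inj]\<close>)
  finally show ?thesis
    by (simp add: tangent_map_eq[of B D "\<lambda>x. F x (g p)"] tangent_map_eq[of C D "\<lambda>y. F (f p) y"] b_def c_def d_def)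
qed

subsection \<open>The model space and the charts\<close>

lemma model_atlas_iff [simp]: "c \<in> model_atlas \<longleftrightarrow> c = (UNIV, \<lambda>x. x)"
  by (simp add: model_atlas_def)

lemma inv_into_UNIV_ident [simp]: "inv_into UNIV (\<lambda>x. x) = (\<lambda>x. x)"
  by (rule ext) (simp add: inv_into_f_eq)

lemma manifold_model_atlas: "manifold model_atlas"
  by (auto simp: manifold_def model_atlas_def homeomorphism_def o_def intro!: smooth_on_ident)

lemmas charted_model_atlas = manifold_imp_charted[OF manifold_model_atlas]

lemma chart_at_model_atlas [simp]:
  fixes x :: "'e::locally_convex_space"
  shows "chart_at model_atlas x = (UNIV, \<lambda>x. x)"
  using chart_at(1)[OF charted_model_atlas, of x] by simp

lemma smooth_map_on_model_iff:
  "smooth_map_on model_atlas U model_atlas f \<longleftrightarrow> smooth_on U f"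
  by (auto simp: smooth_map_on_def o_def model_atlas_def dest: smooth_on_open smooth_on_imp_continuous_on)

lemma tangent_map_model: "tangent_map model_atlas model_atlas f x v = dderiv f x v"
  by (simp add: tangent_map_eq local_rep_def o_def)

lemma smooth_map_on_chart_inv:
  assumes A: "manifold A" and c: "c \<in> A"
  shows "smooth_map_on model_atlas (snd c ` fst c) A (inv_into (fst c) (snd c))"
proof (rule smooth_map_onI)
  show "open (snd c ` fst c)"
    by (rule manifold_open_chart[OF A c])
  show "continuous_on (snd c ` fst c) (inv_into (fst c) (snd c))"
    using A c by (auto simp: manifold_def homeomorphism_def)
  fix m :: "('b, 'b) chart" and d assume m: "m \<in> model_atlas" and d: "d \<in> A"
  have "smooth_on (snd c ` (fst c \<inter> fst d)) (snd d \<circ> inv_into (fst c) (snd c))"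
    using A c d unfolding manifold_def by (auto split: prod.splits)
  moreover have "snd c ` (fst c \<inter> fst d) = snd c ` fst c \<inter> inv_into (fst c) (snd c) -` fst d"
    using manifold_imp_charted[OF A] c by auto
  ultimately show "smooth_on (snd m ` (fst m \<inter> snd c ` fst c \<inter> inv_into (fst c) (snd c) -` fst d))
      (local_rep m d (inv_into (fst c) (snd c)))"
    using m by (simp add: local_rep_def o_def)
qed

text \<open>Tangent vectors at \<open>p\<close> are read off in the chart chosen at \<open>p\<close>, in which they do not change.\<close>

lemma tangent_map_chart_at_inv:
  assumes A: "manifold A"
  shows "tangent_map model_atlas A (inv_into (fst (chart_at A p)) (snd (chart_at A p))) (snd (chart_at A p) p) v = v"
proof -
  note A' = manifold_imp_charted[OF A]
  let ?c = "chart_at A p"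
  have "dderiv (local_rep (UNIV, \<lambda>x. x) ?c (inv_into (fst ?c) (snd ?c))) (snd ?c p) v = dderiv (\<lambda>y. y) (snd ?c p) v"
    by (rule dderiv_cong[OF manifold_open_chart(2)[OF A chart_at(1)[OF A', of p]]])
      (auto simp: local_rep_def A' chart_at)
  also have "\<dots> = v"
    by (rule has_dderiv_imp_eq[OF has_dderiv_ident])
  finally show ?thesis
    by (simp add: tangent_map_eq A' chart_at)
qed

section \<open>Differential forms in charts\<close>

lemma form1_rep_eq:
  "form1_rep A c \<alpha> x v = \<alpha> (inv_into (fst c) (snd c) x) (tangent_map model_atlas A (inv_into (fst c) (snd c)) x v)"
  by (simp add: form1_rep_def Let_def)

lemma form1_rep_chart_at:
  assumes "manifold A"
  shows "form1_rep A (chart_at A p) \<alpha> (snd (chart_at A p) p) v = \<alpha> p v"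
  using assms by (simp add: form1_rep_eq tangent_map_chart_at_inv manifold_imp_charted chart_at)

lemma form1_rep_linear:
  assumes A: "manifold A" and \<alpha>: "form1 A \<alpha>" and c: "c \<in> A" and x: "x \<in> snd c ` fst c"
  shows "linear (form1_rep A c \<alpha> x)"
proof -
  have "linear (tangent_map model_atlas A (inv_into (fst c) (snd c)) x)"
    by (rule tangent_map_linear[OF charted_model_atlas manifold_imp_charted[OF A] smooth_map_on_chart_inv[OF A c] x])
  from linear_compose[OF this, of "\<alpha> (inv_into (fst c) (snd c) x)"] \<alpha> show ?thesis
    by (simp add: form1_def form1_rep_eq[abs_def] o_def)
qed

lemma form1_rep_smooth:
  assumes "form1 A \<alpha>" "c \<in> A"
  shows "smooth_on (snd c ` fst c \<times> UNIV) (\<lambda>(x, v). form1_rep A c \<alpha> x v)"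
  using assms unfolding form1_def by (cases c) auto

lemma form1_rep_smooth_fixed:
  assumes \<alpha>: "form1 A \<alpha>" and c: "c \<in> A" and "open (snd c ` fst c)"
  shows "smooth_on (snd c ` fst c) (\<lambda>x. form1_rep A c \<alpha> x v)"
proof -
  have "smooth_on (snd c ` fst c) (\<lambda>x. case (x, v) of (x, v) \<Rightarrow> form1_rep A c \<alpha> x v)"
    by (rule smooth_on_compose[OF smooth_on_Pair[OF smooth_on_ident smooth_on_const] form1_rep_smooth[OF \<alpha> c]])
      (use assms(3) in auto)
  then show ?thesis by simp
qed

text \<open>For the identity map this is the transformation of a form under a change of charts; for a section
  over \<open>S\<close> it is the coordinate expression of the form on the base of a bundle.\<close>

lemma form1_rep_pullback:
  assumes A: "manifold A" and B: "manifold B" and f: "smooth_map_on A S B f"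
    and \<alpha>: "\<And>p v. p \<in> S \<Longrightarrow> \<alpha> p v = \<beta> (f p) (tangent_map A B f p v)"
    and c: "c \<in> A" and d: "d \<in> B" and y: "y \<in> snd c ` (fst c \<inter> S \<inter> f -` fst d)"
  shows "form1_rep A c \<alpha> y v = form1_rep B d \<beta> (local_rep c d f y) (dderiv (local_rep c d f) y v)"
proof -
  note A' = manifold_imp_charted[OF A] and B' = manifold_imp_charted[OF B]
  let ?c = "inv_into (fst c) (snd c)" and ?d = "inv_into (fst d) (snd d)" and ?f = "local_rep c d f"
  let ?D = "snd c ` (fst c \<inter> S \<inter> f -` fst d)"
  have sf: "smooth_on ?D ?f"
    by (rule smooth_map_on_local_rep[OF f c d])
  have c': "?c z \<in> S" "f (?c z) \<in> fst d" "z \<in> snd c ` fst c" if "z \<in> ?D" for z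
    using that A' c by auto
  have inner: "?d (?f z) = f (?c z)" if "z \<in> ?D" for z
    using c'[OF that] B' d by (simp add: local_rep_def)
  have "form1_rep A c \<alpha> y v = \<beta> (f (?c y)) (tangent_map A B f (?c y) (tangent_map model_atlas A ?c y v))"
    using c'[OF y] by (simp add: form1_rep_eq \<alpha>)
  also have "tangent_map A B f (?c y) (tangent_map model_atlas A ?c y v) = tangent_map model_atlas B (\<lambda>z. f (?c z)) y v"
    using tangent_map_compose[OF charted_model_atlas A' B' smooth_map_on_chart_inv[OF A c] f, of y] c'[OF y] by simp
  also have "\<dots> = tangent_map model_atlas B (\<lambda>z. ?d (?f z)) y v"
    by (rule tangent_map_cong[OF manifold_model_atlas smooth_on_open[OF sf] y]) (simp add: inner)
  also have "\<dots> = tangent_map model_atlas B ?d (?f y) (tangent_map model_atlas model_atlas ?f y v)"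
    using tangent_map_compose[OF charted_model_atlas charted_model_atlas B' _ smooth_map_on_chart_inv[OF B d],
        of ?D ?f y v] sf y c'[OF y] by (simp add: smooth_map_on_model_iff local_rep_def)
  finally show ?thesis
    by (simp add: form1_rep_eq tangent_map_model inner[OF y])
qed

text \<open>The antisymmetrised derivative of a form on an open set is natural: the second derivatives of
  \<open>S\<close> that occur in it cancel by symmetry.\<close>

lemma dderiv_form_pullback:
  fixes a :: "'e::locally_convex_space \<Rightarrow> 'e \<Rightarrow> real" and S :: "'f::locally_convex_space \<Rightarrow> 'e"
  assumes a: "smooth_on (W \<times> UNIV) (\<lambda>(x, v). a x v)" "\<And>x. x \<in> W \<Longrightarrow> linear (a x)"
    and S: "smooth_on N S" "\<And>y. y \<in> N \<Longrightarrow> S y \<in> W"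
    and b: "\<And>y v. y \<in> N \<Longrightarrow> b y v = a (S y) (dderiv S y v)" and y: "y \<in> N"
  shows "dderiv (\<lambda>y. b y Y) y X - dderiv (\<lambda>y. b y X) y Y =
    dderiv (\<lambda>x. a x (dderiv S y Y)) (S y) (dderiv S y X) - dderiv (\<lambda>x. a x (dderiv S y X)) (S y) (dderiv S y Y)"
proof -
  let ?a = "\<lambda>(x, v). a x v"
  have *: "dderiv (\<lambda>y. b y Y) y X = dderiv (\<lambda>x. a x (dderiv S y Y)) (S y) (dderiv S y X) + a (S y) (iter_dderiv S [X, Y] y)" for X Y
  proof -
    let ?z = "(S y, dderiv S y Y)"
    have z: "?z \<in> W \<times> UNIV"
      using S(2)[OF y] by simp
    have "dderiv (\<lambda>y. b y Y) y X = dderiv (\<lambda>y. ?a (S y, dderiv S y Y)) y X"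
      by (rule dderiv_cong[OF smooth_on_open[OF S(1)] y]) (simp add: b)
    also have "\<dots> = dderiv ?a ?z (dderiv S y X, iter_dderiv S [X, Y] y)"
      using smooth_on_has_dderiv_iter[OF S(1) y, of "[Y]" X]
      by (intro has_dderiv_imp_eq has_dderiv_compose[where g = ?a and f = "\<lambda>y. (S y, dderiv S y Y)",
            OF smooth_on_imp_C1_on[OF a(1)] z] has_dderiv_Pair smooth_on_has_dderiv[OF S(1) y]) simp
    also have "\<dots> = dderiv ?a ?z (dderiv S y X, 0) + dderiv ?a ?z (0, iter_dderiv S [X, Y] y)"
      using linear_add[OF C1_on_linear[OF smooth_on_imp_C1_on[OF a(1)] z],
          of "(dderiv S y X, 0)" "(0, iter_dderiv S [X, Y] y)"] by simp
    also have "dderiv ?a ?z (dderiv S y X, 0) = dderiv (\<lambda>x. a x (dderiv S y Y)) (S y) (dderiv S y X)"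
      by (simp add: dderiv_def diff_quot_def[abs_def])
    also have "dderiv ?a ?z (0, iter_dderiv S [X, Y] y) = dderiv (a (S y)) (dderiv S y Y) (iter_dderiv S [X, Y] y)"
      by (simp add: dderiv_def diff_quot_def[abs_def])
    also have "\<dots> = a (S y) (iter_dderiv S [X, Y] y)"
      by (rule has_dderiv_imp_eq[OF has_dderiv_linear[OF a(2)[OF S(2)[OF y]]]])
    finally show ?thesis .
  qed
  show ?thesis
    using *[of X Y] *[of Y X] second_dderiv_symmetric[OF S(1) y, of X Y] by simp
qed

lemma smooth_on_form_pullback:
  fixes a :: "'e::locally_convex_space \<Rightarrow> 'e \<Rightarrow> 'h::locally_convex_space" and S :: "'f::locally_convex_space \<Rightarrow> 'e"
  assumes a: "smooth_on (W \<times> UNIV) (\<lambda>(x, v). a x v)" and S: "smooth_on N S" "\<And>y. y \<in> N \<Longrightarrow> S y \<in> W"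
  shows "smooth_on (N \<times> UNIV) (\<lambda>(y, v). a (S y) (dderiv S y v))"
proof -
  have N: "open (N \<times> (UNIV :: 'f set))"
    using smooth_on_open[OF S(1)] by (simp add: open_Times)
  have "smooth_on (N \<times> UNIV) (\<lambda>z. (S (fst z), case z of (y, v) \<Rightarrow> dderiv S y v))"
    by (intro smooth_on_Pair smooth_on_compose[OF smooth_on_fst[OF N] S(1)] smooth_on_dderiv[OF S(1)]) auto
  from smooth_on_compose[OF this a] show ?thesis
    using S(2) by (simp add: split_def mem_Times_iff)
qed

text \<open>The two facts about a pull-back \<open>\<beta>\<close> that are needed later, smoothness and \<open>d\<beta> = f\<^sup>* d\<alpha>\<close>, in an arbitrary
  chart at the source. At the target the chart chosen at \<open>f p\<close> is taken, as in the definition of \<open>d\<alpha>\<close>;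
  \<open>L\<close> is the tangent map of \<open>f\<close> at \<open>p\<close> in these charts.\<close>

lemma form1_local_pullback:
  assumes A: "manifold A" and B: "manifold B" and \<alpha>: "form1 B \<alpha>" and f: "smooth_map_on A S B f"
    and \<beta>: "\<And>p v. p \<in> S \<Longrightarrow> \<beta> p v = \<alpha> (f p) (tangent_map A B f p v)"
    and c: "c \<in> A" and p: "p \<in> fst c" "p \<in> S"
  obtains N where "snd c p \<in> N" "N \<subseteq> snd c ` fst c"
    "smooth_on (N \<times> UNIV) (\<lambda>(y, v). form1_rep A c \<beta> y v :: real)"
    "\<exists>L. \<forall>X Y. dderiv (\<lambda>y. form1_rep A c \<beta> y Y) (snd c p) X - dderiv (\<lambda>y. form1_rep A c \<beta> y X) (snd c p) Y =
      ext_deriv1 B \<alpha> (f p) (L X) (L Y)"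
proof -
  note A' = manifold_imp_charted[OF A] and B' = manifold_imp_charted[OF B]
  define d where "d = chart_at B (f p)"
  have d: "d \<in> B" "f p \<in> fst d"
    using chart_at[OF B'] by (auto simp: d_def)
  define N where "N = snd c ` (fst c \<inter> S \<inter> f -` fst d)"
  let ?f = "local_rep c d f"
  have sf: "smooth_on N ?f"
    unfolding N_def by (rule smooth_map_on_local_rep[OF f c d(1)])
  have pN: "snd c p \<in> N"
    using p d by (auto simp: N_def)
  have fN: "?f y \<in> snd d ` fst d" if "y \<in> N" for y
    using that A' c by (auto simp: N_def local_rep_def)
  have rep: "form1_rep A c \<beta> y v = form1_rep B d \<alpha> (?f y) (dderiv ?f y v)" if "y \<in> N" for y v
    using form1_rep_pullback[where \<beta> = \<alpha> and \<alpha> = \<beta>, OF A B f \<beta> c d(1)] that by (simp add: N_def)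
  have "smooth_on (N \<times> UNIV) (\<lambda>(y, v). form1_rep B d \<alpha> (?f y) (dderiv ?f y v))"
    by (rule smooth_on_form_pullback[OF form1_rep_smooth[OF \<alpha> d(1)] sf fN])
  then have smooth: "smooth_on (N \<times> UNIV) (\<lambda>(y, v). form1_rep A c \<beta> y v)"
    by (rule smooth_on_cong) (auto simp: rep)
  have fp: "?f (snd c p) = snd d (f p)"
    using A' c p by (simp add: local_rep_def)
  have "dderiv (\<lambda>y. form1_rep A c \<beta> y Y) (snd c p) X - dderiv (\<lambda>y. form1_rep A c \<beta> y X) (snd c p) Y =
      ext_deriv1 B \<alpha> (f p) (dderiv ?f (snd c p) X) (dderiv ?f (snd c p) Y)" for X Y
    using dderiv_form_pullback[where b = "form1_rep A c \<beta>", OF form1_rep_smooth[OF \<alpha> d(1)] form1_rep_linear[OF B \<alpha> d(1)] sf fN rep pN]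
    by (simp add: ext_deriv1_def Let_def d_def[symmetric] fp)
  then show ?thesis
    using that[OF pN _ smooth] by (auto simp: N_def)
qed

section \<open>Invariant horizontal forms on principal bundles\<close>

lemma smooth_action_partial:
  assumes G: "manifold GA" and A: "manifold A" and act: "smooth_action G GA A act"
  shows "smooth_map A A (act g)" "smooth_map GA A (\<lambda>h. act h p)"
proof -
  have F: "smooth_map (prod_atlas GA A) A (\<lambda>(g, p). act g p)"
    using act by (simp add: smooth_action_def)
  show "smooth_map A A (act g)"
    using smooth_map_on_binary[OF A manifold_imp_charted[OF G] manifold_imp_charted[OF A]
        smooth_map_on_const[OF A open_UNIV] smooth_map_on_ident[OF A] F] by simp
  show "smooth_map GA A (\<lambda>h. act h p)"
    using smooth_map_on_binary[OF G manifold_imp_charted[OF G] manifold_imp_charted[OF A]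
        smooth_map_on_ident[OF G] smooth_map_on_const[OF G open_UNIV] F] by simp
qed

text \<open>The section is the part of a local trivialisation over the identity of the group; the group
  component \<open>\<tau>\<close> of the trivialisation then says by which element a point differs from the section.\<close>

lemma principal_bundle_local_section:
  assumes principal: "principal_bundle G GA PA BA act \<pi>" and G: "lie_group G GA"
  obtains U s \<tau> where "open U" "b \<in> U" "smooth_map_on BA U PA s" "\<forall>x\<in>U. \<pi> (s x) = x"
    "smooth_map_on PA (\<pi> -` U) GA \<tau>" "\<forall>p\<in>\<pi> -` U. act (\<tau> p) (s (\<pi> p)) = p"
proof -
  have PA: "manifold PA" and BA: "manifold BA" and GA: "manifold GA" and "group G" and "carrier G = UNIV"
    using principal G by (auto simp: principal_bundle_def lie_group_def)
  obtain U \<tau> \<Phi> where U: "open U" "b \<in> U"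
    and \<tau>: "smooth_map_on PA (\<pi> -` U) (prod_atlas BA GA) (\<lambda>p. (\<pi> p, \<tau> p))"
    and \<Phi>: "smooth_map_on (prod_atlas BA GA) (U \<times> UNIV) PA \<Phi>"
    and hom: "homeomorphism (\<pi> -` U) (U \<times> UNIV) (\<lambda>p. (\<pi> p, \<tau> p)) \<Phi>"
    and equi: "\<forall>g. \<forall>p\<in>\<pi> -` U. \<pi> (act g p) = \<pi> p \<and> \<tau> (act g p) = g \<otimes>\<^bsub>G\<^esub> \<tau> p"
  proof -
    have "\<forall>b. \<exists>U \<tau> \<Phi>. open U \<and> b \<in> U \<and>
        smooth_map_on PA (\<pi> -` U) (prod_atlas BA GA) (\<lambda>p. (\<pi> p, \<tau> p)) \<and>
        smooth_map_on (prod_atlas BA GA) (U \<times> UNIV) PA \<Phi> \<and>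
        homeomorphism (\<pi> -` U) (U \<times> UNIV) (\<lambda>p. (\<pi> p, \<tau> p)) \<Phi> \<and>
        (\<forall>g. \<forall>p\<in>\<pi> -` U. \<pi> (act g p) = \<pi> p \<and> \<tau> (act g p) = g \<otimes>\<^bsub>G\<^esub> \<tau> p)"
      using principal unfolding principal_bundle_def by (elim conjE)
    from this[rule_format, of b] show ?thesis
      by (elim exE conjE) (rule that)
  qed
  define s where "s x = \<Phi> (x, \<one>\<^bsub>G\<^esub>)" for x
  have s: "\<pi> (s x) = x" "\<tau> (s x) = \<one>\<^bsub>G\<^esub>" if "x \<in> U" for x
    using homeomorphism_apply2[OF hom, of "(x, \<one>\<^bsub>G\<^esub>)"] that by (auto simp: s_def)
  have "smooth_map_on BA U PA s"
    unfolding s_def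
    by (rule smooth_map_on_binary[OF BA manifold_imp_charted[OF BA] manifold_imp_charted[OF GA]
        smooth_map_on_subset[OF BA smooth_map_on_ident[OF BA] U(1)] smooth_map_on_const[OF BA U(1)],
        where T = "U \<times> UNIV"]) (use \<Phi> in auto)
  moreover have "act (\<tau> p) (s (\<pi> p)) = p" if p: "p \<in> \<pi> -` U" for p
  proof -
    have sp: "s (\<pi> p) \<in> \<pi> -` U" "\<pi> (s (\<pi> p)) = \<pi> p" "\<tau> (s (\<pi> p)) = \<one>\<^bsub>G\<^esub>"
      using p s by auto
    have "\<pi> (act (\<tau> p) (s (\<pi> p))) = \<pi> p" "\<tau> (act (\<tau> p) (s (\<pi> p))) = \<tau> p"
      using equi sp \<open>group G\<close> \<open>carrier G = UNIV\<close> by (auto simp: group.is_monoid)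
    moreover from this have "act (\<tau> p) (s (\<pi> p)) \<in> \<pi> -` U"
      using p by auto
    ultimately show ?thesis
      using homeomorphism_apply1[OF hom p] homeomorphism_apply1[OF hom, of "act (\<tau> p) (s (\<pi> p))"] by simp
  qed
  moreover have "smooth_map_on PA (\<pi> -` U) GA \<tau>"
    by (rule smooth_map_on_snd_component[OF manifold_imp_charted[OF BA] \<tau>])
  ultimately show ?thesis
    using that[OF U, of s \<tau>] s(1) by blast
qed

text \<open>Differentiating \<open>q = \<tau> q \<cdot> s (\<pi> q)\<close> splits every tangent vector at \<open>p\<close> into the translate of a
  vector tangent to the section, which only depends on its projection, and a vector tangent to the
  fibre, which is a translate of a fundamental vector.\<close>

lemma invariant_horizontal_form_on_section:
  assumes principal: "principal_bundle G GA PA BA act \<pi>" and G: "lie_group G GA"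
    and lin: "\<And>p. linear (\<alpha> p :: _ \<Rightarrow> real)"
    and inv: "\<And>g p X. \<alpha> (act g p) (tangent_map PA PA (act g) p X) = \<alpha> p X"
    and hor: "\<And>\<xi> p. \<alpha> p (fundamental_vf G GA PA act \<xi> p) = 0"
    and U: "open U" and s: "smooth_map_on BA U PA s"
    and \<tau>: "smooth_map_on PA (\<pi> -` U) GA \<tau>" and split: "\<forall>p\<in>\<pi> -` U. act (\<tau> p) (s (\<pi> p)) = p"
    and p: "p \<in> \<pi> -` U"
  shows "\<alpha> p X = \<alpha> (s (\<pi> p)) (tangent_map BA PA s (\<pi> p) (tangent_map PA BA \<pi> p X))"
proof -
  have PA: "manifold PA" and BA: "manifold BA" and GA: "manifold GA" and grp: "group G" and carr: "carrier G = UNIV"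
    and act: "smooth_action G GA PA act" and \<pi>: "smooth_map PA BA \<pi>"
    and mult: "smooth_map (prod_atlas GA GA) GA (\<lambda>(g, h). g \<otimes>\<^bsub>G\<^esub> h)"
    using principal G by (auto simp: principal_bundle_def lie_group_def)
  note PA' = manifold_imp_charted[OF PA] and BA' = manifold_imp_charted[OF BA] and GA' = manifold_imp_charted[OF GA]
  have F: "smooth_map (prod_atlas GA PA) PA (\<lambda>(g, p). act g p)" and act1: "act \<one>\<^bsub>G\<^esub> q = q"
    and act_mult: "act (g \<otimes>\<^bsub>G\<^esub> h) q = act g (act h q)" for g h q
    using act by (auto simp: smooth_action_def)
  have s\<pi>: "smooth_map_on PA (\<pi> -` U) PA (\<lambda>q. s (\<pi> q))"
    using smooth_map_on_compose[OF PA' BA' \<pi> s] by (simp add: o_def)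
  let ?h = "\<tau> p" and ?y = "s (\<pi> p)"
  have p_eq: "act ?h ?y = p"
    using split p by blast
  let ?V = "tangent_map PA GA \<tau> p X" and ?Z = "tangent_map PA PA (\<lambda>q. s (\<pi> q)) p X"
  have "tangent_map PA PA (\<lambda>q. act (\<tau> q) (s (\<pi> q))) p X = tangent_map PA PA (\<lambda>q. q) p X"
    by (rule tangent_map_cong[OF PA smooth_map_on_D(1)[OF s\<pi>] p]) (use split in auto)
  then have "X = tangent_map PA PA (\<lambda>q. act (\<tau> q) (s (\<pi> q))) p X"
    by (simp add: tangent_map_ident[OF PA])
  also have "\<dots> = tangent_map GA PA (\<lambda>g. act g ?y) ?h ?V + tangent_map PA PA (act ?h) ?y ?Z"
    by (rule tangent_map_binary[OF PA GA PA PA' \<tau> s\<pi> F p]) simp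
  finally have X: "X = tangent_map GA PA (\<lambda>g. act g ?y) ?h ?V + tangent_map PA PA (act ?h) ?y ?Z" .
  \<comment> \<open>The vector tangent to the fibre is moved from \<open>p\<close> to the section, where the orbit map starts at
    the identity of the group.\<close>
  define k where "k = inv\<^bsub>G\<^esub> ?h"
  have kh: "k \<otimes>\<^bsub>G\<^esub> ?h = \<one>\<^bsub>G\<^esub>" and hk: "?h \<otimes>\<^bsub>G\<^esub> k = \<one>\<^bsub>G\<^esub>"
    using grp carr by (auto simp: k_def group.l_inv group.r_inv)
  have L: "smooth_map GA GA (\<lambda>g. k \<otimes>\<^bsub>G\<^esub> g)"
    using smooth_map_on_binary[OF GA GA' GA' smooth_map_on_const[OF GA open_UNIV] smooth_map_on_ident[OF GA] mult] by simp
  note act_h = smooth_action_partial(1)[OF GA PA act, of ?h] and act_y = smooth_action_partial(2)[OF GA PA act, of ?y]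
  have kg: "smooth_map GA PA (\<lambda>g. act (k \<otimes>\<^bsub>G\<^esub> g) ?y)"
    using smooth_map_on_compose[OF GA' GA' L act_y] by (simp add: o_def)
  let ?\<xi> = "tangent_map GA GA (\<lambda>g. k \<otimes>\<^bsub>G\<^esub> g) ?h ?V"
  have "(\<lambda>g. act g ?y) = (\<lambda>g. act ?h (act (k \<otimes>\<^bsub>G\<^esub> g) ?y))"
    by (rule ext) (simp flip: act_mult add: hk act1 monoid.m_assoc[symmetric] group.is_monoid[OF grp] carr)
  then have "tangent_map GA PA (\<lambda>g. act g ?y) ?h ?V = tangent_map GA PA (\<lambda>g. act ?h (act (k \<otimes>\<^bsub>G\<^esub> g) ?y)) ?h ?V"
    by simp
  also have "\<dots> = tangent_map PA PA (act ?h) ?y (tangent_map GA PA (\<lambda>g. act (k \<otimes>\<^bsub>G\<^esub> g) ?y) ?h ?V)"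
    using tangent_map_compose[OF GA' PA' PA' kg act_h, of ?h ?V] by (simp add: kh act1)
  also have "tangent_map GA PA (\<lambda>g. act (k \<otimes>\<^bsub>G\<^esub> g) ?y) ?h ?V = fundamental_vf G GA PA act ?\<xi> ?y"
    using tangent_map_compose[OF GA' GA' PA' L act_y, of ?h ?V] by (simp add: kh fundamental_vf_def)
  finally have "\<alpha> p (tangent_map GA PA (\<lambda>g. act g ?y) ?h ?V) = 0"
    using inv[of ?h ?y "fundamental_vf G GA PA act ?\<xi> ?y"] hor[of ?y ?\<xi>] by (simp add: p_eq)
  moreover have "\<alpha> p (tangent_map PA PA (act ?h) ?y ?Z) = \<alpha> ?y ?Z"
    using inv[of ?h ?y ?Z] by (simp add: p_eq)
  ultimately have "\<alpha> p X = \<alpha> ?y ?Z"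
    by (subst X) (simp add: linear_add[OF lin])
  also have "?Z = tangent_map BA PA s (\<pi> p) (tangent_map PA BA \<pi> p X)"
    using p by (intro tangent_map_compose[OF PA' BA' PA' \<pi> s]) auto
  finally show ?thesis .
qed

text \<open>A section is a right inverse of the projection, so a form on the base is recovered from its
  pull-back. This gives uniqueness, and it makes every such form locally a pull-back by a section.\<close>

lemma pullback_along_section:
  assumes PA: "manifold PA" and BA: "manifold BA" and \<pi>: "smooth_map PA BA \<pi>"
    and s: "smooth_map_on BA U PA s" "\<forall>x\<in>U. \<pi> (s x) = x" and b: "b \<in> U"
  shows "pullback1 PA BA \<pi> \<beta> (s b) (tangent_map BA PA s b Y) = \<beta> b Y"
proof -
  note PA' = manifold_imp_charted[OF PA] and BA' = manifold_imp_charted[OF BA]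
  have "tangent_map PA BA \<pi> (s b) (tangent_map BA PA s b Y) = tangent_map BA BA (\<lambda>x. \<pi> (s x)) b Y"
    using tangent_map_compose[OF BA' PA' BA' s(1) \<pi> b] by simp
  also have "\<dots> = tangent_map BA BA (\<lambda>x. x) b Y"
    by (rule tangent_map_cong[OF BA smooth_map_on_D(1)[OF s(1)] b]) (use s(2) in auto)
  finally show ?thesis
    using s(2) b by (simp add: pullback1_def tangent_map_ident[OF BA])
qed

text \<open>The form on the base is defined at each point with a section chosen there. Near the point it is
  the pull-back by that one section, and is therefore smooth.\<close>

lemma invariant_horizontal_form_basic:
  fixes BA :: "('b::t2_space, 'f::locally_convex_space) atlas"
  assumes principal: "principal_bundle G GA PA BA act \<pi>" and G: "lie_group G GA" and \<alpha>: "form1 PA \<alpha>"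
    and inv: "\<And>g p X. \<alpha> (act g p) (tangent_map PA PA (act g) p X) = (\<alpha> p X :: real)"
    and hor: "\<And>\<xi> p. \<alpha> p (fundamental_vf G GA PA act \<xi> p) = 0"
  shows "\<exists>!\<beta>. form1 BA \<beta> \<and> \<alpha> = pullback1 PA BA \<pi> \<beta>"
proof (rule ex_ex1I)
  have PA: "manifold PA" and BA: "manifold BA" and \<pi>: "smooth_map PA BA \<pi>"
    using principal by (auto simp: principal_bundle_def)
  note BA' = manifold_imp_charted[OF BA] and PA' = manifold_imp_charted[OF PA]
  have lin: "linear (\<alpha> p)" for p
    using \<alpha> by (simp add: form1_def)
  have "\<exists>U s \<tau>. open U \<and> b \<in> U \<and> smooth_map_on BA U PA s \<and> (\<forall>x\<in>U. \<pi> (s x) = x) \<and>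
      smooth_map_on PA (\<pi> -` U) GA \<tau> \<and> (\<forall>p\<in>\<pi> -` U. act (\<tau> p) (s (\<pi> p)) = p)" for b
    by (rule principal_bundle_local_section[OF principal G, of b]) blast
  then obtain U s \<tau> where U: "\<And>b. open (U b)" "\<And>b. b \<in> U b"
    and s: "\<And>b. smooth_map_on BA (U b) PA (s b)" "\<And>b. \<forall>x\<in>U b. \<pi> (s b x) = x"
    and \<tau>: "\<And>b. smooth_map_on PA (\<pi> -` U b) GA (\<tau> b)" "\<And>b. \<forall>p\<in>\<pi> -` U b. act (\<tau> b p) (s b (\<pi> p)) = p"
    by metis
  define \<beta> where "\<beta> b Y = \<alpha> (s b b) (tangent_map BA PA (s b) b Y)" for b Y
  have pullback: "\<alpha> = pullback1 PA BA \<pi> \<beta>"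
  proof (intro ext)
    fix p X
    show "\<alpha> p X = pullback1 PA BA \<pi> \<beta> p X"
      unfolding pullback1_def \<beta>_def
      by (rule invariant_horizontal_form_on_section[OF principal G lin inv hor U(1) s(1) \<tau>]) (simp add: U(2))
  qed
  have \<beta>: "\<beta> x Y = \<alpha> (s b x) (tangent_map BA PA (s b) x Y)" if "x \<in> U b" for b x Y
    using pullback_along_section[OF PA BA \<pi> s that, of \<beta> Y] pullback by simp
  have "form1 BA \<beta>"
    unfolding form1_def
  proof (intro conjI allI ballI)
    show "linear (\<beta> b)" for b
      using linear_compose[OF tangent_map_linear[OF BA' PA' s(1) U(2)] lin] by (simp add: \<beta>_def[abs_def] o_def)
    fix c assume c: "c \<in> BA"
    have "smooth_on (snd c ` fst c \<times> UNIV) (\<lambda>(y, v). form1_rep BA c \<beta> y v)"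
    proof (rule smooth_on_local)
      fix z assume "z \<in> snd c ` fst c \<times> (UNIV :: 'f set)"
      then obtain b where b: "b \<in> fst c" "fst z = snd c b"
        by auto
      obtain N where N: "snd c b \<in> N" "N \<subseteq> snd c ` fst c"
        "smooth_on (N \<times> UNIV) (\<lambda>(y, v). form1_rep BA c \<beta> y v)"
        using form1_local_pullback[OF BA PA \<alpha> s(1) \<beta> c b(1) U(2)] by metis
      then show "\<exists>N. z \<in> N \<and> N \<subseteq> snd c ` fst c \<times> UNIV \<and> smooth_on N (\<lambda>(y, v). form1_rep BA c \<beta> y v)"
        using b by (intro exI[of _ "N \<times> UNIV"]) (auto simp: mem_Times_iff)
    qed
    then show "case c of (V, \<psi>) \<Rightarrow> smooth_on (\<psi> ` V \<times> UNIV) (\<lambda>(y, v). form1_rep BA (V, \<psi>) \<beta> y v)"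
      by (simp add: split_def)
  qed
  with pullback show "\<exists>\<beta>. form1 BA \<beta> \<and> \<alpha> = pullback1 PA BA \<pi> \<beta>"
    by blast
  fix \<beta>1 \<beta>2
  assume *: "form1 BA \<beta>1 \<and> \<alpha> = pullback1 PA BA \<pi> \<beta>1" "form1 BA \<beta>2 \<and> \<alpha> = pullback1 PA BA \<pi> \<beta>2"
  show "\<beta>1 = \<beta>2"
  proof (intro ext)
    fix b Y
    show "\<beta>1 b Y = \<beta>2 b Y"
      using pullback_along_section[OF PA BA \<pi> s U(2), of \<beta>1 b Y] pullback_along_section[OF PA BA \<pi> s U(2), of \<beta>2 b Y] *
      by simp
  qed
qed

text \<open>Pulling back by a section shows closedness on the base in every chart, and not only in the chart
  chosen at the base point. Integration in one fixed chart will require this.\<close>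

lemma closed_pullback_imp_closed_in_charts:
  assumes principal: "principal_bundle G GA PA BA act \<pi>" and G: "lie_group G GA"
    and \<alpha>: "form1 PA \<alpha>" "\<alpha> = pullback1 PA BA \<pi> \<beta>" and closed: "\<And>p X Y. ext_deriv1 PA \<alpha> p X Y = (0 :: real)"
    and c: "c \<in> BA" "y \<in> snd c ` fst c"
  shows "dderiv (\<lambda>y. form1_rep BA c \<beta> y Y) y X = dderiv (\<lambda>y. form1_rep BA c \<beta> y X) y Y"
proof -
  have PA: "manifold PA" and BA: "manifold BA" and \<pi>: "smooth_map PA BA \<pi>"
    using principal by (auto simp: principal_bundle_def)
  obtain b where b: "b \<in> fst c" "y = snd c b"
    using c(2) by auto
  obtain U s \<tau> where U: "open U" "b \<in> U" and s: "smooth_map_on BA U PA s" "\<forall>x\<in>U. \<pi> (s x) = x"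
      "smooth_map_on PA (\<pi> -` U) GA \<tau>" "\<forall>p\<in>\<pi> -` U. act (\<tau> p) (s (\<pi> p)) = p"
    by (rule principal_bundle_local_section[OF principal G, of b])
  have \<beta>: "\<beta> x Y = \<alpha> (s x) (tangent_map BA PA s x Y)" if "x \<in> U" for x Y
    using pullback_along_section[OF PA BA \<pi> s(1,2) that, of \<beta> Y] \<alpha>(2) by simp
  obtain L where "\<forall>X Y. dderiv (\<lambda>y. form1_rep BA c \<beta> y Y) (snd c b) X -
      dderiv (\<lambda>y. form1_rep BA c \<beta> y X) (snd c b) Y = ext_deriv1 PA \<alpha> (s b) (L X) (L Y)"
    using form1_local_pullback[OF BA PA \<alpha>(1) s(1) \<beta> c(1) b(1) U(2)] by metis
  then show ?thesis
    using closed by (simp add: b(2))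
qed

section \<open>The form of an orbit\<close>

lemma orbit_form_rep:
  "form1_rep A c (orbit_form \<kappa>\<^sub>a J chi \<theta>) x v =
    \<kappa>\<^sub>a (local_rep c (UNIV, \<lambda>x. x) (\<lambda>p. J (chi p)) x) (form1_rep A c \<theta> x v)"
  by (simp add: form1_rep_eq orbit_form_def local_rep_def)

lemma form1_orbit_form:
  assumes PA: "manifold PA" and J: "smooth_map PA model_atlas (\<lambda>p. J (chi p))"
    and \<theta>: "form1 PA \<theta>" and \<kappa>: "continuous_bilinear \<kappa>\<^sub>a"
  shows "form1 PA (orbit_form \<kappa>\<^sub>a J chi \<theta> :: 'p::t2_space \<Rightarrow> 'e::locally_convex_space \<Rightarrow> real)"
  unfolding form1_def
proof (intro conjI allI ballI)
  have "linear (\<kappa>\<^sub>a \<mu>)" for \<mu>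
    using \<kappa> by (simp add: continuous_bilinear_def bilinear_def)
  moreover have "linear (\<theta> p)" for p
    using \<theta> by (simp add: form1_def)
  ultimately show "linear (orbit_form \<kappa>\<^sub>a J chi \<theta> p)" for p
    using linear_compose[of "\<theta> p" "\<kappa>\<^sub>a (J (chi p))"] by (simp add: orbit_form_def[abs_def] o_def)
  fix c assume c: "c \<in> PA"
  let ?J = "local_rep c (UNIV, \<lambda>x. x) (\<lambda>p. J (chi p))"
  have sJ: "smooth_on (snd c ` fst c) ?J"
    using smooth_map_on_local_rep[OF J c, of "(UNIV, \<lambda>x. x)"] by simp
  have "open (snd c ` fst c \<times> (UNIV :: 'e set))"
    using manifold_open_chart(2)[OF PA c] by (simp add: open_Times)
  from smooth_on_compose[OF smooth_on_fst[OF this] sJ]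
  have "smooth_on (snd c ` fst c \<times> UNIV) (\<lambda>z :: 'e \<times> 'e. ?J (fst z))"
    by auto
  from smooth_on_bilinear[OF \<kappa> this form1_rep_smooth[OF \<theta> c]]
  show "case c of (U, \<phi>) \<Rightarrow> smooth_on (\<phi> ` U \<times> UNIV) (\<lambda>(x, v). form1_rep PA (U, \<phi>) (orbit_form \<kappa>\<^sub>a J chi \<theta>) x v)"
    by (simp add: orbit_form_rep split_def)
qed

text \<open>The product rule for \<open>\<kappa>\<^sub>a\<close>; the exterior derivative is computed with constant vector fields, so
  nothing else has to be differentiated.\<close>

lemma ext_deriv1_orbit_form:
  assumes PA: "manifold PA" and J: "smooth_map PA model_atlas (\<lambda>p. J (chi p))"
    and \<theta>: "form1 PA \<theta>" and \<kappa>: "continuous_bilinear \<kappa>\<^sub>a"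
  shows "ext_deriv1 PA (orbit_form \<kappa>\<^sub>a J chi \<theta>) p X Y =
    \<kappa>\<^sub>a (tangent_map PA model_atlas (\<lambda>p. J (chi p)) p X) (\<theta> p Y) -
    \<kappa>\<^sub>a (tangent_map PA model_atlas (\<lambda>p. J (chi p)) p Y) (\<theta> p X) + (\<kappa>\<^sub>a (J (chi p)) (ext_deriv1 PA \<theta> p X Y) :: real)"
proof -
  note PA' = manifold_imp_charted[OF PA]
  define c where "c = chart_at PA p"
  have c: "c \<in> PA" "p \<in> fst c"
    using chart_at[OF PA'] by (auto simp: c_def)
  let ?J = "local_rep c (UNIV, \<lambda>x. x) (\<lambda>p. J (chi p))" and ?x = "snd c p"
  have sJ: "smooth_on (snd c ` fst c) ?J"
    using smooth_map_on_local_rep[OF J c(1), of "(UNIV, \<lambda>x. x)"] by simp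
  have x: "?x \<in> snd c ` fst c"
    using c by blast
  have J': "tangent_map PA model_atlas (\<lambda>p. J (chi p)) p V = dderiv ?J ?x V" for V
    by (simp add: tangent_map_eq c_def)
  have \<theta>': "form1_rep PA c \<theta> ?x V = \<theta> p V" for V
    unfolding c_def by (rule form1_rep_chart_at[OF PA])
  have *: "dderiv (\<lambda>y. form1_rep PA c (orbit_form \<kappa>\<^sub>a J chi \<theta>) y W) ?x V =
      \<kappa>\<^sub>a (dderiv ?J ?x V) (\<theta> p W) + \<kappa>\<^sub>a (J (chi p)) (dderiv (\<lambda>y. form1_rep PA c \<theta> y W) ?x V)" for V W
  proof -
    have "has_dderiv (\<lambda>y. \<kappa>\<^sub>a (?J y) (form1_rep PA c \<theta> y W)) ?x V
        (\<kappa>\<^sub>a (dderiv ?J ?x V) (form1_rep PA c \<theta> ?x W) + \<kappa>\<^sub>a (?J ?x) (dderiv (\<lambda>y. form1_rep PA c \<theta> y W) ?x V))"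
      by (rule has_dderiv_bilinear[OF \<kappa> smooth_on_has_dderiv[OF sJ x] smooth_on_has_dderiv[OF
            form1_rep_smooth_fixed[OF \<theta> c(1) manifold_open_chart(2)[OF PA c(1)]] x]])
    moreover have "?J ?x = J (chi p)"
      using c PA' by (simp add: local_rep_def)
    ultimately show ?thesis
      by (simp add: orbit_form_rep has_dderiv_imp_eq \<theta>')
  qed
  have "linear (\<kappa>\<^sub>a (J (chi p)))"
    using \<kappa> by (simp add: continuous_bilinear_def bilinear_def)
  from linear_diff[OF this] show ?thesis
    by (simp add: ext_deriv1_def Let_def c_def[symmetric] * J')
qed

section \<open>Primitives of closed forms on convex sets\<close>

lemma has_dderiv_real_iff: "has_dderiv f (r::real) 1 l \<longleftrightarrow> (f has_real_derivative l) (at r)"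
  unfolding has_dderiv_def DERIV_def diff_quot_def
  by (simp add: divide_inverse mult.commute)

lemma continuous_on_scaleR_lcs:
  fixes g :: "'i::topological_space \<Rightarrow> 'e::locally_convex_space"
  shows "continuous_on S f \<Longrightarrow> continuous_on S g \<Longrightarrow> continuous_on S (\<lambda>i. f i *\<^sub>R g i)"
  unfolding continuous_on_def by (blast intro: tendsto_scaleR_lcs)

text \<open>Directional derivatives alone do not imply continuity, but a jointly continuous derivative does: on
  a small convex neighbourhood of \<open>x\<close> the increment of \<open>f\<close> is controlled by derivatives in small
  directions.\<close>

lemma has_dderiv_imp_continuous_on:
  fixes f :: "'e::locally_convex_space \<Rightarrow> 'f::locally_convex_space"
  assumes W: "open W" and f: "\<And>x v. x \<in> W \<Longrightarrow> has_dderiv f x v (a x v)"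
    and a: "continuous_on (W \<times> UNIV) (\<lambda>(x, v). a x v)"
  shows "continuous_on W f"
  unfolding continuous_on_def
proof
  fix x assume x: "x \<in> W"
  show "(f \<longlongrightarrow> f x) (at x within W)"
  proof (rule topological_tendstoI)
    fix S assume S: "open S" "f x \<in> S"
    have "continuous_on UNIV (\<lambda>y. y + f x)"
      by (simp add: continuous_on_def tendsto_add tendsto_ident_at)
    then have "open ((\<lambda>y. y + f x) -` S)" "0 \<in> (\<lambda>y. y + f x) -` S"
      using open_vimage[OF S(1)] S(2) by auto
    then obtain C where C: "open C" "convex C" "0 \<in> C" "C \<subseteq> (\<lambda>y. y + f x) -` S"
      by (rule open_convex_nhd)
    have "has_dderiv f x 0 0"
      by (simp add: has_dderiv_def diff_quot_def[abs_def])
    then have ax: "a x 0 = 0"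
      using f[OF x] has_dderiv_unique by blast
    have "open ((\<lambda>(x, v). a x v) -` C \<inter> (W \<times> UNIV))"
      using continuous_open_preimage[OF a open_Times[OF W open_UNIV] C(1)] by (simp add: Int_commute)
    moreover have "(x, 0) \<in> (\<lambda>(x, v). a x v) -` C \<inter> (W \<times> UNIV)"
      using x C(3) ax by simp
    ultimately obtain N M where "open N" "open M" "(x, 0) \<in> N \<times> M"
        and NM: "N \<times> M \<subseteq> (\<lambda>(x, v). a x v) -` C \<inter> (W \<times> UNIV)"
      by (rule open_prod_elim)
    then have N: "open N" "x \<in> N" and M: "open M" "0 \<in> M"
      by auto
    have "open ((\<lambda>y. y - x) -` M)"
      by (rule open_vimage[OF M(1)])
        (auto simp: continuous_on_def diff_conv_add_uminus simp del: add_uminus_conv_diff intro!: tendsto_add tendsto_ident_at)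
    then have "open (N \<inter> (\<lambda>y. y - x) -` M)" "x \<in> N \<inter> (\<lambda>y. y - x) -` M"
      using N M by (auto intro: open_Int)
    then obtain K where K: "open K" "convex K" "x \<in> K" "K \<subseteq> N \<inter> (\<lambda>y. y - x) -` M"
      by (rule open_convex_nhd)
    have "f y \<in> S" if y: "y \<in> K" for y
    proof -
      have seg: "x + s *\<^sub>R (y - x) \<in> K" if "0 \<le> s" "s \<le> 1" for s
        using convexD[OF K(2,3) y, of "1 - s" s] that by (simp add: algebra_simps)
      have "(f (x + 1 *\<^sub>R (y - x)) - f (x + 0 *\<^sub>R (y - x))) /\<^sub>R (1 - 0) \<in> C"
      proof (rule mean_value_open_convex[OF C(1,2), where \<gamma> = "\<lambda>s. f (x + s *\<^sub>R (y - x))"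
            and \<gamma>' = "\<lambda>s. a (x + s *\<^sub>R (y - x)) (y - x)"])
        fix s :: real assume s: "0 \<le> s" "s \<le> 1"
        have "(x + s *\<^sub>R (y - x), y - x) \<in> N \<times> M"
          using seg[OF s] K(4) y by auto
        then have "x + s *\<^sub>R (y - x) \<in> W" "a (x + s *\<^sub>R (y - x)) (y - x) \<in> C"
          using NM by auto
        then show "has_dderiv (\<lambda>s. f (x + s *\<^sub>R (y - x))) s 1 (a (x + s *\<^sub>R (y - x)) (y - x))"
            "a (x + s *\<^sub>R (y - x)) (y - x) \<in> C"
          by (auto intro: has_dderiv_along_line f)
      qed simp
      with C(4) show ?thesis by auto
    qed
    with K(1,3) show "\<forall>\<^sub>F y in at x within W. f y \<in> S"
      by (auto simp: eventually_at_topological)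
  qed
qed

text \<open>The derivatives of \<open>f\<close> beyond the first are derivatives of \<open>(x, v) \<mapsto> a x v\<close> at \<open>(x, w\<^sub>j)\<close> in directions
  \<open>(w\<^sub>i, 0)\<close>, because the last direction is held fixed.\<close>

lemma primitive_smooth_on:
  fixes f :: "'e::locally_convex_space \<Rightarrow> 'f::locally_convex_space"
  assumes W: "open W" and f: "\<And>x v. x \<in> W \<Longrightarrow> has_dderiv f x v (a x v)"
    and a: "smooth_on (W \<times> UNIV) (\<lambda>(x, v). a x v)"
  shows "smooth_on W f"
proof -
  let ?a = "\<lambda>(x, v). a x v"
  define t where "t is j = (\<lambda>x w. iter_dderiv ?a (map (\<lambda>i. (w i, 0)) is) (x, w j))" for "is" and j :: nat
  define T where "T = insert (\<lambda>x (w :: nat \<Rightarrow> 'e). f x) {t is j |is j. True}"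
  have t: "t is j \<in> sums_of T" for "is" j
    by (rule sums_of.base) (auto simp: T_def)
  show ?thesis
  proof (rule smooth_on_terms[OF W, where T = T])
    show "(\<lambda>x w. f x) \<in> sums_of T"
      by (rule sums_of.base) (simp add: T_def)
    fix H assume "H \<in> T"
    then consider "H = (\<lambda>x w. f x)" | "is" j where "H = t is j"
      unfolding T_def by blast
    then have "continuous_on (W \<times> UNIV) (\<lambda>(x, w). H x w) \<and>
      (\<exists>H'\<in>sums_of T. \<forall>x\<in>W. \<forall>w. has_dderiv (\<lambda>x. H x (\<lambda>i. w (Suc i))) x (w 0) (H' x w))"
    proof cases
      case 1
      have "continuous_on W f"
        by (rule has_dderiv_imp_continuous_on[OF W f smooth_on_imp_continuous_on[OF a]])
      from continuous_on_compose2[OF this continuous_on_fst[OF continuous_on_id], of "W \<times> (UNIV :: (nat \<Rightarrow> 'e) set)"]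
      have "continuous_on (W \<times> UNIV) (\<lambda>(x, w :: nat \<Rightarrow> 'e). H x w)"
        using 1 by (auto simp: split_def)
      moreover have "\<forall>x\<in>W. \<forall>w. has_dderiv (\<lambda>x. H x (\<lambda>i. w (Suc i))) x (w 0) (t [] 0 x w)"
        using f by (simp add: 1 t_def)
      ultimately show ?thesis
        using t by blast
    next
      case (2 "is" j)
      have "continuous_on (W \<times> (UNIV :: (nat \<Rightarrow> 'e) set))
          (\<lambda>z. iter_dderiv ?a (map (\<lambda>b. b z) (map (\<lambda>i z. (snd z i, 0)) is)) (fst z, snd z j))"
        by (rule continuous_on_iter_dderiv_compose[OF a])
          (auto intro!: continuous_on_Pair continuous_on_fst continuous_on_id continuous_on_direction)
      then have "continuous_on (W \<times> UNIV) (\<lambda>(x, w). H x w)"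
        by (simp add: 2 t_def split_def o_def)
      moreover have "has_dderiv (\<lambda>x. H x (\<lambda>i. w (Suc i))) x (w 0) (t (0 # map Suc is) (Suc j) x w)"
        if "x \<in> W" for x w
        using smooth_on_has_dderiv_iter[OF a, of "(x, w (Suc j))" "map (\<lambda>i. (w (Suc i), 0)) is" "(w 0, 0)"] that
        by (simp add: 2 t_def o_def has_dderiv_def diff_quot_def[abs_def])
      ultimately show ?thesis
        using t by blast
    qed
    then show "continuous_on (W \<times> UNIV) (\<lambda>(x, w). H x w)"
      and "\<exists>H'\<in>sums_of T. \<forall>x\<in>W. \<forall>w. has_dderiv (\<lambda>x. H x (\<lambda>i. w (Suc i))) x (w 0) (H' x w)"
      by blast+
  qed
qed

text \<open>The primitive is \<open>y \<mapsto> \<integral>\<^sub>0\<^sup>1 a(x\<^sub>0 + s(y - x\<^sub>0))(y - x\<^sub>0) ds\<close>. Differentiating under the integral sign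
  along \<open>v\<close> and exchanging the two vectors by closedness turns the integrand into the derivative of
  \<open>s \<cdot> a(x\<^sub>0 + s(y - x\<^sub>0))(v)\<close>.\<close>

lemma closed_form_has_primitive:
  fixes a :: "'e::locally_convex_space \<Rightarrow> 'e \<Rightarrow> real"
  assumes W: "open W" "convex W" "x0 \<in> W"
    and a: "smooth_on (W \<times> UNIV) (\<lambda>(x, v). a x v)" and lin: "\<And>x. x \<in> W \<Longrightarrow> linear (a x)"
    and closed: "\<And>x X Y. x \<in> W \<Longrightarrow> dderiv (\<lambda>x. a x Y) x X = dderiv (\<lambda>x. a x X) x Y"
  shows "\<exists>f. \<forall>x\<in>W. \<forall>v. has_dderiv f x v (a x v)"
proof -
  let ?a = "\<lambda>(x, v). a x v"
  define f where "f y = integral (cbox 0 1) (\<lambda>s. a (x0 + s *\<^sub>R (y - x0)) (y - x0))" for y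
  have da: "dderiv ?a (x, w) (u, v) = dderiv (\<lambda>x. a x w) x u + a x v" if x: "x \<in> W" for x w u v
  proof -
    have z: "(x, w) \<in> W \<times> UNIV"
      using x by simp
    have "dderiv ?a (x, w) (u, v) = dderiv ?a (x, w) (u, 0) + dderiv ?a (x, w) (0, v)"
      using linear_add[OF C1_on_linear[OF smooth_on_imp_C1_on[OF a] z], of "(u, 0)" "(0, v)"] by simp
    also have "dderiv ?a (x, w) (u, 0) = dderiv (\<lambda>x. a x w) x u"
      by (simp add: dderiv_def diff_quot_def[abs_def])
    also have "dderiv ?a (x, w) (0, v) = dderiv (a x) w v"
      by (simp add: dderiv_def diff_quot_def[abs_def])
    also have "\<dots> = a x v"
      by (rule has_dderiv_imp_eq[OF has_dderiv_linear[OF lin[OF x]]])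
    finally show ?thesis .
  qed
  have a_lin: "linear (dderiv (\<lambda>x. a x w) x)" if x: "x \<in> W" for x w
  proof -
    have "smooth_on W (\<lambda>x. ?a (x, w))"
      by (rule smooth_on_compose[OF smooth_on_Pair[OF smooth_on_ident smooth_on_const] a]) (use W in auto)
    then show ?thesis
      using C1_on_linear[OF smooth_on_imp_C1_on x] by simp
  qed
  have "has_dderiv f y v (a y v)" if y: "y \<in> W" for y v
  proof -
    \<comment> \<open>Everything happens on the line through \<open>y\<close> with direction \<open>v\<close>, parametrised by \<open>r\<close>; the part of
      it that lies in \<open>W\<close> is an open interval.\<close>
    define u where "u r = y + r *\<^sub>R v - x0" for r
    define R where "R = {r. y + r *\<^sub>R v \<in> W}"
    define g where "g r s = a (x0 + s *\<^sub>R u r) (u r)" for r s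
    define g' where "g' r s = dderiv ?a (x0 + s *\<^sub>R u r, u r) (s *\<^sub>R v, v)" for r s
    have u_cont: "continuous_on S (\<lambda>z. u (k z))" if "continuous_on S k" for S :: "'z::topological_space set" and k
      unfolding u_def diff_conv_add_uminus
      using that by (intro continuous_on_add continuous_on_const continuous_on_scaleR_lcs)
    have base_cont: "continuous_on S (\<lambda>z. x0 + l z *\<^sub>R u (k z))" if "continuous_on S k" "continuous_on S l" for S :: "'z::topological_space set" and k l
      using that u_cont by (intro continuous_on_add continuous_on_const continuous_on_scaleR_lcs)
    have "R = (\<lambda>r. y + r *\<^sub>R v) -` W"
      by (auto simp: R_def)
    moreover have "continuous_on UNIV (\<lambda>r. y + r *\<^sub>R v)"
      by (intro continuous_on_add continuous_on_const continuous_on_scaleR_lcs continuous_on_id)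
    ultimately have "open R"
      using open_vimage[OF W(1)] by metis
    have "convex R"
    proof (rule convexI)
      fix r1 r2 p q :: real assume *: "r1 \<in> R" "r2 \<in> R" "0 \<le> p" "0 \<le> q" "p + q = 1"
      have "p *\<^sub>R (y + r1 *\<^sub>R v) + q *\<^sub>R (y + r2 *\<^sub>R v) \<in> W"
        using * by (intro convexD[OF W(2)]) (auto simp: R_def)
      moreover have "p *\<^sub>R (y + r1 *\<^sub>R v) + q *\<^sub>R (y + r2 *\<^sub>R v) = (p + q) *\<^sub>R y + (p *\<^sub>R r1 + q *\<^sub>R r2) *\<^sub>R v"
        by (simp add: algebra_simps)
      ultimately show "p *\<^sub>R r1 + q *\<^sub>R r2 \<in> R"
        using *(5) by (simp add: R_def)
    qed
    have "0 \<in> R"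
      using y by (simp add: R_def)
    have in_W: "x0 + s *\<^sub>R u r \<in> W" if "r \<in> R" "0 \<le> s" "s \<le> 1" for r s
    proof -
      have "(1 - s) *\<^sub>R x0 + s *\<^sub>R (y + r *\<^sub>R v) \<in> W"
        using that W by (intro convexD) (auto simp: R_def)
      then show ?thesis
        by (simp add: u_def algebra_simps)
    qed
    have g: "((\<lambda>r. g r s) has_real_derivative g' r s) (at r)" if r: "r \<in> R" "0 \<le> s" "s \<le> 1" for r s
    proof -
      have "has_dderiv u r 1 v"
        by (simp add: has_dderiv_def diff_quot_def u_def algebra_simps Lim_cong_within)
      from has_dderiv_Pair[OF has_dderiv_add[OF has_dderiv_const has_dderiv_scaleR[OF this]] this, of x0 s]
      have "has_dderiv (\<lambda>r. (x0 + s *\<^sub>R u r, u r)) r 1 (s *\<^sub>R v, v)"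
        by simp
      then have "has_dderiv (\<lambda>r. ?a (x0 + s *\<^sub>R u r, u r)) r 1 (g' r s)"
        unfolding g'_def
        by (intro has_dderiv_compose[where g = ?a, OF smooth_on_imp_C1_on[OF a]]) (use in_W[OF r] in auto)
      then show ?thesis
        by (simp add: g_def has_dderiv_real_iff)
    qed
    have g_cont: "continuous_on {0..1} (g r)" if "r \<in> R" for r
    proof -
      have "continuous_on {0..1} (\<lambda>s. ?a (x0 + s *\<^sub>R u r, u r))"
        by (rule continuous_on_compose2[OF smooth_on_imp_continuous_on[OF a]])
          (use in_W[OF that] base_cont[OF continuous_on_const continuous_on_id] in \<open>auto intro: continuous_on_Pair continuous_on_const\<close>)
      then show ?thesis
        by (simp add: g_def[abs_def])
    qed
    have g'_cont: "continuous_on (R \<times> cbox 0 1) (\<lambda>(r, s). g' r s)"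
    proof -
      have "continuous_on (R \<times> cbox 0 1) (\<lambda>z. (\<lambda>(x, v). dderiv ?a x v) ((x0 + snd z *\<^sub>R u (fst z), u (fst z)), (snd z *\<^sub>R v, v)))"
      proof (rule continuous_on_compose2[of "(W \<times> UNIV) \<times> UNIV"])
        show "continuous_on ((W \<times> UNIV) \<times> UNIV) (\<lambda>(x, v). dderiv ?a x v)"
          using smooth_on_imp_C1_on[OF a] by (simp add: C1_on_def)
        show "continuous_on (R \<times> cbox 0 1) (\<lambda>z. ((x0 + snd z *\<^sub>R u (fst z), u (fst z)), (snd z *\<^sub>R v, v)))"
          by (intro continuous_on_Pair base_cont u_cont continuous_on_scaleR_lcs continuous_on_const
              continuous_on_fst continuous_on_snd continuous_on_id)
      qed (use in_W in auto)
      then show ?thesis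
        by (simp add: g'_def split_def)
    qed
    have "((\<lambda>r. integral (cbox 0 1) (g r)) has_field_derivative integral (cbox 0 1) (g' 0)) (at 0 within R)"
      by (rule leibniz_rule_field_derivative[OF _ _ g'_cont \<open>0 \<in> R\<close> \<open>convex R\<close>])
        (use g g_cont in \<open>auto intro: has_field_derivative_at_within integrable_continuous_real\<close>)
    then have "has_dderiv (\<lambda>r. integral (cbox 0 1) (g r)) 0 1 (integral (cbox 0 1) (g' 0))"
      using at_within_open[OF \<open>0 \<in> R\<close> \<open>open R\<close>] by (simp add: has_dderiv_real_iff)
    moreover have "integral (cbox 0 1) (g r) = f (y + r *\<^sub>R v)" for r
      by (simp add: f_def g_def[abs_def] u_def)
    ultimately have "has_dderiv f y v (integral (cbox 0 1) (g' 0))"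
      by (simp add: has_dderiv_def diff_quot_def[abs_def])
    moreover have "integral (cbox 0 1) (g' 0) = a y v"
    proof -
      have "((\<lambda>s. s * a (x0 + s *\<^sub>R u 0) v) has_vector_derivative g' 0 s) (at s within {0..1})"
        if s: "s \<in> {0..1}" for s
      proof -
        let ?x = "x0 + s *\<^sub>R u 0"
        have x: "?x \<in> W"
          using in_W[OF \<open>0 \<in> R\<close>, of s] s by simp
        have "smooth_on W (\<lambda>x. ?a (x, v))"
          by (rule smooth_on_compose[OF smooth_on_Pair[OF smooth_on_ident smooth_on_const] a]) (use W in auto)
        then have "has_dderiv (\<lambda>s. a (x0 + s *\<^sub>R u 0) v) s 1 (dderiv (\<lambda>x. a x v) ?x (u 0))"
          using x by (intro has_dderiv_along_line smooth_on_has_dderiv) auto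
        then have "((\<lambda>s. a (x0 + s *\<^sub>R u 0) v) has_real_derivative dderiv (\<lambda>x. a x (u 0)) ?x v) (at s)"
          using closed[OF x, of v "u 0"] by (simp add: has_dderiv_real_iff)
        then have "((\<lambda>s. s * a (x0 + s *\<^sub>R u 0) v) has_real_derivative
            s * dderiv (\<lambda>x. a x (u 0)) ?x v + a ?x v) (at s)"
          by (auto intro!: derivative_eq_intros)
        moreover have "g' 0 s = s * dderiv (\<lambda>x. a x (u 0)) ?x v + a ?x v"
          by (simp add: g'_def da[OF x] linear_scale[OF a_lin[OF x]])
        ultimately show ?thesis
          by (simp add: has_real_derivative_iff_has_vector_derivative has_vector_derivative_at_within)
      qed
      from fundamental_theorem_of_calculus[OF _ this]
      have "(g' 0 has_integral (1 * a (x0 + 1 *\<^sub>R u 0) v - 0 * a (x0 + 0 *\<^sub>R u 0) v)) {0..1}"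
        by simp
      then show ?thesis
        by (simp add: integral_unique u_def)
    qed
    ultimately show ?thesis by simp
  qed
  then show ?thesis by blast
qed

section \<open>Gluing local primitives on a simply connected space\<close>

lemma continuous_on_open_nhd:
  assumes "continuous_on S H" "x \<in> S" "open K" "H x \<in> K"
  obtains V where "open V" "x \<in> V" "\<forall>y\<in>S. y \<in> V \<longrightarrow> H y \<in> K"
  using assms(1)[unfolded continuous_on_topological, rule_format, OF assms(2,3,4)] by blast

text \<open>A free homotopy between two constant loops traces a path between their base points.\<close>

lemma simply_connected_path_between:
  fixes a b :: "'b::topological_space"
  assumes sc: "simply_connected (UNIV :: 'b set)"
  shows "\<exists>p. path p \<and> pathstart p = a \<and> pathfinish p = b"
proof -
  have "homotopic_loops UNIV (\<lambda>t. a) (\<lambda>t. b)"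
    using sc unfolding simply_connected_def by (simp add: path_def pathstart_def pathfinish_def)
  then obtain H where H: "continuous_on ({0..1::real} \<times> {0..1::real}) H" "H (0, 0) = a" "H (1, 0) = b"
    unfolding homotopic_loops by force
  have "continuous_on {0..1} (\<lambda>s. H (s, 0))"
    by (rule continuous_on_compose2[OF H(1)]) (auto intro!: continuous_intros)
  with H(2,3) show ?thesis
    by (intro exI[of _ "\<lambda>s. H (s, 0)"]) (auto simp: path_def pathstart_def pathfinish_def)
qed

text \<open>Local functions that cover the space and differ by local constants where they overlap. A
  primitive along a map is a function on its domain whose local variation is that of the local
  functions; the analytic continuation of the local functions along paths and homotopies is expressed
  in these terms.\<close>

locale local_primitives =
  fixes L :: "('b::topological_space set \<times> ('b \<Rightarrow> real)) set"
  assumes cover: "\<exists>N f. (N, f) \<in> L \<and> b \<in> N"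
    and open_dom: "(N, f) \<in> L \<Longrightarrow> open N"
    and compat: "(N1, f1) \<in> L \<Longrightarrow> (N2, f2) \<in> L \<Longrightarrow> b \<in> N1 \<Longrightarrow> b \<in> N2 \<Longrightarrow>
      \<exists>K. open K \<and> b \<in> K \<and> (\<forall>y\<in>K. f1 y - f1 b = f2 y - f2 b)"
begin

definition primitive_along :: "('x::topological_space \<Rightarrow> 'b) \<Rightarrow> 'x set \<Rightarrow> ('x \<Rightarrow> real) \<Rightarrow> bool" where
  "primitive_along H S h \<longleftrightarrow> (\<forall>x\<in>S. \<exists>N f U. (N, f) \<in> L \<and> H x \<in> N \<and> open U \<and> x \<in> U \<and>
    (\<forall>y\<in>S \<inter> U. h y - h x = f (H y) - f (H x)))"

lemma primitive_alongE:
  assumes "primitive_along H S h" "x \<in> S"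
  obtains N f U where "(N, f) \<in> L" "H x \<in> N" "open U" "x \<in> U" "\<forall>y\<in>S \<inter> U. h y - h x = f (H y) - f (H x)"
  using bspec[OF assms(1)[unfolded primitive_along_def] assms(2)] by (elim exE conjE) (rule that)

text \<open>Any local function may be used at a point, since two of them differ by a constant near it.\<close>

lemma primitive_along_local:
  assumes h: "primitive_along H S h" and H: "continuous_on S H" and L: "(N, f) \<in> L" and x: "x \<in> S" "H x \<in> N"
  obtains U where "open U" "x \<in> U" "\<forall>y\<in>S \<inter> U. h y - h x = f (H y) - f (H x)"
proof -
  obtain N' f' U where U: "(N', f') \<in> L" "H x \<in> N'" "open U" "x \<in> U"
      "\<forall>y\<in>S \<inter> U. h y - h x = f' (H y) - f' (H x)"
    by (rule primitive_alongE[OF h x(1)])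
  obtain K where K: "open K" "H x \<in> K" "\<forall>z\<in>K. f' z - f' (H x) = f z - f (H x)"
    using compat[OF U(1) L U(2) x(2)] by blast
  obtain V where V: "open V" "x \<in> V" "\<forall>y\<in>S. y \<in> V \<longrightarrow> H y \<in> K"
    by (rule continuous_on_open_nhd[OF H x(1) K(1,2)])
  show ?thesis
    by (rule that[of "U \<inter> V"]) (use U K V in auto)
qed

lemma primitive_along_unique:
  assumes S: "connected S" and H: "continuous_on S H"
    and h1: "primitive_along H S h1" and h2: "primitive_along H S h2" and xy: "x \<in> S" "y \<in> S"
  shows "h1 x - h2 x = h1 y - h2 y"
proof (rule connected_local_const[where f = "\<lambda>x. h1 x - h2 x", OF S xy], intro ballI)
  fix x assume x: "x \<in> S"
  obtain N f where L: "(N, f) \<in> L" "H x \<in> N"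
    using cover by blast
  obtain U1 where U1: "open U1" "x \<in> U1" "\<forall>y\<in>S \<inter> U1. h1 y - h1 x = f (H y) - f (H x)"
    by (rule primitive_along_local[OF h1 H L(1) x L(2)])
  obtain U2 where U2: "open U2" "x \<in> U2" "\<forall>y\<in>S \<inter> U2. h2 y - h2 x = f (H y) - f (H x)"
    by (rule primitive_along_local[OF h2 H L(1) x L(2)])
  show "\<forall>\<^sub>F y in at x within S. h1 x - h2 x = h1 y - h2 y"
    unfolding eventually_at_topological
  proof (intro exI[of _ "U1 \<inter> U2"] conjI ballI impI)
    fix y assume "y \<in> U1 \<inter> U2" "y \<in> S"
    then have "h1 y - h1 x = f (H y) - f (H x)" "h2 y - h2 x = f (H y) - f (H x)"
      using U1(3) U2(3) by auto
    then show "h1 x - h2 x = h1 y - h2 y" by simp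
  qed (use U1 U2 in auto)
qed

lemma primitive_along_cong:
  assumes "primitive_along H S h" "\<And>x. x \<in> S \<Longrightarrow> H x = H' x" "\<And>x. x \<in> S \<Longrightarrow> h x = h' x"
  shows "primitive_along H' S h'"
  unfolding primitive_along_def
proof
  fix x assume x: "x \<in> S"
  obtain N f U where "(N, f) \<in> L" "H x \<in> N" "open U" "x \<in> U" "\<forall>y\<in>S \<inter> U. h y - h x = f (H y) - f (H x)"
    by (rule primitive_alongE[OF assms(1) x])
  then show "\<exists>N f U. (N, f) \<in> L \<and> H' x \<in> N \<and> open U \<and> x \<in> U \<and> (\<forall>y\<in>S \<inter> U. h' y - h' x = f (H' y) - f (H' x))"
    using x assms(2,3) by (intro exI[of _ N] exI[of _ f] exI[of _ U]) auto
qed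

lemma primitive_along_compose:
  assumes h: "primitive_along H S h" and g: "continuous_on T g" "g ` T \<subseteq> S"
  shows "primitive_along (\<lambda>t. H (g t)) T (\<lambda>t. h (g t))"
  unfolding primitive_along_def
proof
  fix t assume t: "t \<in> T"
  then have gt: "g t \<in> S"
    using g(2) by blast
  obtain N f U where U: "(N, f) \<in> L" "H (g t) \<in> N" "open U" "g t \<in> U"
      "\<forall>y\<in>S \<inter> U. h y - h (g t) = f (H y) - f (H (g t))"
    by (rule primitive_alongE[OF h gt])
  obtain V where "open V" "t \<in> V" "\<forall>y\<in>T. y \<in> V \<longrightarrow> g y \<in> U"
    by (rule continuous_on_open_nhd[OF g(1) t U(3,4)])
  then show "\<exists>N f U. (N, f) \<in> L \<and> H (g t) \<in> N \<and> open U \<and> t \<in> U \<and>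
      (\<forall>y\<in>T \<inter> U. h (g y) - h (g t) = f (H (g y)) - f (H (g t)))"
    using U g(2) by (intro exI[of _ N] exI[of _ f] exI[of _ V]) auto
qed

lemma primitive_along_subset:
  "primitive_along H S h \<Longrightarrow> T \<subseteq> S \<Longrightarrow> primitive_along H T h"
  using primitive_along_compose[of H S h T "\<lambda>x. x"] by auto

text \<open>Closedness separates a point from the piece that it does not belong to.\<close>

lemma primitive_along_Un:
  assumes closed: "closed A" "closed B" and H: "continuous_on (A \<union> B) H"
    and h: "primitive_along H A h" "primitive_along H B h"
  shows "primitive_along H (A \<union> B) h"
  unfolding primitive_along_def
proof
  fix x assume x: "x \<in> A \<union> B"
  obtain N f where L: "(N, f) \<in> L" "H x \<in> N"
    using cover by blast
  have local: "\<exists>U. open U \<and> x \<in> U \<and> (\<forall>y\<in>C \<inter> U. h y - h x = f (H y) - f (H x))"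
    if C: "closed C" "primitive_along H C h" "C \<subseteq> A \<union> B" for C
  proof (cases "x \<in> C")
    case True
    show ?thesis
      by (rule primitive_along_local[OF C(2) continuous_on_subset[OF H C(3)] L(1) True L(2)]) blast
  next
    case False
    with C(1) show ?thesis
      by (intro exI[of _ "- C"]) auto
  qed
  obtain U where U: "open U" "x \<in> U" "\<forall>y\<in>A \<inter> U. h y - h x = f (H y) - f (H x)"
    using local[OF closed(1) h(1)] by blast
  obtain V where V: "open V" "x \<in> V" "\<forall>y\<in>B \<inter> V. h y - h x = f (H y) - f (H x)"
    using local[OF closed(2) h(2)] by blast
  show "\<exists>N f U. (N, f) \<in> L \<and> H x \<in> N \<and> open U \<and> x \<in> U \<and> (\<forall>y\<in>(A \<union> B) \<inter> U. h y - h x = f (H y) - f (H x))"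
    using L U V by (intro exI[of _ N] exI[of _ f] exI[of _ "U \<inter> V"]) auto
qed

text \<open>A constant makes the two primitives agree at one point of the overlap, and then they agree on all
  of it because it is connected.\<close>

lemma primitive_along_glue:
  assumes closed: "closed A" "closed B" and H: "continuous_on (A \<union> B) H"
    and h: "primitive_along H A h1" "primitive_along H B h2" and AB: "connected (A \<inter> B)" "A \<inter> B \<noteq> {}"
  shows "\<exists>h. primitive_along H (A \<union> B) h"
proof -
  obtain x where x: "x \<in> A \<inter> B"
    using AB(2) by blast
  define h where "h y = (if y \<in> A then h1 y else h2 y + (h1 x - h2 x))" for y
  have shift: "primitive_along H B (\<lambda>y. h2 y + (h1 x - h2 x))"
    using h(2) by (simp add: primitive_along_def)
  have "h2 y + (h1 x - h2 x) = h y" if "y \<in> B" for y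
  proof (cases "y \<in> A")
    case True
    have "h1 x - h2 x = h1 y - h2 y"
      by (rule primitive_along_unique[OF AB(1) continuous_on_subset[OF H]
            primitive_along_subset[OF h(1)] primitive_along_subset[OF h(2)] x]) (use True that in auto)
    with True show ?thesis by (simp add: h_def)
  qed (simp add: h_def)
  then have "primitive_along H B h"
    by (intro primitive_along_cong[OF shift]) auto
  moreover have "primitive_along H A h"
    by (rule primitive_along_cong[OF h(1)]) (auto simp: h_def)
  ultimately show ?thesis
    using primitive_along_Un[OF closed H] by blast
qed

text \<open>Small rectangles are mapped into the domain of a local function. The rectangles are glued
  to strips, and the strips to the square, along segments, on which primitives are unique up to a
  constant.\<close>

lemma primitive_along_square:
  fixes H :: "real \<times> real \<Rightarrow> 'b"
  assumes H: "continuous_on ({0..1} \<times> {0..1}) H"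
  shows "\<exists>h. primitive_along H ({0..1} \<times> {0..1}) h"
proof -
  have strip: "\<exists>d>0. \<exists>h. primitive_along H (({s - d..s + d} \<inter> {0..1}) \<times> {0..1}) h" if s: "0 \<le> s" "s \<le> 1" for s
  proof -
    define I where "I d = {s - d..s + d} \<inter> {0..1}" for d
    have I: "closed (I d)" "convex (I d)" "I d \<subseteq> {0..1}" for d
      by (auto simp: I_def intro: convex_Int)
    have sI: "s \<in> I d" if "d > 0" for d
      using s that by (simp add: I_def)
    define P where "P u v \<longleftrightarrow> (0 \<le> u \<and> v \<le> 1 \<longrightarrow> (\<exists>d>0. \<exists>h. primitive_along H (I d \<times> {u..v}) h))" for u v
    have "P 0 1"
    proof (induction rule: Bolzano[of 0 1 P, OF zero_le_one])
      case (1 u v w)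
      show ?case
        unfolding P_def
      proof
        assume uw: "0 \<le> u \<and> w \<le> 1"
        obtain d1 h1 d2 h2 where d: "d1 > 0" "d2 > 0"
            and h: "primitive_along H (I d1 \<times> {u..v}) h1" "primitive_along H (I d2 \<times> {v..w}) h2"
          using 1 uw unfolding P_def by (metis order_trans)
        let ?d = "min d1 d2"
        have sub: "I ?d \<subseteq> I d1" "I ?d \<subseteq> I d2"
          by (auto simp: I_def)
        have Un: "I ?d \<times> {u..v} \<union> I ?d \<times> {v..w} = I ?d \<times> {u..w}"
          using 1(3,4) by auto
        have Int: "I ?d \<times> {u..v} \<inter> I ?d \<times> {v..w} = I ?d \<times> {v}"
          using 1(3,4) by auto
        have "\<exists>h. primitive_along H (I ?d \<times> {u..v} \<union> I ?d \<times> {v..w}) h"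
        proof (rule primitive_along_glue)
          show "continuous_on (I ?d \<times> {u..v} \<union> I ?d \<times> {v..w}) H"
            unfolding Un using uw I(3) by (intro continuous_on_subset[OF H]) auto
          show "primitive_along H (I ?d \<times> {u..v}) h1" "primitive_along H (I ?d \<times> {v..w}) h2"
            using sub by (auto intro!: primitive_along_subset[OF h(1)] primitive_along_subset[OF h(2)])
          show "connected (I ?d \<times> {u..v} \<inter> I ?d \<times> {v..w})"
            unfolding Int by (intro convex_connected convex_Times I) simp
          show "I ?d \<times> {u..v} \<inter> I ?d \<times> {v..w} \<noteq> {}"
            unfolding Int using sI[of ?d] d by auto
        qed (auto intro: closed_Times I)
        then show "\<exists>d>0. \<exists>h. primitive_along H (I d \<times> {u..w}) h"
          unfolding Un using d by (intro exI[of _ ?d]) auto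
      qed
    next
      case (2 t)
      obtain N f where L: "(N, f) \<in> L" "H (s, t) \<in> N"
        using cover by blast
      obtain A where A: "open A" "(s, t) \<in> A" "\<forall>z\<in>{0..1} \<times> {0..1}. z \<in> A \<longrightarrow> H z \<in> N"
        by (rule continuous_on_open_nhd[OF H _ open_dom[OF L(1)] L(2)]) (use 2 s in auto)
      obtain A1 A2 where A12: "open A1" "open A2" "(s, t) \<in> A1 \<times> A2" "A1 \<times> A2 \<subseteq> A"
        by (rule open_prod_elim[OF A(1,2)])
      obtain e1 where e1: "e1 > 0" "ball s e1 \<subseteq> A1"
        using A12(1,3) by (auto elim: openE)
      obtain e2 where e2: "e2 > 0" "ball t e2 \<subseteq> A2"
        using A12(2,3) by (auto elim: openE)
      have "P u v" if uv: "u \<le> t" "t \<le> v" "v - u < e2" for u v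
        unfolding P_def
      proof
        assume "0 \<le> u \<and> v \<le> 1"
        have "H z \<in> N" if "z \<in> I (e1 / 2) \<times> {u..v}" for z
        proof -
          have "fst z \<in> ball s e1" "snd z \<in> ball t e2"
            using that uv e1(1) by (auto simp: I_def dist_real_def)
          then have "z \<in> A1 \<times> A2"
            using e1(2) e2(2) by (auto simp: mem_Times_iff)
          moreover have "z \<in> {0..1} \<times> {0..1}"
            using that \<open>0 \<le> u \<and> v \<le> 1\<close> I(3) by auto
          ultimately show ?thesis
            using A(3) A12(4) by blast
        qed
        then have "primitive_along H (I (e1 / 2) \<times> {u..v}) (\<lambda>z. f (H z))"
          unfolding primitive_along_def using L(1)
          by (intro ballI exI[of _ N] exI[of _ f] exI[of _ UNIV]) auto
        with e1(1) show "\<exists>d>0. \<exists>h. primitive_along H (I d \<times> {u..v}) h"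
          by (intro exI[of _ "e1 / 2"]) auto
      qed
      with e2(1) show ?case by blast
    qed
    then show ?thesis
      by (simp add: P_def I_def)
  qed
  define P where "P a b \<longleftrightarrow> (0 \<le> a \<and> b \<le> 1 \<longrightarrow> (\<exists>h. primitive_along H ({a..b} \<times> {0..1}) h))" for a b
  have "P 0 1"
  proof (induction rule: Bolzano[of 0 1 P, OF zero_le_one])
    case (1 a b c)
    show ?case
      unfolding P_def
    proof
      assume ac: "0 \<le> a \<and> c \<le> 1"
      obtain h1 h2 where h: "primitive_along H ({a..b} \<times> {0..1}) h1" "primitive_along H ({b..c} \<times> {0..1}) h2"
        using 1 ac unfolding P_def by (metis order_trans)
      have Un: "{a..b} \<times> {0..1} \<union> {b..c} \<times> {0..1} = {a..c} \<times> {0..1::real}"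
        using 1(3,4) by auto
      have Int: "{a..b} \<times> {0..1} \<inter> {b..c} \<times> {0..1} = {b} \<times> {0..1::real}"
        using 1(3,4) by auto
      have "\<exists>h. primitive_along H ({a..b} \<times> {0..1} \<union> {b..c} \<times> {0..1}) h"
      proof (rule primitive_along_glue[OF _ _ _ h])
        show "continuous_on ({a..b} \<times> {0..1} \<union> {b..c} \<times> {0..1}) H"
          unfolding Un using ac by (intro continuous_on_subset[OF H]) auto
        show "connected ({a..b} \<times> {0..1} \<inter> {b..c} \<times> {0..1::real})"
          unfolding Int by (intro convex_connected convex_Times) auto
        show "{a..b} \<times> {0..1} \<inter> {b..c} \<times> {0..1::real} \<noteq> {}"
          unfolding Int by auto
      qed (auto intro: closed_Times)
      then show "\<exists>h. primitive_along H ({a..c} \<times> {0..1}) h"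
        unfolding Un .
    qed
  next
    case (2 s)
    obtain d h where d: "d > 0" and h: "primitive_along H (({s - d..s + d} \<inter> {0..1}) \<times> {0..1}) h"
      using strip[OF 2] by blast
    have "P a b" if "a \<le> s" "s \<le> b" "b - a < d" for a b
      unfolding P_def
    proof
      assume "0 \<le> a \<and> b \<le> 1"
      then have "{a..b} \<times> {0..1} \<subseteq> ({s - d..s + d} \<inter> {0..1}) \<times> {0..1}"
        using that by auto
      then show "\<exists>h. primitive_along H ({a..b} \<times> {0..1}) h"
        using primitive_along_subset[OF h] by blast
    qed
    with d show ?case by blast
  qed
  then show ?thesis
    by (simp add: P_def)
qed

lemma primitive_along_path:
  assumes "path p"
  shows "\<exists>h. primitive_along p {0..1} h"
proof -
  have "continuous_on ({0..1} \<times> {0..1}) (\<lambda>z :: real \<times> real. p (snd z))"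
    by (rule continuous_on_compose2[OF assms[unfolded path_def] continuous_on_snd[OF continuous_on_id]]) auto
  from primitive_along_square[OF this] obtain h
    where h: "primitive_along (\<lambda>z :: real \<times> real. p (snd z)) ({0..1} \<times> {0..1}) h"
    by blast
  have "primitive_along (\<lambda>t. p (snd (0 :: real, t))) {0..1} (\<lambda>t. h (0, t))"
    by (rule primitive_along_compose[OF h]) (auto intro!: continuous_intros)
  then show ?thesis by auto
qed

text \<open>In a homotopy of loops to a point, the two sides of the square run along the same curve, so the
  increment of the primitive is the same along all loops of the homotopy.\<close>

lemma primitive_along_loop:
  assumes sc: "simply_connected (UNIV :: 'b set)" and p: "path p" "pathfinish p = pathstart p"
    and h: "primitive_along p {0..1} h"
  shows "h 1 = h 0"
proof -
  have "path (\<lambda>t::real. p 0)"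
    by (simp add: path_def)
  then have "homotopic_loops UNIV p (\<lambda>t. p 0)"
    using sc p unfolding simply_connected_def by (simp add: pathstart_def pathfinish_def)
  then obtain H where H: "continuous_on ({0..1::real} \<times> {0..1::real}) H"
      and H0: "\<forall>x\<in>{0..1}. H (0, x) = p x" and H1: "\<forall>x\<in>{0..1}. H (1, x) = p 0"
      and ends: "\<forall>t\<in>{0..1}. pathfinish (H \<circ> Pair t) = pathstart (H \<circ> Pair t)"
    unfolding homotopic_loops by blast
  obtain k where k: "primitive_along H ({0..1} \<times> {0..1}) k"
    using primitive_along_square[OF H] by blast
  have edge: "primitive_along (\<lambda>t. H (g t)) {0..1} (\<lambda>t. k (g t))" "continuous_on {0..1} (\<lambda>t. H (g t))"
    if "continuous_on {0..1} g" "g ` {0..1} \<subseteq> {0..1} \<times> {0..1}" for g :: "real \<Rightarrow> real \<times> real"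
    using that primitive_along_compose[OF k that] continuous_on_compose2[OF H that(1)] by auto
  have left: "primitive_along (\<lambda>s. H (s, 0)) {0..1} (\<lambda>s. k (s, 0))"
    by (rule edge(1)[of "\<lambda>s. (s, 0)"]) (auto intro!: continuous_intros)
  have left_cont: "continuous_on {0..1} (\<lambda>s. H (s, 0))"
    by (rule edge(2)[of "\<lambda>s. (s, 0)"]) (auto intro!: continuous_intros)
  have "primitive_along (\<lambda>s. H (s, 1)) {0..1} (\<lambda>s. k (s, 1))"
    by (rule edge(1)[of "\<lambda>s. (s, 1)"]) (auto intro!: continuous_intros)
  then have right: "primitive_along (\<lambda>s. H (s, 0)) {0..1} (\<lambda>s. k (s, 1))"
    by (rule primitive_along_cong) (use ends in \<open>auto simp: pathstart_def pathfinish_def\<close>)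
  have bottom: "primitive_along p {0..1} (\<lambda>t. k (0, t))"
  proof (rule primitive_along_cong)
    show "primitive_along (\<lambda>t. H (0, t)) {0..1} (\<lambda>t. k (0, t))"
      by (rule edge(1)[of "\<lambda>t. (0, t)"]) (auto intro!: continuous_intros)
  qed (use H0 in auto)
  have top: "primitive_along (\<lambda>t. p 0) {0..1} (\<lambda>t. k (1, t))"
  proof (rule primitive_along_cong)
    show "primitive_along (\<lambda>t. H (1, t)) {0..1} (\<lambda>t. k (1, t))"
      by (rule edge(1)[of "\<lambda>t. (1, t)"]) (auto intro!: continuous_intros)
  qed (use H1 in auto)
  have const: "primitive_along (\<lambda>t::real. p 0) {0..1} (\<lambda>t. 0)"
    using cover[of "p 0"] unfolding primitive_along_def by auto
  have "k (0, 1) - k (0, 0) = k (1, 1) - k (1, 0)"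
    using primitive_along_unique[OF connected_Icc left_cont right left, of 0 1] by simp
  also have "\<dots> = 0"
    using primitive_along_unique[OF connected_Icc continuous_on_const top const, of 0 1] by simp
  finally show ?thesis
    using primitive_along_unique[OF connected_Icc p(1)[unfolded path_def] h bottom, of 0 1] by simp
qed

lemma primitive_along_increment:
  assumes "path p" "primitive_along p {0..1} h" "primitive_along p {0..1} k"
  shows "h 1 - h 0 = k 1 - k 0"
  using primitive_along_unique[OF connected_Icc assms(1)[unfolded path_def] assms(2,3), of 0 1] by simp

lemma primitive_along_halves:
  assumes pq: "path p" "path q" and h: "primitive_along (p +++ q) {0..1} h" and meet: "pathfinish p = pathstart q"
  shows "primitive_along p {0..1} (\<lambda>t. h (t / 2))" "primitive_along q {0..1} (\<lambda>t. h ((t + 1) / 2))"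
proof -
  have "primitive_along (\<lambda>t. (p +++ q) (t / 2)) {0..1} (\<lambda>t. h (t / 2))"
    by (rule primitive_along_compose[OF h]) (auto intro!: continuous_intros)
  then show "primitive_along p {0..1} (\<lambda>t. h (t / 2))"
    by (rule primitive_along_cong) (auto simp: joinpaths_def)
  have second: "primitive_along (\<lambda>t. (p +++ q) ((t + 1) / 2)) {0..1} (\<lambda>t. h ((t + 1) / 2))"
    by (rule primitive_along_compose[OF h]) (auto intro!: continuous_intros)
  have "(p +++ q) ((t + 1) / 2) = q t" if "t \<in> {0..1}" for t
  proof (cases "t = 0")
    case True
    then show ?thesis
      using meet by (simp add: joinpaths_def pathfinish_def pathstart_def)
  next
    case False
    with that have "\<not> (t + 1) / 2 \<le> 1 / 2" "2 * ((t + 1) / 2) - 1 = t"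
      by (auto simp: field_simps)
    then show ?thesis
      unfolding joinpaths_def by (simp only: if_False)
  qed
  then show "primitive_along q {0..1} (\<lambda>t. h ((t + 1) / 2))"
    by (rule primitive_along_cong[OF second]) auto
qed

text \<open>Going along \<open>p\<close> and back along \<open>q\<close> is a loop. Its primitive restricts to the two halves, so primitives
  never have to be joined.\<close>

lemma primitive_along_path_independent:
  assumes sc: "simply_connected (UNIV :: 'b set)" and pq: "path p" "path q"
    and ends: "pathstart p = pathstart q" "pathfinish p = pathfinish q"
    and h: "primitive_along p {0..1} h" and k: "primitive_along q {0..1} k"
  shows "h 1 - h 0 = k 1 - k 0"
proof -
  have meet: "pathfinish p = pathstart (reversepath q)"
    using ends by simp
  have path: "path (p +++ reversepath q)"
    using pq ends by simp
  obtain l where l: "primitive_along (p +++ reversepath q) {0..1} l"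
    using primitive_along_path[OF path] by blast
  have "path (reversepath q)"
    using pq(2) by simp
  note halves = primitive_along_halves[OF pq(1) this l meet]
  have "l 1 = l 0"
    by (rule primitive_along_loop[OF sc path _ l]) (use ends in simp)
  moreover have "primitive_along (\<lambda>t. reversepath q (1 - t)) {0..1} (\<lambda>t. l (((1 - t) + 1) / 2))"
    by (rule primitive_along_compose[OF halves(2)]) (auto intro!: continuous_intros)
  then have "primitive_along q {0..1} (\<lambda>t. l (((1 - t) + 1) / 2))"
    by (rule primitive_along_cong) (auto simp: reversepath_def)
  from primitive_along_increment[OF pq(2) k this] have "k 1 - k 0 = l (1 / 2) - l 1"
    by simp
  moreover have "h 1 - h 0 = l (1 / 2) - l 0"
    using primitive_along_increment[OF pq(1) h halves(1)] by simp
  ultimately show ?thesis by simp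
qed

text \<open>The function is the increment along any path from a fixed point. On paths that stay in one domain
  it varies like the local function, by continuing a path to the start with the given one.\<close>

lemma global_primitive:
  assumes sc: "simply_connected (UNIV :: 'b set)"
  obtains \<Psi> :: "'b \<Rightarrow> real" where "\<And>N f q. (N, f) \<in> L \<Longrightarrow> path q \<Longrightarrow> path_image q \<subseteq> N \<Longrightarrow>
    \<Psi> (pathfinish q) - \<Psi> (pathstart q) = f (pathfinish q) - f (pathstart q)"
proof -
  fix a :: 'b
  obtain p where p: "\<And>b. path (p b)" "\<And>b. pathstart (p b) = a" "\<And>b. pathfinish (p b) = b"
    using simply_connected_path_between[OF sc] by metis
  obtain h where h: "\<And>b. primitive_along (p b) {0..1} (h b)"
    using primitive_along_path[OF p(1)] by metis
  define \<Psi> where "\<Psi> b = h b 1 - h b 0" for b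
  show ?thesis
  proof (rule that[of \<Psi>])
    fix N f q assume L: "(N, f) \<in> L" and q: "path q" "path_image q \<subseteq> N"
    let ?b = "pathstart q" and ?c = "pathfinish q"
    have meet: "pathfinish (p ?b) = pathstart q"
      by (simp add: p)
    then have path: "path (p ?b +++ q)"
      using p(1) q(1) by simp
    obtain l where l: "primitive_along (p ?b +++ q) {0..1} l"
      using primitive_along_path[OF path] by blast
    note halves = primitive_along_halves[OF p(1) q(1) l meet]
    have "primitive_along q {0..1} (\<lambda>t. f (q t))"
      unfolding primitive_along_def using L q(2)
      by (intro ballI exI[of _ N] exI[of _ f] exI[of _ UNIV]) (auto simp: path_image_def)
    from primitive_along_increment[OF q(1) halves(2) this]
    have "l 1 - l (1 / 2) = f ?c - f ?b"
      by (simp add: pathstart_def pathfinish_def)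
    moreover have "\<Psi> ?b = l (1 / 2) - l 0"
      using primitive_along_increment[OF p(1) h halves(1)] by (simp add: \<Psi>_def)
    moreover have "\<Psi> ?c = l 1 - l 0"
      using primitive_along_path_independent[OF sc p(1) path _ _ h l, of ?c] by (simp add: \<Psi>_def p)
    ultimately show "\<Psi> ?c - \<Psi> ?b = f ?c - f ?b" by simp
  qed
qed

end

section \<open>Closed forms on simply connected manifolds\<close>

text \<open>The derivative is required in all charts, since the global function has to be smooth in all of
  them.\<close>

definition form_primitives :: "('b, 'e::locally_convex_space) atlas \<Rightarrow> ('b \<Rightarrow> 'e \<Rightarrow> real) \<Rightarrow> ('b::t2_space set \<times> ('b \<Rightarrow> real)) set" where
  "form_primitives A \<beta> = {(N, f). open N \<and> (\<forall>c\<in>A. \<forall>y\<in>snd c ` (fst c \<inter> N). \<forall>v.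
    has_dderiv (\<lambda>x. f (inv_into (fst c) (snd c) x)) y v (form1_rep A c \<beta> y v))}"

lemma form_primitivesD:
  assumes "(N, f) \<in> form_primitives A \<beta>"
  shows "open N" "c \<in> A \<Longrightarrow> y \<in> snd c ` (fst c \<inter> N) \<Longrightarrow>
    has_dderiv (\<lambda>x. f (inv_into (fst c) (snd c) x)) y v (form1_rep A c \<beta> y v)"
  using assms unfolding form_primitives_def by blast+

text \<open>A primitive found in one chart is one in any other chart by the chain rule and the transformation
  of a form under the change of charts.\<close>

lemma form_primitive_in_all_charts:
  assumes A: "manifold A" and c: "c \<in> A" and W: "W \<subseteq> snd c ` fst c" "open W"
    and f: "smooth_on W f" "\<And>x v. x \<in> W \<Longrightarrow> has_dderiv f x v (form1_rep A c \<beta> x v)"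
  shows "(inv_into (fst c) (snd c) ` W, \<lambda>p. f (snd c p)) \<in> form_primitives A \<beta>"
proof -
  note A' = manifold_imp_charted[OF A]
  let ?N = "inv_into (fst c) (snd c) ` W"
  have N_iff: "p \<in> ?N \<longleftrightarrow> p \<in> fst c \<and> snd c p \<in> W" for p
  proof
    assume "p \<in> ?N"
    then obtain x where x: "x \<in> W" "p = inv_into (fst c) (snd c) x"
      by blast
    with W(1) obtain q where "q \<in> fst c" "x = snd c q"
      by blast
    with x show "p \<in> fst c \<and> snd c p \<in> W"
      using A' c by simp
  next
    assume "p \<in> fst c \<and> snd c p \<in> W"
    then show "p \<in> ?N"
      using A' c by (intro image_eqI[of _ _ "snd c p"]) simp_all
  qed
  have "?N = fst c \<inter> snd c -` W"
    using N_iff by blast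
  moreover have "continuous_on (fst c) (snd c)"
    using A c by (auto simp: manifold_def homeomorphism_def)
  ultimately have "open ?N"
    using continuous_open_preimage[OF _ manifold_open_chart(1)[OF A c] W(2)] by metis
  moreover have "has_dderiv (\<lambda>x. f (snd c (inv_into (fst e) (snd e) x))) y v (form1_rep A e \<beta> y v)"
    if e: "e \<in> A" and y: "y \<in> snd e ` (fst e \<inter> ?N)" for e y v
  proof -
    let ?t = "local_rep e c (\<lambda>p. p)"
    obtain p where p: "p \<in> fst e" "p \<in> fst c" "snd c p \<in> W" "y = snd e p"
      using y N_iff by auto
    have y': "y \<in> snd e ` (fst e \<inter> UNIV \<inter> (\<lambda>p. p) -` fst c)"
      using p by auto
    have ty: "?t y = snd c p"
      using p A' e by (simp add: local_rep_def)
    have "has_dderiv (\<lambda>x. f (?t x)) y v (dderiv f (?t y) (dderiv ?t y v))"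
      by (rule has_dderiv_compose[where g = f, OF smooth_on_imp_C1_on[OF f(1)] _
            smooth_on_has_dderiv[OF smooth_map_on_local_rep[OF smooth_map_on_ident[OF A] e c] y']])
        (simp add: ty p(3))
    moreover have "dderiv f (?t y) (dderiv ?t y v) = form1_rep A c \<beta> (?t y) (dderiv ?t y v)"
      by (rule has_dderiv_imp_eq[OF f(2)]) (simp add: ty p(3))
    moreover have "\<dots> = form1_rep A e \<beta> y v"
      using form1_rep_pullback[where \<beta> = \<beta> and \<alpha> = \<beta>, OF A A smooth_map_on_ident[OF A] _ e c y', of v]
      by (simp add: tangent_map_ident[OF A])
    ultimately show ?thesis
      by (simp add: local_rep_def)
  qed
  ultimately show ?thesis
    by (simp add: form_primitives_def)
qed

text \<open>The neighbourhood is convex in a chart, so that its points are joined to \<open>b\<close> by the images of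
  segments.\<close>

lemma closed_form1_local_primitive:
  assumes A: "manifold A" and \<beta>: "form1 A \<beta>"
    and closed: "\<And>c y X Y. c \<in> A \<Longrightarrow> y \<in> snd c ` fst c \<Longrightarrow>
      dderiv (\<lambda>y. form1_rep A c \<beta> y Y) y X = dderiv (\<lambda>y. form1_rep A c \<beta> y X) y (Y :: 'e::locally_convex_space)"
  shows "\<exists>N f. (N, f) \<in> form_primitives A \<beta> \<and> b \<in> N \<and>
    (\<forall>b'\<in>N. \<exists>q. path q \<and> path_image q \<subseteq> N \<and> pathstart q = b \<and> pathfinish q = (b' :: 'b::t2_space))"
proof -
  note A' = manifold_imp_charted[OF A]
  define c where "c = chart_at A b"
  have c: "c \<in> A" "b \<in> fst c"
    using chart_at[OF A'] by (auto simp: c_def)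
  let ?i = "inv_into (fst c) (snd c)" and ?b = "snd c b"
  have b: "?b \<in> snd c ` fst c"
    using c by blast
  obtain W where W: "open W" "convex W" "?b \<in> W" "W \<subseteq> snd c ` fst c"
    by (rule open_convex_nhd[OF manifold_open_chart(2)[OF A c(1)] b])
  have sm: "smooth_on (W \<times> UNIV) (\<lambda>(x, v). form1_rep A c \<beta> x v)"
    using W by (intro smooth_on_subset[OF form1_rep_smooth[OF \<beta> c(1)]]) (auto simp: open_Times)
  have "\<exists>f. \<forall>x\<in>W. \<forall>v. has_dderiv f x v (form1_rep A c \<beta> x v)"
  proof (rule closed_form_has_primitive[OF W(1,2,3) sm])
    fix x assume "x \<in> W"
    then have x: "x \<in> snd c ` fst c"
      using W(4) by blast
    show "linear (form1_rep A c \<beta> x)"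
      by (rule form1_rep_linear[OF A \<beta> c(1) x])
    show "dderiv (\<lambda>x. form1_rep A c \<beta> x Y) x X = dderiv (\<lambda>x. form1_rep A c \<beta> x X) x Y" for X Y
      by (rule closed[OF c(1) x])
  qed
  then obtain f where f: "\<And>x v. x \<in> W \<Longrightarrow> has_dderiv f x v (form1_rep A c \<beta> x v)"
    by blast
  have "(?i ` W, \<lambda>p. f (snd c p)) \<in> form_primitives A \<beta>"
    by (rule form_primitive_in_all_charts[OF A c(1) W(4,1) primitive_smooth_on[OF W(1) f sm] f])
  moreover have "b \<in> ?i ` W"
    using W(3) A' c by (intro image_eqI[of _ _ ?b]) simp_all
  moreover have "\<exists>q. path q \<and> path_image q \<subseteq> ?i ` W \<and> pathstart q = b \<and> pathfinish q = ?i y" if y: "y \<in> W" for y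
  proof -
    define l where "l t = ?b + t *\<^sub>R (y - ?b)" for t
    have l: "l t \<in> W" if "t \<in> {0..1}" for t
      using convexD[OF W(2,3) y, of "1 - t" t] that by (simp add: l_def algebra_simps)
    have "continuous_on {0..1} l"
      unfolding l_def by (intro continuous_on_add continuous_on_const continuous_on_scaleR_lcs continuous_on_id)
    moreover have "continuous_on (snd c ` fst c) ?i"
      using A c(1) by (auto simp: manifold_def homeomorphism_def)
    ultimately have "continuous_on {0..1} (\<lambda>t. ?i (l t))"
      using l W(4) by (intro continuous_on_compose2[of "snd c ` fst c" ?i "{0..1}" l]) auto
    then show ?thesis
      using l A' c by (intro exI[of _ "\<lambda>t. ?i (l t)"])
        (auto simp: path_def path_image_def pathstart_def pathfinish_def l_def)
  qed
  ultimately show ?thesis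
    by (intro exI[of _ "?i ` W"] exI[of _ "\<lambda>p. f (snd c p)"]) auto
qed

text \<open>Two primitives of the same form differ by a function with vanishing derivative, which is
  constant on the segments of a convex set in a chart.\<close>

lemma form_primitives_compat:
  assumes A: "manifold A" and f: "(N1, f1) \<in> form_primitives A \<beta>" "(N2, f2) \<in> form_primitives A \<beta>"
    and b: "b \<in> N1" "b \<in> N2"
  shows "\<exists>K. open K \<and> b \<in> K \<and> (\<forall>y\<in>K. f1 y - f1 b = f2 y - f2 b)"
proof -
  note A' = manifold_imp_charted[OF A]
  define c where "c = chart_at A b"
  have c: "c \<in> A" "b \<in> fst c"
    using chart_at[OF A'] by (auto simp: c_def)
  let ?i = "inv_into (fst c) (snd c)" and ?b = "snd c b"
  have N: "open (N1 \<inter> N2)"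
    using form_primitivesD(1)[OF f(1)] form_primitivesD(1)[OF f(2)] by (rule open_Int)
  have "?b \<in> snd c ` (fst c \<inter> (N1 \<inter> N2))"
    using c b by blast
  then obtain W where W: "open W" "convex W" "?b \<in> W" "W \<subseteq> snd c ` (fst c \<inter> (N1 \<inter> N2))"
    by (rule open_convex_nhd[OF manifold_open_image[OF A c(1) N]])
  have const: "f1 (?i y) - f1 b = f2 (?i y) - f2 b" if y: "y \<in> W" for y
  proof -
    let ?l = "\<lambda>t. ?b + t *\<^sub>R (y - ?b)"
    define k where "k t = f1 (?i (?l t)) + (- 1) *\<^sub>R f2 (?i (?l t))" for t
    have k: "(k has_real_derivative 0) (at t)" if "0 \<le> t" "t \<le> 1" for t
    proof -
      let ?r = "form1_rep A c \<beta> (?l t) (y - ?b)"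
      have "?l t \<in> W"
        using convexD[OF W(2,3) y, of "1 - t" t] that by (simp add: algebra_simps)
      then have "?l t \<in> snd c ` (fst c \<inter> N1)" "?l t \<in> snd c ` (fst c \<inter> N2)"
        using W(4) by blast+
      then have "has_dderiv (\<lambda>x. f1 (?i x)) (?l t) (y - ?b) ?r" "has_dderiv (\<lambda>x. f2 (?i x)) (?l t) (y - ?b) ?r"
        using form_primitivesD(2)[OF f(1) c(1)] form_primitivesD(2)[OF f(2) c(1)] by blast+
      from has_dderiv_add[OF has_dderiv_along_line[OF this(1)] has_dderiv_scaleR[OF has_dderiv_along_line[OF this(2)]], of "- 1"]
      show ?thesis
        by (simp add: k_def[abs_def] has_dderiv_real_iff)
    qed
    have "continuous_on {0..1} k"
      using k by (intro continuous_at_imp_continuous_on ballI) (auto intro: DERIV_isCont)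
    then have "k 1 = k 0"
      using k by (intro DERIV_isconst_end) auto
    then show ?thesis
      using A' c by (simp add: k_def)
  qed
  have "open (fst c \<inter> snd c -` W)"
    using A c(1) by (intro continuous_open_preimage W manifold_open_chart) (auto simp: manifold_def homeomorphism_def)
  moreover have "f1 p - f1 b = f2 p - f2 b" if "p \<in> fst c \<inter> snd c -` W" for p
    using const[of "snd c p"] that A' c by simp
  ultimately show ?thesis
    using c W(3) by (intro exI[of _ "fst c \<inter> snd c -` W"]) auto
qed

text \<open>The Poincare lemma gives local primitives, and simple connectedness glues them.\<close>

lemma closed_form1_exact:
  fixes A :: "('b::t2_space, 'e::locally_convex_space) atlas"
  assumes A: "manifold A" and \<beta>: "form1 A \<beta>"
    and closed: "\<And>c y X Y. c \<in> A \<Longrightarrow> y \<in> snd c ` fst c \<Longrightarrow>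
      dderiv (\<lambda>y. form1_rep A c \<beta> y Y) y X = dderiv (\<lambda>y. form1_rep A c \<beta> y X) y Y"
    and sc: "simply_connected (UNIV :: 'b set)"
  shows "\<exists>\<Psi> :: 'b \<Rightarrow> real. smooth_map A model_atlas \<Psi> \<and> (\<forall>b X. \<beta> b X = tangent_map A model_atlas \<Psi> b X)"
proof -
  note A' = manifold_imp_charted[OF A]
  note loc = closed_form1_local_primitive[OF A \<beta> closed]
  interpret local_primitives "form_primitives A \<beta>"
  proof
    show "\<exists>N f. (N, f) \<in> form_primitives A \<beta> \<and> b \<in> N" for b
      using loc[of b] by blast
    show "(N, f) \<in> form_primitives A \<beta> \<Longrightarrow> open N" for N f
      by (rule form_primitivesD)
  qed (rule form_primitives_compat[OF A])
  obtain \<Psi> where \<Psi>: "\<And>N f q. (N, f) \<in> form_primitives A \<beta> \<Longrightarrow> path q \<Longrightarrow> path_image q \<subseteq> N \<Longrightarrow>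
      \<Psi> (pathfinish q) - \<Psi> (pathstart q) = f (pathfinish q) - f (pathstart q)"
    using global_primitive[OF sc] by metis
  have der: "has_dderiv (\<lambda>x. \<Psi> (inv_into (fst c) (snd c) x)) y v (form1_rep A c \<beta> y v)"
    if c: "c \<in> A" and y: "y \<in> snd c ` fst c" for c y v
  proof -
    let ?i = "inv_into (fst c) (snd c)"
    obtain b where b: "b \<in> fst c" "y = snd c b"
      using y by blast
    obtain N f where N: "(N, f) \<in> form_primitives A \<beta>" "b \<in> N"
        and q: "\<forall>b'\<in>N. \<exists>q. path q \<and> path_image q \<subseteq> N \<and> pathstart q = b \<and> pathfinish q = b'"
      using loc[of b] by blast
    have diff: "\<Psi> b' = f b' + (\<Psi> b - f b)" if b': "b' \<in> N" for b'
    proof -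
      obtain q where "path q" "path_image q \<subseteq> N" "pathstart q = b" "pathfinish q = b'"
        using q b' by blast
      with \<Psi>[OF N(1), of q] show ?thesis by simp
    qed
    have U: "open (snd c ` (fst c \<inter> N))" "y \<in> snd c ` (fst c \<inter> N)"
      using manifold_open_image[OF A c open_dom[OF N(1)]] b N(2) by auto
    have "has_dderiv (\<lambda>x. f (?i x)) y v (form1_rep A c \<beta> y v)"
      by (rule form_primitivesD(2)[OF N(1) c U(2)])
    from has_dderiv_add[OF this has_dderiv_const[of "\<Psi> b - f b"]]
    have "has_dderiv (\<lambda>x. f (?i x) + (\<Psi> b - f b)) y v (form1_rep A c \<beta> y v)"
      by simp
    moreover have "\<Psi> (?i x) = f (?i x) + (\<Psi> b - f b)" if "x \<in> snd c ` (fst c \<inter> N)" for x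
      using that A' c by (intro diff) auto
    ultimately show ?thesis
      using has_dderiv_cong[OF U, of "\<lambda>x. \<Psi> (?i x)" "\<lambda>x. f (?i x) + (\<Psi> b - f b)"] by simp
  qed
  have smooth: "smooth_on (snd c ` fst c) (\<lambda>x. \<Psi> (inv_into (fst c) (snd c) x))" if c: "c \<in> A" for c
    by (rule primitive_smooth_on[OF manifold_open_chart(2)[OF A c] der[OF c] form1_rep_smooth[OF \<beta> c]])
  have "smooth_map A model_atlas \<Psi>"
  proof (rule smooth_map_onI)
    have "continuous_on (fst c) \<Psi>" if c: "c \<in> A" for c
    proof -
      have "continuous_on (fst c) (\<lambda>p. \<Psi> (inv_into (fst c) (snd c) (snd c p)))"
        by (rule continuous_on_compose2[OF smooth_on_imp_continuous_on[OF smooth[OF c]]])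
          (use A c in \<open>auto simp: manifold_def homeomorphism_def\<close>)
      then show ?thesis
        by (subst (asm) continuous_on_cong[OF refl, where g = \<Psi>]) (use A' c in auto)
    qed
    then have "continuous_on (\<Union>c\<in>A. fst c) \<Psi>"
      by (intro continuous_on_open_UN manifold_open_chart[OF A])
    then show "continuous_on UNIV \<Psi>"
      using A' by (simp add: charted_def)
    show "smooth_on (snd c ` (fst c \<inter> UNIV \<inter> \<Psi> -` fst d)) (local_rep c d \<Psi>)"
      if "c \<in> A" "d \<in> model_atlas" for c d
      using smooth[OF that(1)] that(2) by (simp add: local_rep_def o_def)
  qed simp
  moreover have "\<beta> b X = tangent_map A model_atlas \<Psi> b X" for b X
  proof -
    have "snd (chart_at A b) b \<in> snd (chart_at A b) ` fst (chart_at A b)"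
      using chart_at[OF A'] by blast
    from has_dderiv_imp_eq[OF der[OF chart_at(1)[OF A'] this]] show ?thesis
      by (simp add: tangent_map_eq local_rep_def o_def form1_rep_chart_at[OF A])
  qed
  ultimately show ?thesis by blast
qed

section \<open>The form of an orbit on the base\<close>

theorem theorem2p14:
  fixes G :: "'g::t2_space monoid" and GA :: "('g, 'k::locally_convex_space) atlas"
    and MA :: "('m::t2_space, 'em::locally_convex_space) atlas"
    and PA :: "('p::t2_space, 'ep::locally_convex_space) atlas"
    and BA :: "('b::t2_space, 'eb::locally_convex_space) atlas"
    and \<omega> :: "'m \<Rightarrow> 'em \<Rightarrow> 'em \<Rightarrow> real" and actM :: "'g \<Rightarrow> 'm \<Rightarrow> 'm"
    and \<kappa> :: "'d::locally_convex_space \<Rightarrow> 'k \<Rightarrow> real" and Ads :: "'g \<Rightarrow> 'd \<Rightarrow> 'd"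
    and J :: "'m \<Rightarrow> 'd" and \<sigma> :: "'g \<Rightarrow> 'd"
    and br :: "'a::locally_convex_space \<Rightarrow> 'a \<Rightarrow> 'a" and \<gg> :: "'a set"
    and \<iota> :: "'k \<Rightarrow> 'a" and Ad :: "'g \<Rightarrow> 'a \<Rightarrow> 'a"
    and actP :: "'g \<Rightarrow> 'p \<Rightarrow> 'p" and \<pi> :: "'p \<Rightarrow> 'b" and \<theta> :: "'p \<Rightarrow> 'ep \<Rightarrow> 'a"
    and chi :: "'p \<Rightarrow> 'm" and m :: 'm and \<kappa>\<^sub>a :: "'d \<Rightarrow> 'a \<Rightarrow> real"
  assumes "manifold MA" and "symplectic_form MA \<omega>"
    and "lie_group G GA" and "symplectic_action G GA MA \<omega> actM"
    and "nondegenerate_pairing \<kappa>" and "coadjoint G GA \<kappa> Ads"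
    and "momentum_map G GA MA \<omega> actM \<kappa> J"
    and "nonequivariance_cocycle G actM Ads J \<sigma>"
    and "klein_pair br \<gg> G GA \<iota> Ad"
    and "cartan_geometry G GA \<iota> Ad PA BA actP \<pi> \<theta>"
    and "orbit_through br PA actP MA actM m chi"
    and "duality G \<gg> Ad Ads \<kappa>\<^sub>a"
    and "a_equivariant br PA MA chi \<theta> \<kappa>\<^sub>a J \<sigma>"
  shows "basic_form PA BA \<pi> (orbit_form \<kappa>\<^sub>a J chi \<theta>) \<and>
      (\<exists>!\<beta>. form1 BA \<beta> \<and> orbit_form \<kappa>\<^sub>a J chi \<theta> = pullback1 PA BA \<pi> \<beta>) \<and>
    (\<forall>p X Y. ext_deriv1 PA (orbit_form \<kappa>\<^sub>a J chi \<theta>) p X Y = \<kappa>\<^sub>a (J (chi p)) (curvature br PA \<theta> p X Y)) \<and>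
    (torsion_free br \<gg> PA \<theta> \<longrightarrow>
      (\<forall>p X Y. ext_deriv1 PA (orbit_form \<kappa>\<^sub>a J chi \<theta>) p X Y = 0)) \<and>
    (\<forall>\<beta>. form1 BA \<beta> \<and> orbit_form \<kappa>\<^sub>a J chi \<theta> = pullback1 PA BA \<pi> \<beta> \<longrightarrow>
      (torsion_free br \<gg> PA \<theta> \<longrightarrow> (\<forall>b X Y. ext_deriv1 BA \<beta> b X Y = 0)) \<and>
      (simply_connected (UNIV :: 'b set) \<and> torsion_free br \<gg> PA \<theta> \<longrightarrow>
        (\<exists>\<Psi> :: 'b \<Rightarrow> real. smooth_map BA model_atlas \<Psi> \<and>
          (\<forall>b X. \<beta> b X = tangent_map BA model_atlas \<Psi> b X))))"
proof -
  let ?\<alpha> = "orbit_form \<kappa>\<^sub>a J chi \<theta>"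
  have principal: "principal_bundle G GA PA BA actP \<pi>" and \<theta>: "form1 PA \<theta>" and iso: "\<And>p. tvs_iso (\<theta> p)"
    and \<theta>_equi: "\<And>g p X. \<theta> (actP g p) (tangent_map PA PA (actP g) p X) = Ad g (\<theta> p X)"
    and \<theta>_fund: "\<And>\<xi> p. \<theta> p (fundamental_vf G GA PA actP \<xi> p) = \<iota> \<xi>"
    using assms(10) by (auto simp: cartan_geometry_def)
  have PA: "manifold PA" and BA: "manifold BA"
    using principal by (auto simp: principal_bundle_def)
  have chi: "smooth_map PA MA chi" and chi_equi: "\<And>g p. chi (actP g p) = actM g (chi p)"
    using assms(11) by (auto simp: orbit_through_def)
  have J: "smooth_map MA model_atlas J"
    using assms(7) by (auto simp: momentum_map_def)
  have \<sigma>: "\<And>g m. J (actM g m) = Ads (inv\<^bsub>G\<^esub> g) (J m) + \<sigma> g"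
    using assms(8) by (auto simp: nonequivariance_cocycle_def)
  have \<kappa>: "continuous_bilinear \<kappa>\<^sub>a" and \<kappa>_inv: "\<And>g \<mu> \<xi>. \<kappa>\<^sub>a (Ads (inv\<^bsub>G\<^esub> g) \<mu>) (Ad g \<xi>) = \<kappa>\<^sub>a \<mu> \<xi>"
    and \<kappa>_\<gg>: "\<And>\<mu> \<xi>. \<xi> \<in> \<gg> \<Longrightarrow> \<kappa>\<^sub>a \<mu> \<xi> = 0"
    using assms(12) by (auto simp: duality_def)
  have calabi: "\<And>p \<xi> \<eta>. \<kappa>\<^sub>a (calabi PA MA chi \<theta> J p \<xi>) \<eta> - \<kappa>\<^sub>a (calabi PA MA chi \<theta> J p \<eta>) \<xi> = - \<kappa>\<^sub>a (J (chi p)) (br \<xi> \<eta>)"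
    and \<kappa>_\<sigma>: "\<And>g \<xi>. \<kappa>\<^sub>a (\<sigma> g) \<xi> = 0"
    using assms(13) by (auto simp: a_equivariant_def)
  have \<iota>: "\<iota> \<xi> \<in> \<gg>" for \<xi>
    using assms(9) by (auto simp: klein_pair_def homeomorphism_def)
  have \<kappa>_lin: "linear (\<kappa>\<^sub>a \<mu>)" "linear (\<lambda>\<mu>. \<kappa>\<^sub>a \<mu> \<xi>)" for \<mu> \<xi>
    using \<kappa> by (auto simp: continuous_bilinear_def bilinear_def)
  note PA' = manifold_imp_charted[OF PA] and MA' = manifold_imp_charted[OF assms(1)]
  have J\<chi>: "smooth_map PA model_atlas (\<lambda>p. J (chi p))"
    using smooth_map_on_compose[OF PA' MA' chi J] by (simp add: o_def)
  have \<alpha>: "form1 PA ?\<alpha>"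
    by (rule form1_orbit_form[where J = J and chi = chi, OF PA J\<chi> \<theta> \<kappa>])
  \<comment> \<open>Invariance: the cocycle is invisible to \<open>\<kappa>\<^sub>a\<close>, which pairs \<open>Ad\<^sup>*\<close> and \<open>Ad\<close> invariantly. Horizontality:
    fundamental vector fields have values in \<open>\<gg>\<close>, where \<open>\<kappa>\<^sub>a\<close> vanishes.\<close>
  have inv: "?\<alpha> (actP g p) (tangent_map PA PA (actP g) p X) = ?\<alpha> p X" for g p X
    by (simp add: orbit_form_def \<theta>_equi chi_equi \<sigma> linear_add[OF \<kappa>_lin(2)] \<kappa>_inv \<kappa>_\<sigma>)
  have hor: "?\<alpha> p (fundamental_vf G GA PA actP \<xi> p) = 0" for \<xi> p
    by (simp add: orbit_form_def \<theta>_fund \<kappa>_\<gg> \<iota>)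
  have ex1: "\<exists>!\<beta>. form1 BA \<beta> \<and> ?\<alpha> = pullback1 PA BA \<pi> \<beta>"
    by (rule invariant_horizontal_form_basic[OF principal assms(3) \<alpha> inv hor])
  \<comment> \<open>The first two terms of the product rule are the antisymmetrised Calabi operator, which
    equivariance turns into the bracket term of the curvature.\<close>
  have d\<alpha>: "ext_deriv1 PA ?\<alpha> p X Y = \<kappa>\<^sub>a (J (chi p)) (curvature br PA \<theta> p X Y)" for p X Y
  proof -
    have "inj (\<theta> p)"
      using iso[of p] unfolding tvs_iso_def homeomorphism_def by (metis UNIV_I inj_on_inverseI)
    then have C: "tangent_map PA model_atlas (\<lambda>p. J (chi p)) p Z = calabi PA MA chi \<theta> J p (\<theta> p Z)" for Z
      using tangent_map_compose[OF PA' MA' charted_model_atlas chi J, of p Z] by (simp add: calabi_def rho_def)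
    show ?thesis
      unfolding ext_deriv1_orbit_form[where J = J and chi = chi, OF PA J\<chi> \<theta> \<kappa>] C calabi
      by (simp add: curvature_def linear_diff[OF \<kappa>_lin(1)])
  qed
  have closed: "ext_deriv1 PA ?\<alpha> p X Y = 0" if "torsion_free br \<gg> PA \<theta>" for p X Y
    using that by (simp add: d\<alpha> torsion_free_def \<kappa>_\<gg>)
  have sym: "dderiv (\<lambda>y. form1_rep BA c \<beta> y Y) y X = dderiv (\<lambda>y. form1_rep BA c \<beta> y X) y Y"
    if "torsion_free br \<gg> PA \<theta>" "?\<alpha> = pullback1 PA BA \<pi> \<beta>" "c \<in> BA" "y \<in> snd c ` fst c" for \<beta> c y X Y
    by (rule closed_pullback_imp_closed_in_charts[OF principal assms(3) \<alpha> that(2) closed[OF that(1)] that(3,4)])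
  have "ext_deriv1 BA \<beta> b X Y = 0"
    if "torsion_free br \<gg> PA \<theta>" "?\<alpha> = pullback1 PA BA \<pi> \<beta>" for \<beta> b X Y
    using sym[OF that chart_at(1)[OF manifold_imp_charted[OF BA]] imageI[OF chart_at(2)[OF manifold_imp_charted[OF BA]]]]
    by (simp add: ext_deriv1_def Let_def)
  moreover have "\<exists>\<Psi> :: 'b \<Rightarrow> real. smooth_map BA model_atlas \<Psi> \<and> (\<forall>b X. \<beta> b X = tangent_map BA model_atlas \<Psi> b X)"
    if "form1 BA \<beta>" "?\<alpha> = pullback1 PA BA \<pi> \<beta>" "torsion_free br \<gg> PA \<theta>" "simply_connected (UNIV :: 'b set)" for \<beta>
    by (rule closed_form1_exact[OF BA that(1) sym[OF that(3,2)] that(4)])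
  moreover have "basic_form PA BA \<pi> ?\<alpha>"
    using \<alpha> ex1 unfolding basic_form_def by blast
  ultimately show ?thesis
    using ex1 d\<alpha> closed by blast
qed

end
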